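(* Let $r_0,r_1,r_2$ be positive integers. Suppose that $(\alpha_1,\alpha_2)=(0,0)$ is the only pair of real numbers for which there exists a $(0,\alpha_1,\alpha_2)$-semistable linear $3$-chain of type $(r_0,r_1,r_2)$ over the function field $\mathbb{C}(X)$. Then, for all integers $d_0,d_1,d_2$, with $t=(r_0,r_1,r_2;d_0,d_1,d_2)$, there is a bounded region $R(t)\subset\mathbb{R}^2$ such that the existence of a $(0,\alpha_1,\alpha_2)$-semistable holomorphic $3$-chain of type $t$ on $X$ implies $(\alpha_1,\alpha_2)\in R(t)$.
   Context: $X$ is a compact Riemann surface of genus $g\ge 2$, with function field $\mathbb{C}(X)$. A holomorphic $3$-chain is a tuple $C=(E_0,E_1,E_2;\phi_1,\phi_2)$ of vector bundles on $X$ with homomorphisms $\phi_i:E_i\to E_{i-1}$; its type is $(\operatorname{rk}E_0,\operatorname{rk}E_1,\operatorname{rk}E_2;\deg E_0,\deg E_1,\deg E_2)$. A subchain is a tuple of subsheaves $F_j\subseteq E_j$ with $\phi_i(F_i)\subseteq F_{i-1}$. For $\alpha=(\alpha_0,\alpha_1,\alpha_2)\in\mathbb{R}^3$, $\mu_\alpha(C)=\frac{\sum_j(\deg E_j+\alpha_j\operatorname{rk}E_j)}{\sum_j\operatorname{rk}E_j}$, and $C$ is $\alpha$-semistable if $\mu_\alpha(C')\le\mu_\alpha(C)$ for every subchain $C'\ne 0,C$. A linear $3$-chain of type $(r_0,r_1,r_2)$ over a field $k$ is a tuple $V=(V_0,V_1,V_2;f_1,f_2)$ of $k$-vector spaces with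 $\dim V_j=r_j$ and linear maps $f_i:V_i\to V_{i-1}$. It is $\alpha$-semistable if for every non-zero subchain $(W_0,W_1,W_2)$ (subspaces $W_j\subseteq V_j$ with $f_i(W_i)\subseteq W_{i-1}$) one has $\frac{\sum_j\alpha_j\dim W_j}{\sum_j\dim W_j}\le\frac{\sum_j\alpha_j\dim V_j}{\sum_j\dim V_j}$. *)

theory Defs
  imports
    "HOL-Complex_Analysis.Complex_Analysis"
    "HOL-Library.Function_Algebras"
    "Jordan_Normal_Form.Determinant"
begin

section \<open>Riemann surfaces\<close>

type_synonym 'a chart = "'a set \<times> ('a \<Rightarrow> complex)"

text \<open>The atlas need not be maximal: every notion below is invariant under holomorphic
  changes of chart. Condition \<open>charts_homeo\<close> says that a chart is a homeomorphism from an open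
  set onto an open set.\<close>

class riemann_surface = t2_space +
  fixes charts :: "('a set \<times> ('a \<Rightarrow> complex)) set"
  assumes charts_cover: "(\<Union>(U, z)\<in>charts. U) = UNIV"
    and charts_homeo:
      "(U, z) \<in> charts \<Longrightarrow> open U \<and> inj_on z U \<and> (\<forall>T\<subseteq>U. open T \<longleftrightarrow> open (z ` T))"
    and charts_compatible:
      "(U, z) \<in> charts \<Longrightarrow> (V, w) \<in> charts \<Longrightarrow> (w \<circ> inv_into U z) holomorphic_on z ` (U \<inter> V)"
    and connected_surface: "connected (UNIV :: 'a set)"

class compact_riemann_surface = riemann_surface +
  assumes compact_surface: "compact (UNIV :: 'a set)"

lemma charts_homeomorphism:
  assumes c: "(U, z) \<in> charts"
  shows "open U \<and> open (z ` U) \<and> homeomorphism U (z ` U) z (inv_into U z)"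
proof -
  have o: "open U" and inj: "inj_on z U" and T: "\<And>T. T \<subseteq> U \<Longrightarrow> open T \<longleftrightarrow> open (z ` T)"
    using charts_homeo[OF c] by auto
  have oz: "open (z ` U)" using o T by blast
  have "continuous_on U z"
    unfolding continuous_on_open_vimage[OF o]
  proof (intro allI impI)
    fix B :: "complex set" assume "open B"
    moreover have "z ` (z -` B \<inter> U) = B \<inter> z ` U" by auto
    ultimately show "open (z -` B \<inter> U)" using T[of "z -` B \<inter> U"] oz by auto
  qed
  moreover have "continuous_on (z ` U) (inv_into U z)"
    unfolding continuous_on_open_vimage[OF oz]
  proof (intro allI impI)
    fix B :: "'a set" assume "open B"
    moreover have "inv_into U z -` B \<inter> z ` U = z ` (B \<inter> U)"
      using inj by (auto simp: inv_into_f_f)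
    ultimately show "open (inv_into U z -` B \<inter> z ` U)" using T[of "B \<inter> U"] o by auto
  qed
  ultimately show ?thesis
    using o oz inj by (auto simp: homeomorphism_def inv_into_f_f image_image)
qed

definition holo_fun :: "'a::riemann_surface set \<Rightarrow> ('a \<Rightarrow> complex) \<Rightarrow> bool" where
  "holo_fun U f \<longleftrightarrow> (\<forall>(V, z)\<in>charts. (f \<circ> inv_into V z) holomorphic_on z ` (U \<inter> V))"

definition mero_fun :: "('a::riemann_surface \<Rightarrow> complex) \<Rightarrow> bool" where
  "mero_fun f \<longleftrightarrow> (\<forall>(V, z)\<in>charts. (f \<circ> inv_into V z) meromorphic_on z ` V)"


section \<open>The function field\<close>

text \<open>The predicate \<open>meromorphic_on\<close> ignores values at isolated points, so a meromorphic
  function on the surface is a class of total functions modulo equality off a closed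
  discrete set.\<close>

definition mero_eq :: "('a::riemann_surface \<Rightarrow> complex) \<Rightarrow> ('a \<Rightarrow> complex) \<Rightarrow> bool" where
  "mero_eq f g \<longleftrightarrow> mero_fun f \<and> mero_fun g \<and> (\<forall>\<^sub>F x in cosparse UNIV. f x = g x)"

lemma chart_around:
  fixes x :: "'a::riemann_surface"
  obtains V z where "(V, z) \<in> charts" "x \<in> V"
proof -
  have "x \<in> (\<Union>(V, z)\<in>charts. V)" unfolding charts_cover by simp
  then show ?thesis using that by auto
qed

lemma eventually_at_chart:
  fixes P :: "'a::riemann_surface \<Rightarrow> bool"
  assumes c: "(V, z) \<in> charts" and x: "x \<in> V"
  shows "eventually P (at x) \<longleftrightarrow> eventually (\<lambda>p. P (inv_into V z p)) (at (z x))"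
proof -
  have oV: "open V" and oz: "open (z ` V)" and hom: "homeomorphism V (z ` V) z (inv_into V z)"
    using charts_homeomorphism[OF c] by auto
  have iz: "\<And>y. y \<in> V \<Longrightarrow> inv_into V z (z y) = y" 
    and zi: "\<And>p. p \<in> z ` V \<Longrightarrow> z (inv_into V z p) = p"
    and iV: "\<And>p. p \<in> z ` V \<Longrightarrow> inv_into V z p \<in> V"
    using hom by (auto simp: homeomorphism_def)
  have cz: "isCont z x" 
    using hom oV x continuous_on_eq_continuous_at by (auto simp: homeomorphism_def)
  have ci: "isCont (inv_into V z) (z x)" 
    using hom oz x continuous_on_eq_continuous_at[OF oz, of "inv_into V z"]
    by (auto simp: homeomorphism_def)
  have f1: "filterlim z (at (z x)) (at x)"
  proof (rule filterlim_atI)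
    show "(z \<longlongrightarrow> z x) (at x)" using cz by (simp add: isCont_def)
    have "eventually (\<lambda>y. y \<in> V) (at x)" using eventually_at_topological oV x by blast
    moreover have "eventually (\<lambda>y. y \<noteq> x) (at x)" by (simp add: eventually_at_filter)
    ultimately show "eventually (\<lambda>y. z y \<noteq> z x) (at x)"
      by eventually_elim (metis iz x)
  qed
  have f2: "filterlim (inv_into V z) (at x) (at (z x))"
  proof (rule filterlim_atI)
    show "(inv_into V z \<longlongrightarrow> x) (at (z x))" using ci iz[OF x] by (simp add: isCont_def)
    have "eventually (\<lambda>p. p \<in> z ` V) (at (z x))" 
      using eventually_at_topological oz x by blast
    moreover have "eventually (\<lambda>p. p \<noteq> z x) (at (z x))" by (simp add: eventually_at_filter)
    ultimately show "eventually (\<lambda>p. inv_into V z p \<noteq> x) (at (z x))"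
      by eventually_elim (metis zi)
  qed
  show ?thesis
  proof
    assume "eventually P (at x)"
    then show "eventually (\<lambda>p. P (inv_into V z p)) (at (z x))"
      using f2 by (rule eventually_compose_filterlim)
  next
    assume "eventually (\<lambda>p. P (inv_into V z p)) (at (z x))"
    then have "eventually (\<lambda>y. P (inv_into V z (z y))) (at x)"
      using f1 by (rule eventually_compose_filterlim)
    moreover have "eventually (\<lambda>y. y \<in> V) (at x)" using eventually_at_topological oV x by blast
    ultimately show "eventually P (at x)"
      by eventually_elim (simp add: iz)
  qed
qed

lemma surface_at_neq_bot: "at (x::'a::riemann_surface) \<noteq> bot"
proof
  assume "at x = bot"
  then have "eventually (\<lambda>_. False) (at x)" by simp
  moreover obtain V z where c: "(V, z) \<in> charts" "x \<in> V" by (rule chart_around)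
  ultimately have "eventually (\<lambda>p. False) (at (z x))" using eventually_at_chart[OF c] by simp
  then show False by simp
qed

lemma eventually_cosparse_UNIV:
  "eventually P (cosparse UNIV) \<longleftrightarrow> (\<forall>x. eventually P (at x))"
  by (simp add: eventually_cosparse_open_eq)

lemma cosparse_surface_neq_bot: "cosparse (UNIV :: 'a::riemann_surface set) \<noteq> bot"
proof
  assume "cosparse (UNIV :: 'a set) = bot"
  then have "eventually (\<lambda>_. False) (cosparse (UNIV :: 'a set))" by simp
  then have "eventually (\<lambda>_. False) (at (undefined :: 'a))"
    unfolding eventually_cosparse_UNIV by blast
  then show False using surface_at_neq_bot[of "undefined :: 'a"] by simp
qed

lemma mero_fun_const: "mero_fun (\<lambda>_. c)"
  by (auto simp: mero_fun_def o_def intro!: meromorphic_intros)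

lemma mero_fun_ops:
  assumes "mero_fun f" "mero_fun g"
  shows "mero_fun (\<lambda>x. f x + g x)" "mero_fun (\<lambda>x. f x - g x)" "mero_fun (\<lambda>x. f x * g x)"
    "mero_fun (\<lambda>x. f x / g x)" "mero_fun (\<lambda>x. - f x)" "mero_fun (\<lambda>x. inverse (f x))"
  using assms unfolding mero_fun_def o_def case_prod_beta
  by (intro ballI meromorphic_intros; blast)+

lemma mero_fun_dichotomy:
  fixes f :: "'a::riemann_surface \<Rightarrow> complex"
  assumes f: "mero_fun f"
  shows "(\<forall>\<^sub>F x in cosparse UNIV. f x = 0) \<or> (\<forall>\<^sub>F x in cosparse UNIV. f x \<noteq> 0)"
proof -
  define A where "A = {x. eventually (\<lambda>y. f y = 0) (at x)}"
  define B where "B = {x. eventually (\<lambda>y. f y \<noteq> 0) (at x)}"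
  have op: "open {x. eventually P (at x)}" for P :: "'a \<Rightarrow> bool"
  proof (rule Topological_Spaces.openI)
    fix x assume "x \<in> {x. eventually P (at x)}"
    then obtain S where S: "open S" "x \<in> S" "\<And>y. y \<in> S \<Longrightarrow> y \<noteq> x \<Longrightarrow> P y"
      by (auto simp: eventually_at_topological)
    have "eventually P (at y)" if "y \<in> S" for y
    proof (cases "y = x")
      case True
      then show ?thesis using S by (auto simp: eventually_at_topological)
    next
      case False
      have "open (S - {x})" using S by auto
      then show ?thesis using False that S
        unfolding eventually_at_topological by (intro exI[of _ "S - {x}"]) auto
    qed
    then show "\<exists>T. open T \<and> x \<in> T \<and> T \<subseteq> {x. eventually P (at x)}"
      using S by blast
  qed
  have "x \<in> A \<union> B" for x
  proof -
    obtain V z where c: "(V, z) \<in> charts" "x \<in> V" by (rule chart_around)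
    have "(f \<circ> inv_into V z) meromorphic_on z ` V"
      using f c(1) by (auto simp: mero_fun_def)
    then have "(f \<circ> inv_into V z) meromorphic_on {z x}"
      by (rule meromorphic_on_subset) (use c(2) in auto)
    then have m: "isolated_singularity_at (f \<circ> inv_into V z) (z x)"
      "not_essential (f \<circ> inv_into V z) (z x)"
      by (simp_all add: meromorphic_at_iff)
    show ?thesis
    proof (cases "\<exists>\<^sub>F p in at (z x). (f \<circ> inv_into V z) p = 0")
      case True
      then have "\<forall>\<^sub>F p in at (z x). (f \<circ> inv_into V z) p = 0"
        using not_essential_frequently_0_imp_eventually_0 m by blast
      then show ?thesis using eventually_at_chart[OF c] by (simp add: A_def)
    next
      case False
      then have "\<forall>\<^sub>F p in at (z x). (f \<circ> inv_into V z) p \<noteq> 0"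
        by (simp add: not_frequently)
      then show ?thesis using eventually_at_chart[OF c] by (simp add: B_def)
    qed
  qed
  moreover have "A \<inter> B = {}"
  proof -
    have False if "x \<in> A" "x \<in> B" for x
    proof -
      have "eventually (\<lambda>_. False) (at x)"
        using that eventually_conj[of "\<lambda>y. f y = 0" "at x" "\<lambda>y. f y \<noteq> 0"]
        by (auto simp: A_def B_def)
      then show False using surface_at_neq_bot[of x] by simp
    qed
    then show ?thesis by blast
  qed
  moreover have "open A" "open B" unfolding A_def B_def by (rule op)+
  ultimately have "A = UNIV \<or> B = UNIV"
    using connectedD[OF connected_surface, of A B] by blast
  then show ?thesis
    by (auto simp: A_def B_def eventually_cosparse_UNIV set_eq_iff)
qed

quotient_type (overloaded) 'a mero = "'a::riemann_surface \<Rightarrow> complex" / partial: mero_eq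
proof (rule part_equivpI)
  show "\<exists>f::'a \<Rightarrow> complex. mero_eq f f"
    by (rule exI[of _ "\<lambda>_. 0"]) (simp add: mero_eq_def mero_fun_const)
  show "symp (mero_eq :: ('a \<Rightarrow> complex) \<Rightarrow> _)"
    by (auto simp: symp_def mero_eq_def eq_commute)
  show "transp (mero_eq :: ('a \<Rightarrow> complex) \<Rightarrow> _)"
    by (auto simp: transp_def mero_eq_def elim: eventually_elim2)
qed

instantiation mero :: (riemann_surface) comm_ring_1
begin

lift_definition zero_mero :: "'a mero" is "\<lambda>_. 0"
  by (simp add: mero_eq_def mero_fun_const)

lift_definition one_mero :: "'a mero" is "\<lambda>_. 1"
  by (simp add: mero_eq_def mero_fun_const)

lift_definition plus_mero :: "'a mero \<Rightarrow> 'a mero \<Rightarrow> 'a mero" is "\<lambda>f g x. f x + g x"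
  by (auto simp: mero_eq_def mero_fun_ops elim: eventually_elim2)

lift_definition minus_mero :: "'a mero \<Rightarrow> 'a mero \<Rightarrow> 'a mero" is "\<lambda>f g x. f x - g x"
  by (auto simp: mero_eq_def mero_fun_ops elim: eventually_elim2)

lift_definition uminus_mero :: "'a mero \<Rightarrow> 'a mero" is "\<lambda>f x. - f x"
  by (auto simp: mero_eq_def mero_fun_ops elim: eventually_mono)

lift_definition times_mero :: "'a mero \<Rightarrow> 'a mero \<Rightarrow> 'a mero" is "\<lambda>f g x. f x * g x"
  by (auto simp: mero_eq_def mero_fun_ops elim: eventually_elim2)

instance
proof
  fix a b c :: "'a mero"
  show "a * b * c = a * (b * c)"
    by transfer (auto simp: mero_eq_def mero_fun_ops mult.assoc)
  show "a * b = b * a"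
    by transfer (auto simp: mero_eq_def mero_fun_ops mult.commute)
  show "1 * a = a"
    by transfer (auto simp: mero_eq_def)
  show "a + b + c = a + (b + c)"
    by transfer (auto simp: mero_eq_def mero_fun_ops add.assoc)
  show "a + b = b + a"
    by transfer (auto simp: mero_eq_def mero_fun_ops add.commute)
  show "0 + a = a"
    by transfer (auto simp: mero_eq_def)
  show "- a + a = 0"
    by transfer (auto simp: mero_eq_def mero_fun_ops mero_fun_const)
  show "a - b = a + - b"
    by transfer (auto simp: mero_eq_def mero_fun_ops)
  show "(a + b) * c = a * c + b * c"
    by transfer (auto simp: mero_eq_def mero_fun_ops algebra_simps)
  show "(0::'a mero) \<noteq> 1"
    by transfer (auto simp: mero_eq_def cosparse_surface_neq_bot)
qed

end

instantiation mero :: (riemann_surface) field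
begin

lift_definition divide_mero :: "'a mero \<Rightarrow> 'a mero \<Rightarrow> 'a mero" is "\<lambda>f g x. f x / g x"
  by (auto simp: mero_eq_def mero_fun_ops elim: eventually_elim2)

lift_definition inverse_mero :: "'a mero \<Rightarrow> 'a mero" is "\<lambda>f x. inverse (f x)"
  by (auto simp: mero_eq_def mero_fun_ops elim: eventually_mono)

instance
proof
  fix a b :: "'a mero"
  show "inverse a * a = 1" if "a \<noteq> 0"
    using that
  proof transfer
    fix f :: "'a \<Rightarrow> complex"
    assume f: "mero_eq f f" and n: "\<not> mero_eq f (\<lambda>_. 0)"
    then have "\<not> (\<forall>\<^sub>F x in cosparse UNIV. f x = 0)"
      by (auto simp: mero_eq_def mero_fun_const)
    then have "\<forall>\<^sub>F x in cosparse UNIV. f x \<noteq> 0"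
      using mero_fun_dichotomy[of f] f by (auto simp: mero_eq_def)
    then have "\<forall>\<^sub>F x in cosparse UNIV. inverse (f x) * f x = 1"
      by eventually_elim simp
    then show "mero_eq (\<lambda>x. inverse (f x) * f x) (\<lambda>_. 1)"
      using f by (auto simp: mero_eq_def mero_fun_ops mero_fun_const)
  qed
  show "a div b = a * inverse b"
    by transfer (auto simp: mero_eq_def mero_fun_ops divide_inverse)
  show "inverse (0::'a mero) = 0"
    by transfer (auto simp: mero_eq_def mero_fun_const)
qed

end


section \<open>Genus\<close>

definition fscale :: "'k::field \<Rightarrow> ('i \<Rightarrow> 'k) \<Rightarrow> ('i \<Rightarrow> 'k)" where
  "fscale c v = (\<lambda>i. c * v i)"

global_interpretation fspace: vector_space fscale
  by unfold_locales (auto simp: fscale_def fun_eq_iff algebra_simps)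

text \<open>A holomorphic one-form is the family of its coefficients with respect to all charts
  (extended by zero): it equals \<open>\<omega> ((V, z), \<cdot>) dz\<close> on \<open>V\<close>.\<close>

definition holo_one_forms :: "('a::riemann_surface chart \<times> complex \<Rightarrow> complex) set" where
  "holo_one_forms = {\<omega>.
     (\<forall>(V, z)\<in>charts. (\<lambda>p. \<omega> ((V, z), p)) holomorphic_on z ` V) \<and>
     (\<forall>(V, z)\<in>charts. \<forall>(W, w)\<in>charts. \<forall>x\<in>V \<inter> W.
        \<omega> ((V, z), z x) = \<omega> ((W, w), w x) * deriv (w \<circ> inv_into V z) (z x)) \<and>
     (\<forall>V z p. (V, z) \<notin> charts \<or> p \<notin> z ` V \<longrightarrow> \<omega> ((V, z), p) = 0)}"

definition genus :: "'a::compact_riemann_surface itself \<Rightarrow> nat" where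
  "genus _ = fspace.dim (holo_one_forms :: ('a chart \<times> complex \<Rightarrow> complex) set)"


section \<open>Vector bundles as locally free sheaves\<close>

text \<open>
  Every vector bundle is isomorphic, after a choice of bases of its fibres, to one whose
  fibres are subspaces of the space of complex sequences. So a section is a function to
  complex sequences, and it is set to zero off its domain. The algebraic operations,
  restriction and gluing of sections are those of functions; in particular the uniqueness
  part of the gluing axiom is automatic. Only the values of a sheaf at open sets matter.
\<close>

type_synonym 'a sect = "'a \<Rightarrow> nat \<Rightarrow> complex"
type_synonym 'a sheaf = "'a set \<Rightarrow> 'a sect set"

definition restr :: "'a set \<Rightarrow> 'a sect \<Rightarrow> 'a sect" where
  "restr U s = (\<lambda>x. if x \<in> U then s x else 0)"

definition fmult :: "'a set \<Rightarrow> ('a \<Rightarrow> complex) \<Rightarrow> 'a sect \<Rightarrow> 'a sect" where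
  "fmult U f s = restr U (\<lambda>x k. f x * s x k)"

definition module_sheaf :: "'a::riemann_surface sheaf \<Rightarrow> bool" where
  "module_sheaf F \<longleftrightarrow>
     (\<forall>U. open U \<longrightarrow>
        0 \<in> F U \<and>
        (\<forall>s\<in>F U. restr U s = s) \<and>
        (\<forall>s\<in>F U. \<forall>t\<in>F U. s + t \<in> F U) \<and>
        (\<forall>f s. holo_fun U f \<and> s \<in> F U \<longrightarrow> fmult U f s \<in> F U) \<and>
        (\<forall>V s. open V \<and> V \<subseteq> U \<and> s \<in> F U \<longrightarrow> restr V s \<in> F V)) \<and>
     (\<forall>\<U> s. (\<forall>U\<in>\<U>. open U \<and> restr U s \<in> F U) \<longrightarrow> restr (\<Union>\<U>) s \<in> F (\<Union>\<U>))"

text \<open>The sections \<open>e 0, \<dots>, e (r - 1)\<close> over \<open>U\<close> induce an isomorphism from the \<open>r\<close>-th power of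
  the structure sheaf to \<open>F\<close> over \<open>U\<close>. They need not be linearly independent at every point
  as vectors, since \<open>F\<close> may be a non-saturated subsheaf of a bundle.\<close>

definition frame :: "nat \<Rightarrow> 'a::riemann_surface sheaf \<Rightarrow> 'a set \<Rightarrow> (nat \<Rightarrow> 'a sect) \<Rightarrow> bool" where
  "frame r F U e \<longleftrightarrow> open U \<and> (\<forall>i<r. e i \<in> F U) \<and>
     (\<forall>V. open V \<and> V \<subseteq> U \<longrightarrow>
        (\<forall>s\<in>F V. \<exists>f. (\<forall>i<r. holo_fun V (f i)) \<and>
           (\<forall>x\<in>V. \<forall>k. s x k = (\<Sum>i<r. f i x * e i x k))) \<and>
        (\<forall>f. (\<forall>i<r. holo_fun V (f i)) \<and> (\<forall>x\<in>V. \<forall>k. (\<Sum>i<r. f i x * e i x k) = 0) \<longrightarrow>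
           (\<forall>i<r. \<forall>x\<in>V. f i x = 0)))"

definition locally_free :: "nat \<Rightarrow> 'a::riemann_surface sheaf \<Rightarrow> bool" where
  "locally_free r F \<longleftrightarrow> module_sheaf F \<and> (\<forall>x. \<exists>U e. x \<in> U \<and> frame r F U e)"

definition vector_bundle :: "'a::riemann_surface sheaf \<Rightarrow> bool" where
  "vector_bundle F \<longleftrightarrow> (\<exists>r. locally_free r F)"

definition rk :: "'a::riemann_surface sheaf \<Rightarrow> nat" where
  "rk F = (THE r. locally_free r F)"

definition sheaf_hom ::
    "'a::riemann_surface sheaf \<Rightarrow> 'a sheaf \<Rightarrow> ('a set \<Rightarrow> 'a sect \<Rightarrow> 'a sect) \<Rightarrow> bool" where
  "sheaf_hom F G \<phi> \<longleftrightarrow> (\<forall>U. open U \<longrightarrow>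
     (\<forall>s\<in>F U. \<phi> U s \<in> G U) \<and>
     (\<forall>s\<in>F U. \<forall>t\<in>F U. \<phi> U (s + t) = \<phi> U s + \<phi> U t) \<and>
     (\<forall>f. \<forall>s\<in>F U. holo_fun U f \<longrightarrow> \<phi> U (fmult U f s) = fmult U f (\<phi> U s)) \<and>
     (\<forall>V. \<forall>s\<in>F U. open V \<and> V \<subseteq> U \<longrightarrow> \<phi> V (restr V s) = restr V (\<phi> U s)))"


section \<open>Degree\<close>

text \<open>The degree is the integral of the first Chern form of a Hermitian metric on the
  determinant line bundle. Metrics of class \<open>C\<^sup>2\<close> suffice: their Chern forms are continuous.\<close>

definition partial_deriv :: "complex \<Rightarrow> (complex \<Rightarrow> real) \<Rightarrow> complex \<Rightarrow> real" where
  "partial_deriv v u p = frechet_derivative u (at p) v"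

definition laplacian :: "(complex \<Rightarrow> real) \<Rightarrow> complex \<Rightarrow> real" where
  "laplacian u p = (\<Sum>v\<in>{1, \<i>}. partial_deriv v (partial_deriv v u) p)"

definition C2_on :: "complex set \<Rightarrow> (complex \<Rightarrow> real) \<Rightarrow> bool" where
  "C2_on S u \<longleftrightarrow> u differentiable_on S \<and>
     (\<forall>v\<in>{1, \<i>}. partial_deriv v u differentiable_on S \<and>
        (\<forall>w\<in>{1, \<i>}. continuous_on S (partial_deriv w (partial_deriv v u))))"

definition C2_fun :: "'a::riemann_surface set \<Rightarrow> ('a \<Rightarrow> real) \<Rightarrow> bool" where
  "C2_fun U u \<longleftrightarrow> (\<forall>(V, z)\<in>charts. C2_on (z ` (U \<inter> V)) (u \<circ> inv_into V z))"

text \<open>\<open>h U e\<close> is the squared length of \<open>e 0 \<and> \<dots> \<and> e (r - 1)\<close>, where \<open>r\<close> is the rank.\<close>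

definition det_metric ::
    "'a::riemann_surface sheaf \<Rightarrow> ('a set \<Rightarrow> (nat \<Rightarrow> 'a sect) \<Rightarrow> 'a \<Rightarrow> real) \<Rightarrow> bool" where
  "det_metric F h \<longleftrightarrow>
     (\<forall>U e. frame (rk F) F U e \<longrightarrow> (\<forall>x\<in>U. h U e x > 0) \<and> C2_fun U (h U e)) \<and>
     (\<forall>U e U' e' g.
        frame (rk F) F U e \<and> frame (rk F) F U' e' \<and>
        (\<forall>i<rk F. \<forall>j<rk F. holo_fun (U \<inter> U') (g i j)) \<and>
        (\<forall>x\<in>U \<inter> U'. \<forall>j<rk F. \<forall>k. e' j x k = (\<Sum>i<rk F. g i j x * e i x k)) \<longrightarrow>
        (\<forall>x\<in>U \<inter> U'.
           h U' e' x = (cmod (Determinant.det (mat (rk F) (rk F) (\<lambda>(i, j). g i j x))))\<^sup>2 * h U e x))"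

text \<open>A real two-form is given by its coefficients with respect to \<open>dx \<and> dy\<close> in each chart.
  With \<open>z = x + \<i>y\<close> the first Chern form of a metric \<open>h\<close> on a line bundle is
  \<open>-\<i>/(2\<pi>) \<partial>\<partial>\<^sub>c log h = -1/(4\<pi>) (\<Delta> log h) dx \<and> dy\<close>, where \<open>\<partial>\<^sub>c\<close> is the Cauchy-Riemann operator
  and \<open>h\<close> is the squared length of any local frame.\<close>

definition chern_form ::
    "'a::riemann_surface sheaf \<Rightarrow> ('a set \<Rightarrow> (nat \<Rightarrow> 'a sect) \<Rightarrow> 'a \<Rightarrow> real) \<Rightarrow>
     'a chart \<Rightarrow> complex \<Rightarrow> real" where
  "chern_form F h = (\<lambda>(V, z) p. THE c. \<exists>U e. frame (rk F) F U e \<and> inv_into V z p \<in> U \<and>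
     c = - (1 / (4 * pi)) * laplacian (\<lambda>q. ln (h U e (inv_into V z q))) p)"

definition partition_of_unity ::
    "nat \<Rightarrow> (nat \<Rightarrow> 'a::riemann_surface chart) \<Rightarrow> (nat \<Rightarrow> 'a \<Rightarrow> real) \<Rightarrow> bool" where
  "partition_of_unity n c \<rho> \<longleftrightarrow>
     (\<forall>k<n. c k \<in> charts \<and> continuous_on UNIV (\<rho> k) \<and> (\<forall>x. \<rho> k x \<ge> 0) \<and>
        closure {x. \<rho> k x \<noteq> 0} \<subseteq> fst (c k)) \<and>
     (\<forall>x. (\<Sum>k<n. \<rho> k x) = 1)"

definition surface_integral :: "('a::compact_riemann_surface chart \<Rightarrow> complex \<Rightarrow> real) \<Rightarrow> real" where
  "surface_integral \<omega> = (THE I. \<exists>n c \<rho>. partition_of_unity n c \<rho> \<and>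
     I = (\<Sum>k<n. case c k of (V, z) \<Rightarrow>
            set_lebesgue_integral lborel (z ` V) (\<lambda>p. \<rho> k (inv_into V z p) * \<omega> (V, z) p)))"

definition degree :: "'a::compact_riemann_surface sheaf \<Rightarrow> real" where
  "degree F = (THE d. \<exists>h. det_metric F h \<and> d = surface_integral (chern_form F h))"


section \<open>Holomorphic chains\<close>

text \<open>A holomorphic 3-chain is given by \<open>E 0, E 1, E 2\<close> and \<open>\<phi> 1, \<phi> 2\<close>; other values of \<open>E\<close>
  and \<open>\<phi>\<close> are irrelevant.\<close>

definition holomorphic_chain ::
    "(nat \<Rightarrow> 'a::riemann_surface sheaf) \<Rightarrow>
     (nat \<Rightarrow> 'a set \<Rightarrow> 'a sect \<Rightarrow> 'a sect) \<Rightarrow> bool" where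
  "holomorphic_chain E \<phi> \<longleftrightarrow>
     (\<forall>j<3. vector_bundle (E j)) \<and> (\<forall>i\<in>{1, 2}. sheaf_hom (E i) (E (i - 1)) (\<phi> i))"

definition chain_type ::
    "(nat \<Rightarrow> 'a::compact_riemann_surface sheaf) \<Rightarrow> nat \<times> nat \<times> nat \<times> real \<times> real \<times> real" where
  "chain_type E = (rk (E 0), rk (E 1), rk (E 2), degree (E 0), degree (E 1), degree (E 2))"

text \<open>Coherent subsheaves of vector bundles on a Riemann surface are locally free.\<close>

definition subchain ::
    "(nat \<Rightarrow> 'a::riemann_surface sheaf) \<Rightarrow>
     (nat \<Rightarrow> 'a sheaf) \<Rightarrow> (nat \<Rightarrow> 'a set \<Rightarrow> 'a sect \<Rightarrow> 'a sect) \<Rightarrow> bool" where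
  "subchain F E \<phi> \<longleftrightarrow>
     (\<forall>j<3. vector_bundle (F j) \<and> (\<forall>U. open U \<longrightarrow> F j U \<subseteq> E j U)) \<and>
     (\<forall>i\<in>{1, 2}. \<forall>U. open U \<longrightarrow> \<phi> i U ` F i U \<subseteq> F (i - 1) U)"

definition slope :: "(nat \<Rightarrow> real) \<Rightarrow> (nat \<Rightarrow> 'a::compact_riemann_surface sheaf) \<Rightarrow> real" where
  "slope \<alpha> E = (\<Sum>j<3. degree (E j) + \<alpha> j * real (rk (E j))) / real (\<Sum>j<3. rk (E j))"

definition semistable_chain ::
    "(nat \<Rightarrow> real) \<Rightarrow> (nat \<Rightarrow> 'a::compact_riemann_surface sheaf) \<Rightarrow>
     (nat \<Rightarrow> 'a set \<Rightarrow> 'a sect \<Rightarrow> 'a sect) \<Rightarrow> bool" where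
  "semistable_chain \<alpha> E \<phi> \<longleftrightarrow>
     (\<forall>F. subchain F E \<phi> \<and>
        (\<exists>j<3. \<exists>U. open U \<and> F j U \<noteq> {0}) \<and>
        (\<exists>j<3. \<exists>U. open U \<and> F j U \<noteq> E j U) \<longrightarrow>
        slope \<alpha> F \<le> slope \<alpha> E)"


section \<open>Linear chains\<close>

text \<open>Every finite-dimensional vector space over \<open>'k\<close> is isomorphic to a subspace of the space
  of sequences in \<open>'k\<close>.\<close>

definition linear_chain ::
    "(nat \<Rightarrow> (nat \<Rightarrow> 'k::field) set) \<Rightarrow> (nat \<Rightarrow> (nat \<Rightarrow> 'k) \<Rightarrow> (nat \<Rightarrow> 'k)) \<Rightarrow> bool" where
  "linear_chain V f \<longleftrightarrow>
     (\<forall>j<3. \<exists>B. finite B \<and> V j = fspace.span B) \<and>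
     (\<forall>i\<in>{1, 2}. f i ` V i \<subseteq> V (i - 1) \<and>
        (\<forall>u\<in>V i. \<forall>v\<in>V i. f i (u + v) = f i u + f i v) \<and>
        (\<forall>a. \<forall>v\<in>V i. f i (fscale a v) = fscale a (f i v)))"

definition linear_chain_type :: "(nat \<Rightarrow> (nat \<Rightarrow> 'k::field) set) \<Rightarrow> nat \<times> nat \<times> nat" where
  "linear_chain_type V = (fspace.dim (V 0), fspace.dim (V 1), fspace.dim (V 2))"

definition linear_subchain ::
    "(nat \<Rightarrow> (nat \<Rightarrow> 'k::field) set) \<Rightarrow> (nat \<Rightarrow> (nat \<Rightarrow> 'k) set) \<Rightarrow>
     (nat \<Rightarrow> (nat \<Rightarrow> 'k) \<Rightarrow> (nat \<Rightarrow> 'k)) \<Rightarrow> bool" where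
  "linear_subchain W V f \<longleftrightarrow>
     (\<forall>j<3. fspace.subspace (W j) \<and> W j \<subseteq> V j) \<and> (\<forall>i\<in>{1, 2}. f i ` W i \<subseteq> W (i - 1))"

definition linear_slope :: "(nat \<Rightarrow> real) \<Rightarrow> (nat \<Rightarrow> (nat \<Rightarrow> 'k::field) set) \<Rightarrow> real" where
  "linear_slope \<alpha> V = (\<Sum>j<3. \<alpha> j * real (fspace.dim (V j))) / real (\<Sum>j<3. fspace.dim (V j))"

definition semistable_linear_chain ::
    "(nat \<Rightarrow> real) \<Rightarrow> (nat \<Rightarrow> (nat \<Rightarrow> 'k::field) set) \<Rightarrow>
     (nat \<Rightarrow> (nat \<Rightarrow> 'k) \<Rightarrow> (nat \<Rightarrow> 'k)) \<Rightarrow> bool" where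
  "semistable_linear_chain \<alpha> V f \<longleftrightarrow>
     (\<forall>W. linear_subchain W V f \<and> (\<exists>j<3. W j \<noteq> {0}) \<longrightarrow> linear_slope \<alpha> W \<le> linear_slope \<alpha> V)"

end

theory Submission
  imports Defs
begin

text \<open>
  The hypothesis only enters through the ranks: if \<open>r\<^sub>0 = r\<^sub>1\<close>, or \<open>r\<^sub>1 = r\<^sub>2\<close>, or \<open>r\<^sub>0 = r\<^sub>2 \<le> r\<^sub>1\<close>, then
  coordinate inclusions and projections give a linear chain that is semistable for some non-zero
  parameter, over any field. In the remaining cases, apply semistability of a holomorphic chain
  to eight subchains built from the kernels and the (unsaturated) image sheaves of \<open>\<phi>\<^sub>1\<close>, \<open>\<phi>\<^sub>2\<close> and
  \<open>\<phi>\<^sub>1\<phi>\<^sub>2\<close>. The degrees of these sheaves are unbounded separately, but since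
  \<open>deg ker \<phi> + deg im \<phi>\<close> is the degree of the source, they can be eliminated from the
  inequalities, which then bound the parameters.

  Additivity of rank and degree: row reduction over the local rings of the surface, which are
  discrete valuation rings, gives local frames of the source adapted to the kernel, with block
  triangular transition matrices; hence metrics on the determinants of kernel and image multiply
  to one on the determinant of the source. The degree does not depend on the metric because
  two metrics differ by a factor \<open>exp u\<close>, and the integral of the Laplacian of \<open>u\<close> vanishes.
\<close>

section \<open>Twice differentiable functions in the plane\<close>

text \<open>The excluded rank patterns are where the elimination of degrees breaks down. Comparing
  the two bounds for the degree of im \<phi>1 leaves an inequality whose coefficients are the rank
  of ker \<phi>1 and the corank of im \<phi>1 in E0. It is silent when both vanish, that is, when
  \<phi>1 is generically an isomorphism. The same happens for \<phi>2, and for \<phi>1 \<phi>2 once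
  \<phi>1 is generically surjective and \<phi>2 generically injective. In just these rank patterns
  an identity, or an inclusion followed by a projection, gives a linear chain with a non-zero
  parameter. A coefficient that does not vanish is an integer, hence at least 1, so the final bound
  depends on ranks and degrees but not on the maps.

  Images are not saturated because then kernel and image degrees add up exactly.

  \<open>degree\<close> is a definite description over all metrics: it has a value only after one
  metric has been built and any two have been shown to give the same integral. Hence the calculus of
  integrals, changes of charts and partitions of unity comes before the algebra of sheaves.\<close>

definition has_partials ::
    "complex set \<Rightarrow> (complex \<Rightarrow> real) \<Rightarrow> (complex \<Rightarrow> real) \<Rightarrow> (complex \<Rightarrow> real) \<Rightarrow> bool" where
  "has_partials S u a b \<longleftrightarrow> (\<forall>p\<in>S. (u has_derivative (\<lambda>h. Re h * a p + Im h * b p)) (at p))"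

text \<open>The witnesses \<open>a\<close> and \<open>b\<close> are the x- and y-partials of a
  Frechet derivative. With explicit witnesses the rules for sums, products and compositions can be
  iterated to second order.\<close>

definition C1_on :: "complex set \<Rightarrow> (complex \<Rightarrow> real) \<Rightarrow> bool" where
  "C1_on S u \<longleftrightarrow> (\<exists>a b. has_partials S u a b \<and> continuous_on S a \<and> continuous_on S b)"

lemma has_partials_cong:
  assumes "has_partials S u a b" "open S" "\<And>p. p \<in> S \<Longrightarrow> u p = v p"
    "\<And>p. p \<in> S \<Longrightarrow> a p = a' p" "\<And>p. p \<in> S \<Longrightarrow> b p = b' p"
  shows "has_partials S v a' b'"
  unfolding has_partials_def
proof
  fix p assume p: "p \<in> S"
  have "(u has_derivative (\<lambda>h. Re h * a p + Im h * b p)) (at p)"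
    using assms(1) p by (auto simp: has_partials_def)
  then have "(v has_derivative (\<lambda>h. Re h * a p + Im h * b p)) (at p)"
    by (rule has_derivative_transform_within_open[OF _ assms(2) p]) (use assms in auto)
  then show "(v has_derivative (\<lambda>h. Re h * a' p + Im h * b' p)) (at p)"
    using assms p by simp
qed

lemma has_partials_subset: "has_partials S u a b \<Longrightarrow> T \<subseteq> S \<Longrightarrow> has_partials T u a b"
  by (auto simp: has_partials_def)

lemma has_partials_imp_continuous_on:
  assumes "has_partials S u a b" shows "continuous_on S u"
  unfolding continuous_on_eq_continuous_within
proof
  fix p assume "p \<in> S"
  then have "isCont u p"
    using assms has_derivative_continuous unfolding has_partials_def by blast
  then show "continuous (at p within S) u" by (rule continuous_at_imp_continuous_at_within)
qed

lemma has_partials_const: "has_partials S (\<lambda>_. c) (\<lambda>_. 0) (\<lambda>_. 0)"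
  by (auto simp: has_partials_def)

lemma has_partials_add:
  "has_partials S u a b \<Longrightarrow> has_partials S v a' b' \<Longrightarrow>
    has_partials S (\<lambda>p. u p + v p) (\<lambda>p. a p + a' p) (\<lambda>p. b p + b' p)"
  by (auto simp: has_partials_def algebra_simps intro!: derivative_eq_intros)

lemma has_partials_mult:
  "has_partials S u a b \<Longrightarrow> has_partials S v a' b' \<Longrightarrow>
    has_partials S (\<lambda>p. u p * v p) (\<lambda>p. a p * v p + u p * a' p) (\<lambda>p. b p * v p + u p * b' p)"
  by (auto simp: has_partials_def algebra_simps intro!: derivative_eq_intros)

lemma has_partials_comp:
  assumes "has_partials S u a b" "\<And>t. t \<in> u ` S \<Longrightarrow> (g has_real_derivative g' t) (at t)"
  shows "has_partials S (\<lambda>p. g (u p)) (\<lambda>p. g' (u p) * a p) (\<lambda>p. g' (u p) * b p)"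
  unfolding has_partials_def
proof
  fix p assume p: "p \<in> S"
  have "(u has_derivative (\<lambda>h. Re h * a p + Im h * b p)) (at p)"
    using assms(1) p by (auto simp: has_partials_def)
  moreover have "(g has_derivative (\<lambda>h. g' (u p) * h)) (at (u p))"
    using assms(2) p by (auto simp: has_field_derivative_def)
  ultimately have "((\<lambda>p. g (u p)) has_derivative (\<lambda>h. g' (u p) * (Re h * a p + Im h * b p))) (at p)"
    by (rule has_derivative_compose)
  then show "((\<lambda>p. g (u p)) has_derivative
      (\<lambda>h. Re h * (g' (u p) * a p) + Im h * (g' (u p) * b p))) (at p)"
    by (simp add: algebra_simps)
qed

text \<open>The real derivative of \<open>\<phi>\<close> is multiplication by its complex
  derivative, so the Cauchy-Riemann equations fix the coefficients and signs.\<close>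

lemma has_partials_holo_comp:
  assumes "has_partials T u a b" "\<phi> holomorphic_on S" "open S" "\<phi> ` S \<subseteq> T"
  shows "has_partials S (\<lambda>p. u (\<phi> p))
    (\<lambda>p. a (\<phi> p) * Re (deriv \<phi> p) + b (\<phi> p) * Im (deriv \<phi> p))
    (\<lambda>p. b (\<phi> p) * Re (deriv \<phi> p) - a (\<phi> p) * Im (deriv \<phi> p))"
  unfolding has_partials_def
proof
  fix p assume p: "p \<in> S"
  have "(\<phi> has_field_derivative deriv \<phi> p) (at p)"
    using assms p holomorphic_derivI by blast
  then have "(\<phi> has_derivative (\<lambda>h. deriv \<phi> p * h)) (at p)"
    by (simp add: has_field_derivative_def)
  moreover have "(u has_derivative (\<lambda>h. Re h * a (\<phi> p) + Im h * b (\<phi> p))) (at (\<phi> p))"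
    using assms p by (auto simp: has_partials_def)
  ultimately have "((\<lambda>p. u (\<phi> p)) has_derivative
      (\<lambda>h. Re (deriv \<phi> p * h) * a (\<phi> p) + Im (deriv \<phi> p * h) * b (\<phi> p))) (at p)"
    by (rule has_derivative_compose)
  then show "((\<lambda>p. u (\<phi> p)) has_derivative (\<lambda>h.
      Re h * (a (\<phi> p) * Re (deriv \<phi> p) + b (\<phi> p) * Im (deriv \<phi> p)) +
      Im h * (b (\<phi> p) * Re (deriv \<phi> p) - a (\<phi> p) * Im (deriv \<phi> p)))) (at p)"
    by (simp add: algebra_simps)
qed

lemma has_partials_Re: "has_partials S Re (\<lambda>_. 1) (\<lambda>_. 0)"
  by (auto simp: has_partials_def intro!: derivative_eq_intros)

lemma has_partials_Im: "has_partials S Im (\<lambda>_. 0) (\<lambda>_. 1)"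
  by (auto simp: has_partials_def intro!: derivative_eq_intros)

lemma partial_deriv_eq:
  assumes "has_partials S u a b" "p \<in> S"
  shows "partial_deriv 1 u p = a p" "partial_deriv \<i> u p = b p"
proof -
  have "(u has_derivative (\<lambda>h. Re h * a p + Im h * b p)) (at p)"
    using assms by (auto simp: has_partials_def)
  then have "frechet_derivative u (at p) = (\<lambda>h. Re h * a p + Im h * b p)"
    by (metis frechet_derivative_at)
  then show "partial_deriv 1 u p = a p" "partial_deriv \<i> u p = b p"
    by (auto simp: partial_deriv_def)
qed

lemma has_partials_partial_deriv:
  assumes "u differentiable_on S" "open S"
  shows "has_partials S u (partial_deriv 1 u) (partial_deriv \<i> u)"
  unfolding has_partials_def
proof
  fix p assume p: "p \<in> S"
  define D where "D = frechet_derivative u (at p)"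
  have D: "(u has_derivative D) (at p)"
    using assms p unfolding D_def by (metis differentiable_on_eq_differentiable_at frechet_derivative_works)
  have lin: "linear D" using D by (rule has_derivative_linear)
  have "D h = Re h * D 1 + Im h * D \<i>" for h
  proof -
    have "h = Re h *\<^sub>R 1 + Im h *\<^sub>R \<i>" by (simp add: complex_eq_iff)
    then have "D h = D (Re h *\<^sub>R 1 + Im h *\<^sub>R \<i>)" by simp
    also have "\<dots> = Re h * D 1 + Im h * D \<i>"
      using lin by (simp add: linear_add linear_scale)
    finally show ?thesis .
  qed
  then have "D = (\<lambda>h. Re h * D 1 + Im h * D \<i>)" by blast
  then show "(u has_derivative (\<lambda>h. Re h * partial_deriv 1 u p + Im h * partial_deriv \<i> u p)) (at p)"
    using D by (simp add: partial_deriv_def D_def)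
qed

lemma C1_onI: "has_partials S u a b \<Longrightarrow> continuous_on S a \<Longrightarrow> continuous_on S b \<Longrightarrow> C1_on S u"
  by (auto simp: C1_on_def)

lemma C1_on_imp_differentiable:
  assumes "C1_on S u" shows "u differentiable_on S"
  unfolding differentiable_on_def
proof
  fix p assume "p \<in> S"
  then have "u differentiable (at p)"
    using assms unfolding C1_on_def has_partials_def differentiable_def by blast
  then show "u differentiable (at p within S)" by (rule differentiable_at_withinI)
qed

lemma C1_on_imp_continuous: "C1_on S u \<Longrightarrow> continuous_on S u"
  by (auto simp: C1_on_def intro: has_partials_imp_continuous_on)

lemma C1_on_cong:
  assumes "C1_on S u" "open S" "\<And>p. p \<in> S \<Longrightarrow> u p = v p"
  shows "C1_on S v"
proof -
  obtain a b where ab: "has_partials S u a b" "continuous_on S a" "continuous_on S b"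
    using assms(1) by (auto simp: C1_on_def)
  have "has_partials S v a b" by (rule has_partials_cong[OF ab(1)]) (use assms in auto)
  then show ?thesis using ab by (auto simp: C1_on_def)
qed

lemma C1_on_partial_deriv_continuous:
  assumes "C1_on S u" "v \<in> {1, \<i>}"
  shows "continuous_on S (partial_deriv v u)"
proof -
  obtain a b where ab: "has_partials S u a b" "continuous_on S a" "continuous_on S b"
    using assms(1) by (auto simp: C1_on_def)
  have "continuous_on S (partial_deriv 1 u)" "continuous_on S (partial_deriv \<i> u)"
    using ab partial_deriv_eq[OF ab(1)] by (auto cong: continuous_on_cong)
  then show ?thesis using assms(2) by auto
qed

text \<open>\<open>C2_on\<close> speaks of \<open>partial_deriv\<close>, which does not compose
  well. Derivatives on open sets are unique, so any pair of C1 witnesses serves as well, and the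
  closure rules below are proved in this form.\<close>

lemma C2_on_iff:
  assumes S: "open S"
  shows "C2_on S u \<longleftrightarrow> (\<exists>a b. has_partials S u a b \<and> C1_on S a \<and> C1_on S b)"
proof
  assume u: "C2_on S u"
  have C1: "C1_on S (partial_deriv v u)" if v: "v \<in> {1, \<i>}" for v
    unfolding C1_on_def
  proof (intro exI conjI)
    show "has_partials S (partial_deriv v u) (partial_deriv 1 (partial_deriv v u))
        (partial_deriv \<i> (partial_deriv v u))"
      by (rule has_partials_partial_deriv) (use u v S in \<open>auto simp: C2_on_def\<close>)
  qed (use u v in \<open>auto simp: C2_on_def\<close>)
  show "\<exists>a b. has_partials S u a b \<and> C1_on S a \<and> C1_on S b"
    using has_partials_partial_deriv[of u S] u S C1 by (auto simp: C2_on_def)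
next
  assume "\<exists>a b. has_partials S u a b \<and> C1_on S a \<and> C1_on S b"
  then obtain a b where ab: "has_partials S u a b" "C1_on S a" "C1_on S b" by blast
  have C1: "C1_on S (partial_deriv v u)" if v: "v \<in> {1, \<i>}" for v
    using v partial_deriv_eq[OF ab(1)] C1_on_cong[OF ab(2) S] C1_on_cong[OF ab(3) S] by auto
  have "C1_on S u"
    by (rule C1_onI[OF ab(1)]) (use ab C1_on_imp_continuous in auto)
  then show "C2_on S u"
    unfolding C2_on_def using C1_on_imp_differentiable C1 C1_on_partial_deriv_continuous by blast
qed

lemma C2_onI: "open S \<Longrightarrow> has_partials S u a b \<Longrightarrow> C1_on S a \<Longrightarrow> C1_on S b \<Longrightarrow> C2_on S u"
  using C2_on_iff by blast

lemma C2_onE1: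
  assumes "C2_on S u" "open S"
  obtains a b where "has_partials S u a b" "C1_on S a" "C1_on S b"
  using assms C2_on_iff by blast

lemma C2_on_imp_C1_on:
  assumes "open S" "C2_on S u" shows "C1_on S u"
proof -
  obtain a b where ab: "has_partials S u a b" "C1_on S a" "C1_on S b"
    using C2_onE1[OF assms(2,1)] by metis
  show ?thesis by (rule C1_onI[OF ab(1)]) (use ab C1_on_imp_continuous in auto)
qed

lemma C2_on_imp_continuous: "open S \<Longrightarrow> C2_on S u \<Longrightarrow> continuous_on S u"
  using C2_on_imp_C1_on C1_on_imp_continuous by blast

lemma C2_on_cong:
  assumes "C2_on S u" "open S" "\<And>p. p \<in> S \<Longrightarrow> u p = v p"
  shows "C2_on S v"
proof -
  obtain a b where ab: "has_partials S u a b" "C1_on S a" "C1_on S b"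
    using assms(1,2) C2_on_iff by blast
  have "has_partials S v a b" by (rule has_partials_cong[OF ab(1)]) (use assms in auto)
  then show ?thesis using ab assms(2) C2_on_iff by blast
qed

lemma laplacian_eq:
  assumes "open S" "p \<in> S" "has_partials S u a b" "has_partials S a aa ab" "has_partials S b ba bb"
  shows "laplacian u p = aa p + bb p"
proof -
  have "has_partials S (partial_deriv 1 u) aa ab"
    by (rule has_partials_cong[OF assms(4,1)]) (use partial_deriv_eq[OF assms(3)] in auto)
  moreover have "has_partials S (partial_deriv \<i> u) ba bb"
    by (rule has_partials_cong[OF assms(5,1)]) (use partial_deriv_eq[OF assms(3)] in auto)
  ultimately show ?thesis
    using partial_deriv_eq assms(2) by (simp add: laplacian_def)
qed

text \<open>Second partial derivatives in the order \<open>xx, xy, yx, yy\<close>; they need not be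
  identified, since the mixed ones cancel in all formulas below.\<close>

lemma C2_onE:
  assumes "C2_on S u" "open S"
  obtains a b aa ab ba bb where "has_partials S u a b" "has_partials S a aa ab" "has_partials S b ba bb"
    "continuous_on S aa" "continuous_on S ab" "continuous_on S ba" "continuous_on S bb"
  using assms unfolding C2_on_iff[OF assms(2)] C1_on_def by blast

lemma C1_on_subset: "C1_on S u \<Longrightarrow> T \<subseteq> S \<Longrightarrow> C1_on T u"
  unfolding C1_on_def by (meson has_partials_subset continuous_on_subset)

lemma C2_on_subset:
  assumes "C2_on S u" "open S" "open T" "T \<subseteq> S" shows "C2_on T u"
proof -
  obtain a b where "has_partials S u a b" "C1_on S a" "C1_on S b"
    using C2_onE1[OF assms(1,2)] by metis
  then have "has_partials T u a b" "C1_on T a" "C1_on T b"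
    using assms(4) by (auto intro: has_partials_subset C1_on_subset)
  then show ?thesis by (rule C2_onI[OF assms(3)])
qed

text \<open>Differentiability and continuity at a point only see a neighbourhood; this is applied to
  \<open>u\<close> and to its first and second partials.\<close>

lemma C2_on_local:
  assumes "\<And>p. p \<in> S \<Longrightarrow> \<exists>T. open T \<and> p \<in> T \<and> T \<subseteq> S \<and> C2_on T u"
  shows "C2_on S u"
proof -
  have dif: "v differentiable_on S"
    if "\<And>T. open T \<Longrightarrow> C2_on T u \<Longrightarrow> v differentiable_on T" for v :: "complex \<Rightarrow> real"
    unfolding differentiable_on_def
  proof
    fix p assume "p \<in> S"
    then obtain T where T: "open T" "p \<in> T" "T \<subseteq> S" "C2_on T u" using assms by blast
    then have "v differentiable (at p)"
      using that differentiable_on_eq_differentiable_at by blast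
    then show "v differentiable (at p within S)"
      by (rule differentiable_at_withinI)
  qed
  have cont: "continuous_on S v"
    if "\<And>T. open T \<Longrightarrow> C2_on T u \<Longrightarrow> continuous_on T v" for v :: "complex \<Rightarrow> real"
    unfolding continuous_on_eq_continuous_within
  proof
    fix p assume "p \<in> S"
    then obtain T where T: "open T" "p \<in> T" "T \<subseteq> S" "C2_on T u" using assms by blast
    then have "isCont v p" using that continuous_on_eq_continuous_at by blast
    then show "continuous (at p within S) v" by (rule continuous_at_imp_continuous_at_within)
  qed
  show ?thesis
    unfolding C2_on_def
  proof (intro conjI ballI)
    show "u differentiable_on S" by (rule dif) (simp add: C2_on_def)
  next
    fix v :: complex assume v: "v \<in> {1, \<i>}"
    show "partial_deriv v u differentiable_on S"
      by (rule dif) (use v in \<open>unfold C2_on_def, blast\<close>)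
    fix w :: complex assume w: "w \<in> {1, \<i>}"
    show "continuous_on S (partial_deriv w (partial_deriv v u))"
      by (rule cont) (use v w in \<open>unfold C2_on_def, blast\<close>)
  qed
qed

section \<open>Closure properties of C1 and C2 functions\<close>

lemma C1_on_const: "C1_on S (\<lambda>_. c)"
  by (rule C1_onI[OF has_partials_const]) auto

lemma C1_on_add:
  assumes "C1_on S u" "C1_on S v"
  shows "C1_on S (\<lambda>p. u p + v p)"
proof -
  obtain a b a' b' where "has_partials S u a b" "continuous_on S a" "continuous_on S b"
    "has_partials S v a' b'" "continuous_on S a'" "continuous_on S b'"
    using assms by (auto simp: C1_on_def)
  then show ?thesis
    by (intro C1_onI[OF has_partials_add[of S u a b v a' b']] continuous_on_add)
qed

lemma C1_on_mult:
  assumes "C1_on S u" "C1_on S v"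
  shows "C1_on S (\<lambda>p. u p * v p)"
proof -
  have "continuous_on S u" "continuous_on S v" using assms C1_on_imp_continuous by auto
  moreover obtain a b a' b' where "has_partials S u a b" "continuous_on S a" "continuous_on S b"
    "has_partials S v a' b'" "continuous_on S a'" "continuous_on S b'"
    using assms by (auto simp: C1_on_def)
  ultimately show ?thesis
    by (intro C1_onI[OF has_partials_mult[of S u a b v a' b']] continuous_on_add continuous_on_mult)
qed

lemma C1_on_comp:
  assumes "C1_on S u" "\<And>t. t \<in> u ` S \<Longrightarrow> (g has_real_derivative g' t) (at t)"
    "continuous_on (u ` S) g'"
  shows "C1_on S (\<lambda>p. g (u p))"
proof -
  obtain a b where ab: "has_partials S u a b" "continuous_on S a" "continuous_on S b"
    using assms(1) by (auto simp: C1_on_def)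
  have "continuous_on S (\<lambda>p. g' (u p))"
    using continuous_on_compose2[OF assms(3) C1_on_imp_continuous[OF assms(1)]] by blast
  then show ?thesis
    by (intro C1_onI[OF has_partials_comp[OF ab(1) assms(2)]] continuous_on_mult ab)
qed

lemma C1_on_Re_holo:
  assumes "f holomorphic_on S" "open S"
  shows "C1_on S (\<lambda>p. Re (f p))" "C1_on S (\<lambda>p. Im (f p))"
proof -
  have "continuous_on S (deriv f)"
    using assms holomorphic_deriv holomorphic_on_imp_continuous_on by blast
  then have c: "continuous_on S (\<lambda>p. Re (deriv f p))" "continuous_on S (\<lambda>p. Im (deriv f p))"
    by (auto intro: continuous_intros)
  show "C1_on S (\<lambda>p. Re (f p))"
    by (rule C1_onI[OF has_partials_holo_comp[OF has_partials_Re[of UNIV] assms]])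
      (use c in \<open>auto intro!: continuous_intros\<close>)
  show "C1_on S (\<lambda>p. Im (f p))"
    by (rule C1_onI[OF has_partials_holo_comp[OF has_partials_Im[of UNIV] assms]])
      (use c in \<open>auto intro!: continuous_intros\<close>)
qed

lemma C1_on_holo_comp:
  assumes "C1_on T u" "\<phi> holomorphic_on S" "open S" "\<phi> ` S \<subseteq> T"
  shows "C1_on S (\<lambda>p. u (\<phi> p))"
proof -
  obtain a b where ab: "has_partials T u a b" "continuous_on T a" "continuous_on T b"
    using assms(1) by (auto simp: C1_on_def)
  have c: "continuous_on S \<phi>" "continuous_on S (deriv \<phi>)"
    using assms holomorphic_deriv holomorphic_on_imp_continuous_on by blast+
  then have "continuous_on S (\<lambda>p. a (\<phi> p))" "continuous_on S (\<lambda>p. b (\<phi> p))"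
    using ab assms(4) by (auto intro: continuous_on_compose2)
  then show ?thesis using c
    by (intro C1_onI[OF has_partials_holo_comp[OF ab(1) assms(2-4)]] continuous_intros)
qed

lemma C2_on_const: "open S \<Longrightarrow> C2_on S (\<lambda>_. c)"
  by (rule C2_onI[OF _ has_partials_const]) (auto intro: C1_on_const)

lemma C2_on_add:
  assumes "open S" "C2_on S u" "C2_on S v" shows "C2_on S (\<lambda>p. u p + v p)"
proof -
  obtain a b a' b' where "has_partials S u a b" "C1_on S a" "C1_on S b"
    "has_partials S v a' b'" "C1_on S a'" "C1_on S b'"
    using assms C2_on_iff[OF assms(1)] by auto
  then show ?thesis
    by (intro C2_onI[OF assms(1) has_partials_add[of S u a b v a' b']] C1_on_add)
qed

lemma C2_on_mult:
  assumes "open S" "C2_on S u" "C2_on S v" shows "C2_on S (\<lambda>p. u p * v p)"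
proof -
  have "C1_on S u" "C1_on S v" using assms C2_on_imp_C1_on by auto
  moreover obtain a b a' b' where "has_partials S u a b" "C1_on S a" "C1_on S b"
    "has_partials S v a' b'" "C1_on S a'" "C1_on S b'"
    using assms C2_on_iff[OF assms(1)] by auto
  ultimately show ?thesis
    by (intro C2_onI[OF assms(1) has_partials_mult[of S u a b v a' b']] C1_on_add C1_on_mult)
qed

lemma C2_on_comp:
  assumes "open S" "C2_on S u" "\<And>t. t \<in> u ` S \<Longrightarrow> (g has_real_derivative g' t) (at t)"
    "\<And>t. t \<in> u ` S \<Longrightarrow> (g' has_real_derivative g'' t) (at t)" "continuous_on (u ` S) g''"
  shows "C2_on S (\<lambda>p. g (u p))"
proof -
  obtain a b where ab: "has_partials S u a b" "C1_on S a" "C1_on S b"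
    using assms(1,2) C2_on_iff by blast
  have "C1_on S (\<lambda>p. g' (u p))"
    using C1_on_comp[OF C2_on_imp_C1_on[OF assms(1,2)] assms(4,5)] .
  then show ?thesis
    by (intro C2_onI[OF assms(1) has_partials_comp[OF ab(1) assms(3)]] C1_on_mult ab)
qed

lemma C2_on_holo_comp:
  assumes "C2_on T u" "open T" "\<phi> holomorphic_on S" "open S" "\<phi> ` S \<subseteq> T"
  shows "C2_on S (\<lambda>p. u (\<phi> p))"
proof -
  obtain a b where ab: "has_partials T u a b" "C1_on T a" "C1_on T b"
    using assms(1,2) C2_on_iff by blast
  have d: "deriv \<phi> holomorphic_on S" using assms holomorphic_deriv by blast
  have "has_partials S (\<lambda>p. u (\<phi> p))
    (\<lambda>p. a (\<phi> p) * Re (deriv \<phi> p) + b (\<phi> p) * Im (deriv \<phi> p))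
    (\<lambda>p. b (\<phi> p) * Re (deriv \<phi> p) + (-1) * (a (\<phi> p) * Im (deriv \<phi> p)))"
    using has_partials_holo_comp[OF ab(1) assms(3-5)] by simp
  moreover have "C1_on S (\<lambda>p. a (\<phi> p) * Re (deriv \<phi> p) + b (\<phi> p) * Im (deriv \<phi> p))"
    "C1_on S (\<lambda>p. b (\<phi> p) * Re (deriv \<phi> p) + (-1) * (a (\<phi> p) * Im (deriv \<phi> p)))"
    by (intro C1_on_add C1_on_mult C1_on_const C1_on_holo_comp[OF ab(2) assms(3-5)]
        C1_on_holo_comp[OF ab(3) assms(3-5)] C1_on_Re_holo[OF d assms(4)])+
  ultimately show ?thesis by (rule C2_onI[OF assms(4)])
qed

lemma C2_on_Re: "open S \<Longrightarrow> C2_on S Re"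
  by (rule C2_onI[OF _ has_partials_Re]) (auto intro: C1_on_const)

lemma C2_on_Im: "open S \<Longrightarrow> C2_on S Im"
  by (rule C2_onI[OF _ has_partials_Im]) (auto intro: C1_on_const)

lemma C2_on_norm_square: "open S \<Longrightarrow> C2_on S (\<lambda>p. (cmod p)\<^sup>2)"
  unfolding cmod_power2 unfolding power2_eq_square
  by (intro C2_on_add C2_on_mult C2_on_Re C2_on_Im)

lemma C2_on_norm_square_holo:
  "f holomorphic_on S \<Longrightarrow> open S \<Longrightarrow> C2_on S (\<lambda>p. (cmod (f p))\<^sup>2)"
  using C2_on_holo_comp[OF C2_on_norm_square[OF open_UNIV] open_UNIV] by blast

lemma C2_on_ln:
  assumes "open S" "C2_on S u" "\<And>p. p \<in> S \<Longrightarrow> u p > 0"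
  shows "C2_on S (\<lambda>p. ln (u p))"
proof (rule C2_on_comp[OF assms(1,2), where g' = "\<lambda>t. 1 / t" and g'' = "\<lambda>t. - 1 / t\<^sup>2"])
  fix t assume "t \<in> u ` S"
  then have t: "t > 0" using assms by auto
  show "(ln has_real_derivative 1 / t) (at t)"
    using t by (auto intro!: derivative_eq_intros)
  show "((\<lambda>t. 1 / t) has_real_derivative - 1 / t\<^sup>2) (at t)"
    using t by (auto intro!: derivative_eq_intros simp: power2_eq_square)
next
  show "continuous_on (u ` S) (\<lambda>t. - 1 / t\<^sup>2)"
    using assms(3) by (force intro!: continuous_intros)
qed

lemma C2_on_inverse:
  assumes "open S" "C2_on S u" "\<And>p. p \<in> S \<Longrightarrow> u p > 0"
  shows "C2_on S (\<lambda>p. 1 / u p)"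
proof (rule C2_on_comp[OF assms(1,2), where g' = "\<lambda>t. - 1 / t\<^sup>2" and g'' = "\<lambda>t. 2 / t ^ 3"])
  fix t assume "t \<in> u ` S"
  then have t: "t > 0" using assms by auto
  show "((\<lambda>t. 1 / t) has_real_derivative - 1 / t\<^sup>2) (at t)"
    using t by (auto intro!: derivative_eq_intros simp: power2_eq_square)
  show "((\<lambda>t. - 1 / t\<^sup>2) has_real_derivative 2 / t ^ 3) (at t)"
    using t by (auto intro!: derivative_eq_intros simp: power2_eq_square power3_eq_cube)
next
  show "continuous_on (u ` S) (\<lambda>t. 2 / t ^ 3)"
    using assms(3) by (force intro!: continuous_intros)
qed

section \<open>The Laplacian and holomorphic maps\<close>

lemma laplacian_continuous:
  assumes "open S" "C2_on S u" shows "continuous_on S (laplacian u)"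
proof -
  have "continuous_on S (\<lambda>p. partial_deriv 1 (partial_deriv 1 u) p + partial_deriv \<i> (partial_deriv \<i> u) p)"
    using assms(2) by (auto simp: C2_on_def intro!: continuous_intros)
  then show ?thesis by (simp add: laplacian_def[abs_def])
qed

lemma laplacian_cong:
  assumes "C2_on S u" "open S" "p \<in> S" "\<And>q. q \<in> S \<Longrightarrow> u q = v q"
  shows "laplacian u p = laplacian v p"
proof -
  obtain a b aa ab ba bb where h: "has_partials S u a b" "has_partials S a aa ab" "has_partials S b ba bb"
    using C2_onE[OF assms(1,2)] by metis
  have h': "has_partials S v a b" by (rule has_partials_cong[OF h(1)]) (use assms in auto)
  show ?thesis using laplacian_eq[OF assms(2,3) h] laplacian_eq[OF assms(2,3) h' h(2,3)] by simp
qed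

lemma laplacian_add:
  assumes "open S" "p \<in> S" "C2_on S u" "C2_on S v"
  shows "laplacian (\<lambda>q. u q + v q) p = laplacian u p + laplacian v p"
proof -
  obtain a b aa ab ba bb where u: "has_partials S u a b" "has_partials S a aa ab" "has_partials S b ba bb"
    using C2_onE[OF assms(3,1)] by metis
  obtain a' b' aa' ab' ba' bb' where
    v: "has_partials S v a' b'" "has_partials S a' aa' ab'" "has_partials S b' ba' bb'"
    using C2_onE[OF assms(4,1)] by metis
  show ?thesis
    using laplacian_eq[OF assms(1,2) u] laplacian_eq[OF assms(1,2) v]
      laplacian_eq[OF assms(1,2) has_partials_add[OF u(1) v(1)] has_partials_add[OF u(2) v(2)]
        has_partials_add[OF u(3) v(3)]] by simp
qed

lemma laplacian_cmult:
  assumes "open S" "p \<in> S" "C2_on S u"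
  shows "laplacian (\<lambda>q. c * u q) p = c * laplacian u p"
proof -
  obtain a b aa ab ba bb where u: "has_partials S u a b" "has_partials S a aa ab" "has_partials S b ba bb"
    using C2_onE[OF assms(3,1)] by metis
  have m: "has_partials S w x y \<Longrightarrow> has_partials S (\<lambda>q. c * w q) (\<lambda>q. c * x q) (\<lambda>q. c * y q)" for w x y
    using has_partials_mult[OF has_partials_const[of S c]] by simp
  show ?thesis
    using laplacian_eq[OF assms(1,2) u] laplacian_eq[OF assms(1,2) m[OF u(1)] m[OF u(2)] m[OF u(3)]]
    by (simp add: algebra_simps)
qed

text \<open>Conformal invariance: in the sum of the two pure second derivatives, the mixed partials
  of \<open>u\<close> and the terms with the second derivative of \<open>\<phi>\<close> cancel by
  the Cauchy-Riemann equations.\<close>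

lemma laplacian_holo_comp:
  assumes "C2_on T u" "open T" "\<phi> holomorphic_on S" "open S" "\<phi> ` S \<subseteq> T" "p \<in> S"
  shows "laplacian (\<lambda>q. u (\<phi> q)) p = (cmod (deriv \<phi> p))\<^sup>2 * laplacian u (\<phi> p)"
proof -
  obtain a b aa ab ba bb where u: "has_partials T u a b" "has_partials T a aa ab" "has_partials T b ba bb"
    using C2_onE[OF assms(1,2)] by metis
  define d where "d = deriv \<phi>"
  define e where "e = deriv d"
  have d: "d holomorphic_on S" unfolding d_def using assms holomorphic_deriv by blast
  have R: "has_partials S (\<lambda>q. Re (d q)) (\<lambda>q. Re (e q)) (\<lambda>q. - Im (e q))"
    using has_partials_holo_comp[OF has_partials_Re[of UNIV] d assms(4)] by (simp add: e_def)
  have I: "has_partials S (\<lambda>q. Im (d q)) (\<lambda>q. Im (e q)) (\<lambda>q. Re (e q))"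
    using has_partials_holo_comp[OF has_partials_Im[of UNIV] d assms(4)] by (simp add: e_def)
  have N: "has_partials S (\<lambda>q. - Im (d q)) (\<lambda>q. - Im (e q)) (\<lambda>q. - Re (e q))"
    using has_partials_mult[OF has_partials_const[of S "-1"] I] by simp
  note c = has_partials_holo_comp[OF _ assms(3,4,5), folded d_def]
  note u1 = c[OF u(1)]
  have u1': "has_partials S (\<lambda>p. u (\<phi> p)) (\<lambda>p. a (\<phi> p) * Re (d p) + b (\<phi> p) * Im (d p))
     (\<lambda>p. b (\<phi> p) * Re (d p) + a (\<phi> p) * (- Im (d p)))"
    using u1 by simp
  note ux = has_partials_add[OF has_partials_mult[OF c[OF u(2)] R] has_partials_mult[OF c[OF u(3)] I]]
  note uy = has_partials_add[OF has_partials_mult[OF c[OF u(3)] R] has_partials_mult[OF c[OF u(2)] N]]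
  have "\<phi> p \<in> T" using assms by blast
  then have L: "laplacian u (\<phi> p) = aa (\<phi> p) + bb (\<phi> p)"
    using laplacian_eq[OF assms(2) _ u] by blast
  show ?thesis
    unfolding laplacian_eq[OF assms(4,6) u1' ux uy] L cmod_power2 d_def[symmetric]
    by (simp add: algebra_simps power2_eq_square)
qed

lemma laplacian_Re_holo:
  assumes "f holomorphic_on S" "open S" "p \<in> S"
  shows "laplacian (\<lambda>q. Re (f q)) p = 0"
proof -
  have "laplacian Re (f p) = 0"
    using laplacian_eq[OF open_UNIV UNIV_I has_partials_Re has_partials_const has_partials_const] by simp
  then show ?thesis
    using laplacian_holo_comp[OF C2_on_Re[OF open_UNIV] open_UNIV assms(1,2) _ assms(3)] by simp
qed

text \<open>On a small ball \<open>f\<close> is \<open>exp g\<close> with \<open>g\<close>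
  holomorphic, and then the function is \<open>2 * Re g\<close>, which is harmonic. This is what
  makes Chern forms independent of the frame.\<close>

lemma laplacian_ln_norm_square_holo:
  assumes "f holomorphic_on S" "open S" "p \<in> S" "\<And>q. q \<in> S \<Longrightarrow> f q \<noteq> 0"
  shows "laplacian (\<lambda>q. ln ((cmod (f q))\<^sup>2)) p = 0"
proof -
  obtain r where r: "r > 0" "ball p r \<subseteq> S" using assms(2,3) openE by blast
  have "f holomorphic_on ball p r" using assms(1) r holomorphic_on_subset by blast
  then obtain g where g: "g holomorphic_on ball p r" "\<And>q. q \<in> ball p r \<Longrightarrow> f q = exp (g q)"
    using contractible_imp_holomorphic_log[of f "ball p r"] convex_imp_contractible[of "ball p r"]
      assms(4) r by (metis convex_ball subsetD)
  have "laplacian (\<lambda>q. ln ((cmod (f q))\<^sup>2)) p = laplacian (\<lambda>q. 2 * Re (g q)) p"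
  proof (rule sym, rule laplacian_cong)
    show "C2_on (ball p r) (\<lambda>q. 2 * Re (g q))"
      using C2_on_holo_comp[OF C2_on_Re[OF open_UNIV] open_UNIV g(1)]
      by (intro C2_on_mult C2_on_const) auto
  qed (use r in \<open>auto simp: g(2) ln_realpow\<close>)
  also have "\<dots> = 2 * laplacian (\<lambda>q. Re (g q)) p"
    by (rule laplacian_cmult[of "ball p r"])
      (use r C2_on_holo_comp[OF C2_on_Re[OF open_UNIV] open_UNIV g(1)] in auto)
  also have "\<dots> = 0" using laplacian_Re_holo[OF g(1)] r by simp
  finally show ?thesis .
qed

section \<open>Integrals in the plane\<close>

lemma has_partials_unique:
  assumes "has_partials S u a b" "has_partials S u a' b'" "p \<in> S"
  shows "a p = a' p" "b p = b' p"
  using partial_deriv_eq[OF assms(1,3)] partial_deriv_eq[OF assms(2,3)] by auto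

lemma integrable_compact_support:
  fixes f :: "'b::euclidean_space \<Rightarrow> real"
  assumes "compact K" "continuous_on K f" "\<And>x. x \<notin> K \<Longrightarrow> f x = 0"
  shows "integrable lborel f"
proof -
  have "integrable lborel (\<lambda>x. indicator K x *\<^sub>R f x)"
    by (rule borel_integrable_compact[OF assms(1,2)])
  moreover have "(\<lambda>x. indicator K x *\<^sub>R f x) = f"
    using assms(3) by (auto simp: indicator_def fun_eq_iff)
  ultimately show ?thesis by simp
qed

lemma integral_lborel_translate:
  fixes f :: "'b::euclidean_space \<Rightarrow> real"
  assumes "f \<in> borel_measurable borel"
  shows "(\<integral>x. f (c + x) \<partial>lborel) = (\<integral>x. f x \<partial>lborel)"
proof -
  have "(\<integral>x. f x \<partial>lborel) = (\<integral>x. f x \<partial>distr lborel borel ((+) c))"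
    by (simp add: lborel_distr_plus)
  also have "\<dots> = (\<integral>x. f (c + x) \<partial>lborel)"
    by (subst integral_distr) (use assms in auto)
  finally show ?thesis by simp
qed

text \<open>The integral of a difference quotient vanishes by translation invariance.\<close>

lemma integral_directional_derivative_eq_0:
  assumes w: "has_partials UNIV w a b" and ca: "continuous_on UNIV a" and cb: "continuous_on UNIV b"
    and K: "compact K" "\<And>p. p \<notin> K \<Longrightarrow> w p = 0"
  shows "(\<integral>p. Re v * a p + Im v * b p \<partial>lborel) = 0"
proof -
  define d where "d = (\<lambda>p. Re v * a p + Im v * b p)"
  define s where "s = (\<lambda>n p. real (Suc n) * (w (of_real (1 / real (Suc n)) * v + p) - w p))"
  have cd: "continuous_on UNIV d" unfolding d_def by (intro continuous_intros ca cb)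
  have cw: "continuous_on UNIV w" using w has_partials_imp_continuous_on by blast
  then have mw: "w \<in> borel_measurable borel" by (rule borel_measurable_continuous_onI)
  have md: "d \<in> borel_measurable borel" using cd by (rule borel_measurable_continuous_onI)
  have iw: "integrable lborel w"
    by (rule integrable_compact_support[OF K(1) continuous_on_subset[OF cw]]) (use K(2) in auto)
  have "((\<lambda>_. 0) has_derivative (\<lambda>h. Re h * 0 + Im h * 0)) (at p)" for p :: complex by simp
  then have z: "has_partials (- K) w (\<lambda>_. 0) (\<lambda>_. 0)"
    using has_partials_cong[OF has_partials_const[of "-K" 0]] K compact_imp_closed by (metis ComplD open_Compl)
  have d0: "d p = 0" if "p \<notin> K" for p
    using has_partials_unique[OF has_partials_subset[OF w] z, of p] that by (simp add: d_def)
  obtain B where B: "B > 0" "\<And>p. p \<in> K \<Longrightarrow> \<bar>d p\<bar> \<le> B"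
  proof -
    have "compact (d ` K)" using compact_continuous_image[OF _ K(1)] cd continuous_on_subset by blast
    then obtain B where "\<forall>x\<in>d ` K. norm x \<le> B" using bounded_iff compact_imp_bounded by metis
    then show ?thesis using that[of "max B 1"] by fastforce
  qed
  have B': "\<bar>d p\<bar> \<le> B" for p using B d0 by (cases "p \<in> K") auto
  obtain R where R: "R > 0" "K \<subseteq> ball 0 R" using K(1) compact_imp_bounded bounded_subset_ballD by metis
  \<comment> \<open>The quotients shift by at most \<open>v\<close>, so all of them vanish off this
    one ball, and a constant on it dominates them.\<close>
  define Q where "Q = cball (0::complex) (R + cmod v)"
  have der: "((\<lambda>t. w (of_real t * v + p)) has_real_derivative d (of_real t * v + p)) (at t)" for t p
  proof -
    have "((\<lambda>t. of_real t * v + p) has_derivative (\<lambda>h. of_real h * v)) (at t)"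
      by (auto intro!: derivative_eq_intros)
    moreover have "(w has_derivative (\<lambda>h. Re h * a (of_real t * v + p) + Im h * b (of_real t * v + p)))
        (at (of_real t * v + p))"
      using w by (auto simp: has_partials_def)
    ultimately have "((\<lambda>t. w (of_real t * v + p)) has_derivative
        (\<lambda>h. Re (of_real h * v) * a (of_real t * v + p) + Im (of_real h * v) * b (of_real t * v + p))) (at t)"
      by (rule has_derivative_compose)
    moreover have "(\<lambda>h. Re (of_real h * v) * a (of_real t * v + p) + Im (of_real h * v) * b (of_real t * v + p))
        = times (d (of_real t * v + p))"
      by (auto simp: d_def algebra_simps)
    ultimately show ?thesis by (simp only: has_field_derivative_def)
  qed
  have bound: "\<bar>s n p\<bar> \<le> B * indicator Q p" for n p
  proof (cases "p \<in> Q")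
    case True
    have "\<exists>t. 0 < t \<and> t < 1 / real (Suc n) \<and>
        w (of_real (1 / real (Suc n)) * v + p) - w (of_real 0 * v + p)
        = (1 / real (Suc n) - 0) * d (of_real t * v + p)"
      by (rule MVT2) (use der in auto)
    then obtain t where "w (of_real (1 / real (Suc n)) * v + p) - w p = 1 / real (Suc n) * d (of_real t * v + p)"
      by auto
    then have "s n p = d (of_real t * v + p)" unfolding s_def by simp
    then show ?thesis using B' True by simp
  next
    case False
    then have p: "cmod p > R + cmod v" by (simp add: Q_def)
    have "cmod (of_real (1 / real (Suc n)) * v) \<le> cmod v"
    proof -
      have "cmod (of_real (1 / real (Suc n)) :: complex) \<le> 1"
        unfolding norm_of_real by (simp add: divide_le_eq)
      then show ?thesis unfolding norm_mult by (rule mult_left_le_one_le[rotated 2]) auto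
    qed
    moreover have "cmod p \<le> cmod (of_real (1 / real (Suc n)) * v + p) + cmod (of_real (1 / real (Suc n)) * v)"
      using norm_triangle_sub[of p "- (of_real (1 / real (Suc n)) * v)"] by (simp add: add.commute)
    ultimately have q: "cmod (of_real (1 / real (Suc n)) * v + p) > R" using p by linarith
    have K': "x \<notin> K" if "cmod x > R" for x using that R(2) by force
    have "p \<notin> K" "of_real (1 / real (Suc n)) * v + p \<notin> K"
      using p norm_ge_zero[of v] K'[of p] K'[OF q] by linarith+
    then have "s n p = 0" unfolding s_def using K(2) by simp
    then show ?thesis using False by simp
  qed
  have lim: "(\<lambda>n. s n p) \<longlonglongrightarrow> d p" for p
  proof -
    have "((\<lambda>t. (w (of_real (0 + t) * v + p) - w (of_real 0 * v + p)) / t) \<longlongrightarrow> d (of_real 0 * v + p)) (at 0)"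
      using der[of p 0] by (simp add: DERIV_def)
    moreover have "filterlim (\<lambda>n. 1 / real (Suc n)) (at 0) sequentially"
      using LIMSEQ_inverse_real_of_nat
      by (auto simp: filterlim_at inverse_eq_divide)
    ultimately have "(\<lambda>n. (w (of_real (0 + 1 / real (Suc n)) * v + p) - w (of_real 0 * v + p)) / (1 / real (Suc n)))
        \<longlonglongrightarrow> d (of_real 0 * v + p)"
      by (rule filterlim_compose)
    then show ?thesis by (simp add: s_def mult.commute)
  qed
  have "(\<lambda>n. \<integral>p. s n p \<partial>lborel) \<longlonglongrightarrow> (\<integral>p. d p \<partial>lborel)"
  proof (rule integral_dominated_convergence[where w = "\<lambda>p. B * indicator Q p"])
    show "integrable lborel (\<lambda>p. B * indicator Q p)"
      using borel_integrable_compact[of Q "\<lambda>_. B"] by (simp add: Q_def mult.commute)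
    show "d \<in> borel_measurable lborel" using md by simp
    show "s n \<in> borel_measurable lborel" for n
    proof -
      have "(\<lambda>p. w (of_real (1 / real (Suc n)) * v + p)) \<in> borel_measurable borel"
        by (rule measurable_compose[OF _ mw]) auto
      then show ?thesis unfolding s_def using mw by measurable
    qed
  qed (use lim bound in auto)
  moreover have "(\<integral>p. s n p \<partial>lborel) = 0" for n
  proof -
    have "(\<integral>p. r * (w (c + p) - w p) \<partial>lborel) = 0" for r c
    proof -
      have "integrable lborel (\<lambda>p. w (c + p))"
        using iw integrable_distr_eq[of "(+) c" lborel borel w] mw by (simp add: lborel_distr_plus)
      then show ?thesis using iw integral_lborel_translate[OF mw, of c] by simp
    qed
    then show ?thesis unfolding s_def .
  qed
  ultimately have "(\<lambda>n. 0 :: real) \<longlonglongrightarrow> (\<integral>p. d p \<partial>lborel)" by simp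
  then have "(\<integral>p. d p \<partial>lborel) = 0" by (rule LIMSEQ_unique[OF _ tendsto_const])
  then show ?thesis by (simp add: d_def)
qed

text \<open>Each of the two summands is a directional derivative of a compactly supported first
  partial.\<close>

lemma integral_laplacian_eq_0:
  assumes u: "C2_on UNIV u" and K: "compact K" "\<And>p. p \<notin> K \<Longrightarrow> u p = 0"
  shows "(\<integral>p. laplacian u p \<partial>lborel) = 0"
proof -
  obtain a b aa ab ba bb where h: "has_partials UNIV u a b" "has_partials UNIV a aa ab" "has_partials UNIV b ba bb"
    "continuous_on UNIV aa" "continuous_on UNIV ab" "continuous_on UNIV ba" "continuous_on UNIV bb"
    using C2_onE[OF u open_UNIV] by metis
  have oK: "open (- K)" using K compact_imp_closed by blast
  have z: "has_partials (- K) v (\<lambda>_. 0) (\<lambda>_. 0)" if "\<And>p. p \<notin> K \<Longrightarrow> v p = 0" for v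
    by (rule has_partials_cong[OF has_partials_const[of _ 0] oK]) (use that in auto)
  have a0: "a p = 0" "b p = 0" if "p \<notin> K" for p
    using has_partials_unique[OF has_partials_subset[OF h(1)] z, of p] K(2) that by auto
  have aa0: "aa p = 0" "bb p = 0" if "p \<notin> K" for p
    using has_partials_unique[OF has_partials_subset[OF h(2)] z, of p] a0
      has_partials_unique[OF has_partials_subset[OF h(3)] z, of p] that by auto
  have i: "integrable lborel aa" "integrable lborel bb"
    by (rule integrable_compact_support[OF K(1)]; use h aa0 continuous_on_subset in blast)+
  have "(\<integral>p. aa p \<partial>lborel) = 0"
    using integral_directional_derivative_eq_0[OF h(2,4,5) K(1), of 1] a0 by simp
  moreover have "(\<integral>p. bb p \<partial>lborel) = 0"
    using integral_directional_derivative_eq_0[OF h(3,6,7) K(1), of \<i>] a0 by simp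
  moreover have "laplacian u = (\<lambda>p. aa p + bb p)"
    using laplacian_eq[OF open_UNIV UNIV_I h(1,2,3)] by auto
  ultimately show ?thesis using i by simp
qed

section \<open>Change of variables under injective holomorphic maps\<close>

definition plane :: "real^2 \<Rightarrow> complex" where "plane x = Complex (x $ 1) (x $ 2)"
definition unplane :: "complex \<Rightarrow> real^2" where "unplane z = (\<chi> i. if i = 1 then Re z else Im z)"

lemma plane_unplane [simp]: "plane (unplane z) = z" "unplane (plane x) = x"
  by (auto simp: plane_def unplane_def Finite_Cartesian_Product.vec_eq_iff forall_2)

lemma bounded_linear_plane: "bounded_linear plane"
  unfolding linear_conv_bounded_linear[symmetric]
  by (rule linearI) (auto simp: plane_def complex_eq_iff)

lemma bounded_linear_unplane: "bounded_linear unplane"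
  unfolding linear_conv_bounded_linear[symmetric]
  by (rule linearI) (auto simp: unplane_def Finite_Cartesian_Product.vec_eq_iff forall_2)

lemma measurable_plane [measurable]: "plane \<in> borel_measurable borel"
  using bounded_linear_plane linear_continuous_on borel_measurable_continuous_onI by blast

lemma lborel_plane: "(lborel :: complex measure) = distr lborel borel plane"
proof (rule lborel_eqI)
  fix l u :: complex assume le: "\<And>b. b \<in> Basis \<Longrightarrow> l \<bullet> b \<le> u \<bullet> b"
  have "plane -` box l u = box (unplane l) (unplane u)"
    by (auto simp: mem_box plane_def unplane_def Basis_complex_def Basis_vec_def inner_axis forall_2)
  then have "emeasure (distr lborel borel plane) (box l u) = emeasure lborel (box (unplane l) (unplane u))"
    by (subst emeasure_distr) auto
  also have "\<dots> = (\<Prod>b\<in>Basis. (unplane u - unplane l) \<bullet> b)"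
    by (rule emeasure_lborel_box)
      (use le[of 1] le[of \<i>] in \<open>auto simp: unplane_def Basis_complex_def Basis_vec_def inner_axis forall_2\<close>)
  also have "(\<Prod>b\<in>Basis. (unplane u - unplane l) \<bullet> b) = (Re u - Re l) * (Im u - Im l)"
    by (subst prod.reindex_bij_betw[symmetric, of "\<lambda>i. axis i 1" "UNIV :: 2 set"])
      (auto simp: Basis_vec_def bij_betw_def inj_on_def axis_eq_axis UNIV_2 inner_axis unplane_def)
  also have "\<dots> = (\<Prod>b\<in>Basis. (u - l) \<bullet> b)"
    by (simp add: Basis_complex_def)
  finally show "emeasure (distr lborel borel plane) (box l u) = (\<Prod>b\<in>Basis. (u - l) \<bullet> b)" .
qed simp

text \<open>The real Jacobian determinant of a holomorphic map is the squared modulus of its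
  derivative. The proof carries everything to \<open>real^2\<close>, where the general theorem on
  changes of variables applies.\<close>

lemma holo_change_of_variables:
  fixes f :: "complex \<Rightarrow> real"
  assumes \<phi>: "\<phi> holomorphic_on S" and S: "open S" and inj: "inj_on \<phi> S"
    and f: "set_integrable lborel (\<phi> ` S) f"
  shows "set_lebesgue_integral lborel (\<phi> ` S) f =
    set_lebesgue_integral lborel S (\<lambda>p. (cmod (deriv \<phi> p))\<^sup>2 * f (\<phi> p))"
proof -
  define S' where "S' = plane -` S"
  define g where "g = (\<lambda>x. unplane (\<phi> (plane x)))"
  define g' where "g' = (\<lambda>x h. unplane (deriv \<phi> (plane x) * plane h))"
  \<comment> \<open>The general theorem is about vector-valued integrands, so the scalar
    \<open>f\<close> becomes a vector with one component.\<close>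
  define F :: "real^2 \<Rightarrow> real^1" where "F = (\<lambda>x. \<chi> i. f (plane x))"
  have oS': "open S'" unfolding S'_def
    by (rule open_vimage[OF S]) (use bounded_linear_plane linear_continuous_on in blast)
  have img: "g ` S' = plane -` (\<phi> ` S)"
  proof (intro equalityI subsetI)
    fix y assume "y \<in> plane -` (\<phi> ` S)"
    then obtain p where p: "p \<in> S" "plane y = \<phi> p" by auto
    then have "y = g (unplane p)" by (metis g_def plane_unplane)
    moreover have "unplane p \<in> S'" using p by (simp add: S'_def)
    ultimately show "y \<in> g ` S'" by blast
  qed (auto simp: g_def S'_def)
  have der: "(g has_derivative g' x) (at x within S')" if "x \<in> S'" for x
  proof -
    have "(\<phi> has_derivative (\<lambda>h. deriv \<phi> (plane x) * h)) (at (plane x))"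
      using that \<phi> S by (auto simp: S'_def has_field_derivative_def[symmetric] intro: holomorphic_derivI)
    then have "((\<lambda>x. \<phi> (plane x)) has_derivative (\<lambda>h. deriv \<phi> (plane x) * plane h)) (at x)"
      by (rule has_derivative_compose[OF bounded_linear_imp_has_derivative[OF bounded_linear_plane]])
    then have "(g has_derivative g' x) (at x)"
      unfolding g_def g'_def by (rule bounded_linear.has_derivative[OF bounded_linear_unplane])
    then show ?thesis by (rule has_derivative_at_withinI)
  qed
  have injg: "inj_on g S'"
  proof (rule inj_onI)
    fix x y assume "x \<in> S'" "y \<in> S'" "g x = g y"
    then have "plane x = plane y" using inj
      by (metis S'_def g_def inj_onD plane_unplane(1) vimageE)
    then show "x = y" by (metis plane_unplane(2))
  qed
  have det: "Determinants.det (matrix (g' x)) = (cmod (deriv \<phi> (plane x)))\<^sup>2" for x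
    unfolding cmod_power2
    by (simp add: det_2 matrix_def g'_def unplane_def plane_def axis_def power2_eq_square)
  have meas: "S' \<in> sets lebesgue" using oS' by simp
  \<comment> \<open>The general theorem uses absolute integrability and \<open>integral\<close>, the
    surface integral uses \<open>lborel\<close>. For Borel integrands the completed measure gives
    the same notions.\<close>
  have setI: "f absolutely_integrable_on A \<longleftrightarrow> set_integrable lborel A f"
    if "(\<lambda>x. indicator A x *\<^sub>R f x) \<in> borel_measurable borel" for A and f :: "real^2 \<Rightarrow> real"
    using that by (simp add: set_integrable_def integrable_completion)
  have setL: "integral A f = set_lebesgue_integral lborel A f"
    if "(\<lambda>x. indicator A x *\<^sub>R f x) \<in> borel_measurable borel" "set_integrable lborel A f"
    for A and f :: "real^2 \<Rightarrow> real"
  proof -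
    have "f absolutely_integrable_on A" using setI that by blast
    then have "integral A f = set_lebesgue_integral lebesgue A f"
      by (simp add: set_lebesgue_integral_eq_integral)
    also have "\<dots> = set_lebesgue_integral lborel A f"
      using that(1) by (simp add: set_lebesgue_integral_def integral_completion)
    finally show ?thesis .
  qed
  have mf: "(\<lambda>x. indicator (\<phi> ` S) x *\<^sub>R f x) \<in> borel_measurable borel"
    using f by (auto simp: set_integrable_def)
  have mf': "(\<lambda>x. indicator (g ` S') x *\<^sub>R f (plane x)) \<in> borel_measurable borel"
    using measurable_compose[OF measurable_plane mf] unfolding img by (simp add: indicator_vimage)
  have tr: "set_integrable lborel A h \<longleftrightarrow> set_integrable lborel (plane -` A) (\<lambda>x. h (plane x))"
    "set_lebesgue_integral lborel A h = set_lebesgue_integral lborel (plane -` A) (\<lambda>x. h (plane x))"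
    if "(\<lambda>x. indicator A x *\<^sub>R h x) \<in> borel_measurable borel" for A and h :: "complex \<Rightarrow> real"
  proof -
    have i: "indicator (plane -` A) x = (indicator A (plane x) :: real)" for x
      by (simp add: indicator_def)
    show "set_integrable lborel A h \<longleftrightarrow> set_integrable lborel (plane -` A) (\<lambda>x. h (plane x))"
      unfolding set_integrable_def lborel_plane i by (subst integrable_distr_eq) (use that in auto)
    show "set_lebesgue_integral lborel A h = set_lebesgue_integral lborel (plane -` A) (\<lambda>x. h (plane x))"
      unfolding set_lebesgue_integral_def lborel_plane i by (subst integral_distr) (use that in auto)
  qed
  have fi: "set_integrable lborel (g ` S') (\<lambda>x. f (plane x))"
    using tr(1)[OF mf] f by (simp add: img)
  define D where "D = (\<lambda>p. (cmod (deriv \<phi> p))\<^sup>2 * f (\<phi> p))"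
  have mD: "(\<lambda>x. indicator S x *\<^sub>R D x) \<in> borel_measurable borel"
  proof -
    have c: "continuous_on S \<phi>" "continuous_on S (\<lambda>p. (cmod (deriv \<phi> p))\<^sup>2)"
      using \<phi> S holomorphic_deriv holomorphic_on_imp_continuous_on
      by (blast, intro continuous_intros, blast)
    have "(\<lambda>x. indicator S x *\<^sub>R \<phi> x) \<in> borel_measurable borel"
      "(\<lambda>x. indicator S x *\<^sub>R (cmod (deriv \<phi> x))\<^sup>2) \<in> borel_measurable borel"
      using c S by (auto intro: borel_measurable_continuous_on_indicator
          simp del: real_scaleR_def)
    \<comment> \<open>\<open>f\<close>, \<open>\<phi>\<close> and the derivative are only controlled
      on part of the plane. Cut off by indicators, each factor is Borel everywhere, and the first
      factor already removes all points off \<open>S\<close>.\<close>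
    then have "(\<lambda>x. (indicator S x *\<^sub>R (cmod (deriv \<phi> x))\<^sup>2) *
       (\<lambda>y. indicator (\<phi> ` S) y *\<^sub>R f y) (indicator S x *\<^sub>R \<phi> x)) \<in> borel_measurable borel"
      using mf by (intro borel_measurable_times measurable_compose[OF _ mf])
    moreover have "(\<lambda>x. (indicator S x *\<^sub>R (cmod (deriv \<phi> x))\<^sup>2) *
       (\<lambda>y. indicator (\<phi> ` S) y *\<^sub>R f y) (indicator S x *\<^sub>R \<phi> x)) = (\<lambda>x. indicator S x *\<^sub>R D x)"
      by (auto simp: D_def indicator_def fun_eq_iff)
    ultimately show ?thesis by simp
  qed
  have mD': "(\<lambda>x. indicator S' x *\<^sub>R D (plane x)) \<in> borel_measurable borel"
    using measurable_compose[OF measurable_plane mD] unfolding S'_def by (simp add: indicator_vimage)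
  have eqD: "\<bar>Determinants.det (matrix (g' x))\<bar> *\<^sub>R F (g x) = (\<chi> i. D (plane x))" for x
    by (simp add: det F_def g_def D_def Finite_Cartesian_Product.vec_eq_iff)
  have ab1: "(\<lambda>x. (\<chi> i. h x) :: real^1) absolutely_integrable_on A \<longleftrightarrow> h absolutely_integrable_on A"
    for h :: "real^2 \<Rightarrow> real" and A
    by (subst absolutely_integrable_componentwise_iff)
      (simp add: Basis_vec_def inner_axis)
  have in1: "integral A (\<lambda>x. (\<chi> i. h x) :: real^1) $ 1 = integral A h"
    if "h absolutely_integrable_on A" for h :: "real^2 \<Rightarrow> real" and A
  proof -
    have "(\<lambda>x. (\<chi> i. h x) :: real^1) integrable_on A"
      using ab1[of A h] that absolutely_integrable_on_def by blast
    then have "integral A (\<lambda>x. ((\<chi> i. h x) :: real^1) \<bullet> axis 1 1) = integral A (\<lambda>x. (\<chi> i. h x) :: real^1) \<bullet> axis 1 1"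
      by (rule integral_component_eq)
    then show ?thesis by (simp add: inner_axis)
  qed
  have aF: "F absolutely_integrable_on (g ` S')"
    unfolding F_def ab1 using setI[OF mf'] fi by simp
  have cv: "(\<lambda>x. (\<chi> i. D (plane x)) :: real^1) absolutely_integrable_on S'"
    "integral S' (\<lambda>x. (\<chi> i. D (plane x)) :: real^1) = integral (g ` S') F"
    using has_absolute_integral_change_of_variables[OF meas der injg, of F "integral (g ` S') F"] aF
    unfolding eqD by auto
  have aD: "(\<lambda>x. D (plane x)) absolutely_integrable_on S'" using cv(1) ab1 by blast
  have "set_lebesgue_integral lborel (\<phi> ` S) f = set_lebesgue_integral lborel (g ` S') (\<lambda>x. f (plane x))"
    unfolding img by (rule tr(2)[OF mf])
  also have "\<dots> = integral (g ` S') (\<lambda>x. f (plane x))"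
    using setL[OF mf' fi] by simp
  also have "\<dots> = integral (g ` S') F $ 1"
    using in1[of "g ` S'" "\<lambda>x. f (plane x)"] aF unfolding F_def ab1 by simp
  also have "\<dots> = integral S' (\<lambda>x. D (plane x))"
    using in1[OF aD] cv(2) by simp
  also have "\<dots> = set_lebesgue_integral lborel S' (\<lambda>x. D (plane x))"
    using setL[OF mD'] setI[OF mD'] aD by simp
  also have "\<dots> = set_lebesgue_integral lborel S D"
    unfolding S'_def using tr(2)[OF mD] by simp
  finally show ?thesis by (simp add: D_def)
qed

section \<open>Holomorphic and twice differentiable functions on a surface\<close>

lemma chart_facts:
  fixes z :: "'a::riemann_surface \<Rightarrow> complex"
  assumes c: "(V, z) \<in> charts"
  shows "open V" "open (z ` V)" "inj_on z V" "\<And>x. x \<in> V \<Longrightarrow> inv_into V z (z x) = x"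
    "\<And>p. p \<in> z ` V \<Longrightarrow> z (inv_into V z p) = p" "\<And>p. p \<in> z ` V \<Longrightarrow> inv_into V z p \<in> V"
    "continuous_on V z" "continuous_on (z ` V) (inv_into V z)"
    "\<And>T. T \<subseteq> V \<Longrightarrow> open T \<Longrightarrow> open (z ` T)" "\<And>T. T \<subseteq> V \<Longrightarrow> inv_into V z ` z ` T = T"
proof -
  have h: "homeomorphism V (z ` V) z (inv_into V z)" and o: "open V" "open (z ` V)"
    using charts_homeomorphism[OF c] by auto
  then show "open V" "open (z ` V)" "\<And>x. x \<in> V \<Longrightarrow> inv_into V z (z x) = x"
    "\<And>p. p \<in> z ` V \<Longrightarrow> z (inv_into V z p) = p" "\<And>p. p \<in> z ` V \<Longrightarrow> inv_into V z p \<in> V"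
    "continuous_on V z" "continuous_on (z ` V) (inv_into V z)"
    by (auto simp: homeomorphism_def)
  then show "\<And>T. T \<subseteq> V \<Longrightarrow> inv_into V z ` z ` T = T"
    by (auto simp: image_image subset_iff image_iff)
  show "inj_on z V" "\<And>T. T \<subseteq> V \<Longrightarrow> open T \<Longrightarrow> open (z ` T)"
    using charts_homeo[OF c] by auto
qed

lemma chart_transition:
  fixes z w :: "'a::riemann_surface \<Rightarrow> complex"
  assumes c: "(V, z) \<in> charts" and d: "(W, w) \<in> charts"
  shows "(w \<circ> inv_into V z) holomorphic_on z ` (V \<inter> W)" "open (z ` (V \<inter> W))"
    "inj_on (w \<circ> inv_into V z) (z ` (V \<inter> W))" "(w \<circ> inv_into V z) ` z ` (V \<inter> W) = w ` (V \<inter> W)"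
proof -
  note C = chart_facts[OF c] and D = chart_facts[OF d]
  show "(w \<circ> inv_into V z) holomorphic_on z ` (V \<inter> W)" using charts_compatible[OF c d] .
  show "open (z ` (V \<inter> W))" using C(1,9) D(1) by auto
  show "inj_on (w \<circ> inv_into V z) (z ` (V \<inter> W))"
    using C(4) D(3) by (auto simp: inj_on_def)
  show "(w \<circ> inv_into V z) ` z ` (V \<inter> W) = w ` (V \<inter> W)"
    using C(4) by (force simp: image_iff)
qed

text \<open>A local property of functions on plane open sets that is invariant under holomorphic
  maps may be checked on a surface in one chart around each point.\<close>

lemma chart_local:
  fixes f :: "'a::riemann_surface \<Rightarrow> 'b"
  assumes loc: "\<And>S g. open S \<Longrightarrow> (\<And>p. p \<in> S \<Longrightarrow> \<exists>T. open T \<and> p \<in> T \<and> T \<subseteq> S \<and> P T g) \<Longrightarrow> P S g"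
    and comp: "\<And>S T g \<phi>. P T g \<Longrightarrow> open T \<Longrightarrow> \<phi> holomorphic_on S \<Longrightarrow> open S \<Longrightarrow> \<phi> ` S \<subseteq> T \<Longrightarrow> P S (\<lambda>p. g (\<phi> p))"
    and cong: "\<And>S g h. P S g \<Longrightarrow> open S \<Longrightarrow> (\<And>p. p \<in> S \<Longrightarrow> g p = h p) \<Longrightarrow> P S h"
    and U: "open U"
    and f: "\<And>x. x \<in> U \<Longrightarrow> \<exists>V z T. (V, z) \<in> charts \<and> open T \<and> x \<in> T \<and> T \<subseteq> U \<inter> V \<and> P (z ` T) (f \<circ> inv_into V z)"
  shows "\<forall>(W, w)\<in>charts. P (w ` (U \<inter> W)) (f \<circ> inv_into W w)"
proof (intro ballI, clarify)
  fix W and w :: "'a \<Rightarrow> complex" assume w: "(W, w) \<in> charts"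
  note W = chart_facts[OF w]
  show "P (w ` (U \<inter> W)) (f \<circ> inv_into W w)"
  proof (rule loc)
    show "open (w ` (U \<inter> W))" using W(1,9) U by auto
    fix p assume "p \<in> w ` (U \<inter> W)"
    then obtain x where x: "x \<in> U" "x \<in> W" "p = w x" by auto
    obtain V z T where z: "(V, z) \<in> charts" and T: "open T" "x \<in> T" "T \<subseteq> U \<inter> V"
      "P (z ` T) (f \<circ> inv_into V z)" using f[OF x(1)] by blast
    note Z = chart_facts[OF z]
    have o: "open (w ` (T \<inter> W))" "open (z ` T)" using W(1,9) Z(9) T by auto
    have "P (w ` (T \<inter> W)) (\<lambda>p. (f \<circ> inv_into V z) ((z \<circ> inv_into W w) p))"
    proof (rule comp[OF T(4) o(2) _ o(1)])
      show "(z \<circ> inv_into W w) holomorphic_on w ` (T \<inter> W)"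
        by (rule holomorphic_on_subset[OF chart_transition(1)[OF w z]]) (use T in auto)
      show "(z \<circ> inv_into W w) ` w ` (T \<inter> W) \<subseteq> z ` T"
        using W(4) by auto
    qed
    then have "P (w ` (T \<inter> W)) (f \<circ> inv_into W w)"
      by (rule cong[OF _ o(1)]) (use W(4) Z(4) T in \<open>auto simp: subset_iff\<close>)
    then show "\<exists>S. open S \<and> p \<in> S \<and> S \<subseteq> w ` (U \<inter> W) \<and> P S (f \<circ> inv_into W w)"
      using o(1) x T by blast
  qed
qed

lemma holomorphic_on_local:
  assumes "\<And>p. p \<in> S \<Longrightarrow> \<exists>T. open T \<and> p \<in> T \<and> T \<subseteq> S \<and> g holomorphic_on T"
  shows "g holomorphic_on S"
proof -
  have "g field_differentiable (at p within S)" if p: "p \<in> S" for p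
  proof -
    obtain T where "open T" "p \<in> T" "g holomorphic_on T" using assms p by blast
    then have "g field_differentiable (at p)" using holomorphic_on_imp_differentiable_at by blast
    then show ?thesis using field_differentiable_at_within by blast
  qed
  then show ?thesis by (simp add: holomorphic_on_def)
qed

lemma holo_fun_localI:
  assumes "open U"
    "\<And>x. x \<in> U \<Longrightarrow> \<exists>V z T. (V, z) \<in> charts \<and> open T \<and> x \<in> T \<and> T \<subseteq> U \<inter> V \<and> (f \<circ> inv_into V z) holomorphic_on z ` T"
  shows "holo_fun U f"
  unfolding holo_fun_def
proof (rule chart_local[OF _ _ _ assms(1)])
  fix S T :: "complex set" and g \<phi> :: "complex \<Rightarrow> complex"
  assume "g holomorphic_on T" "\<phi> holomorphic_on S" "\<phi> ` S \<subseteq> T"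
  then show "(\<lambda>p. g (\<phi> p)) holomorphic_on S"
    using holomorphic_on_compose_gen[of \<phi> S g T] by (simp add: o_def)
next
  fix S and g :: "complex \<Rightarrow> complex"
  assume "\<And>p. p \<in> S \<Longrightarrow> \<exists>T. open T \<and> p \<in> T \<and> T \<subseteq> S \<and> g holomorphic_on T"
  then show "g holomorphic_on S" by (rule holomorphic_on_local)
next
  fix S and g h :: "complex \<Rightarrow> complex"
  assume "g holomorphic_on S" "\<And>p. p \<in> S \<Longrightarrow> g p = h p"
  then show "h holomorphic_on S" using holomorphic_cong by blast
qed (use assms in blast)

lemma C2_fun_localI:
  assumes "open U"
    "\<And>x. x \<in> U \<Longrightarrow> \<exists>V z T. (V, z) \<in> charts \<and> open T \<and> x \<in> T \<and> T \<subseteq> U \<inter> V \<and> C2_on (z ` T) (f \<circ> inv_into V z)"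
  shows "C2_fun U f"
  unfolding C2_fun_def
proof (rule chart_local[OF _ _ _ assms(1)])
  fix S and g :: "complex \<Rightarrow> real"
  assume "\<And>p. p \<in> S \<Longrightarrow> \<exists>T. open T \<and> p \<in> T \<and> T \<subseteq> S \<and> C2_on T g"
  then show "C2_on S g" by (rule C2_on_local)
next
  fix S T :: "complex set" and g :: "complex \<Rightarrow> real" and \<phi> :: "complex \<Rightarrow> complex"
  assume "C2_on T g" "open T" "\<phi> holomorphic_on S" "open S" "\<phi> ` S \<subseteq> T"
  then show "C2_on S (\<lambda>p. g (\<phi> p))" by (rule C2_on_holo_comp)
next
  fix S and g h :: "complex \<Rightarrow> real"
  assume "C2_on S g" "open S" "\<And>p. p \<in> S \<Longrightarrow> g p = h p"
  then show "C2_on S h" by (rule C2_on_cong)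
qed (use assms in blast)

lemma holo_funD:
  assumes "holo_fun U f" "(V, z) \<in> charts" "T \<subseteq> U \<inter> V"
  shows "(f \<circ> inv_into V z) holomorphic_on z ` T"
  using assms unfolding holo_fun_def by (blast intro: holomorphic_on_subset)

lemma C2_funD:
  assumes "C2_fun U f" "(V, z) \<in> charts" "T \<subseteq> U \<inter> V" "open T" "open U"
  shows "C2_on (z ` T) (f \<circ> inv_into V z)"
proof -
  have "C2_on (z ` (U \<inter> V)) (f \<circ> inv_into V z)" using assms by (auto simp: C2_fun_def)
  moreover have "open (z ` (U \<inter> V))" "open (z ` T)"
    by (rule chart_facts(9)[OF assms(2)]; use assms chart_facts(1)[OF assms(2)] in auto)+
  moreover have "z ` T \<subseteq> z ` (U \<inter> V)" using assms(3) by blast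
  ultimately show ?thesis by (rule C2_on_subset)
qed

lemma holo_fun_subset: "holo_fun U f \<Longrightarrow> T \<subseteq> U \<Longrightarrow> holo_fun T f"
  unfolding holo_fun_def[of T] by (auto intro: holo_funD[of U f])

lemma holo_fun_cong:
  assumes "holo_fun U f" "\<And>x. x \<in> U \<Longrightarrow> f x = g x"
  shows "holo_fun U g"
  unfolding holo_fun_def
proof (intro ballI, clarify)
  fix V and z :: "'a \<Rightarrow> complex" assume c: "(V, z) \<in> charts"
  have "(f \<circ> inv_into V z) holomorphic_on z ` (U \<inter> V)" using assms(1) c by (auto simp: holo_fun_def)
  moreover have "(f \<circ> inv_into V z) p = (g \<circ> inv_into V z) p" if "p \<in> z ` (U \<inter> V)" for p
    using that chart_facts(4)[OF c] assms(2) by auto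
  ultimately show "(g \<circ> inv_into V z) holomorphic_on z ` (U \<inter> V)"
    using holomorphic_cong by blast
qed

lemma holo_fun_const [simp]: "holo_fun U (\<lambda>_. c)"
  by (auto simp: holo_fun_def o_def)

lemma holo_fun_add: "holo_fun U f \<Longrightarrow> holo_fun U g \<Longrightarrow> holo_fun U (\<lambda>x. f x + g x)"
  and holo_fun_diff: "holo_fun U f \<Longrightarrow> holo_fun U g \<Longrightarrow> holo_fun U (\<lambda>x. f x - g x)"
  and holo_fun_mult: "holo_fun U f \<Longrightarrow> holo_fun U g \<Longrightarrow> holo_fun U (\<lambda>x. f x * g x)"
  and holo_fun_minus: "holo_fun U f \<Longrightarrow> holo_fun U (\<lambda>x. - f x)"
  unfolding holo_fun_def o_def case_prod_beta by (intro ballI holomorphic_intros; blast)+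

lemma holo_fun_power: "holo_fun U f \<Longrightarrow> holo_fun U (\<lambda>x. f x ^ n)"
  unfolding holo_fun_def o_def case_prod_beta by (intro ballI holomorphic_intros; blast)+

lemma holo_fun_divide:
  assumes "holo_fun U f" "holo_fun U g" "\<And>x. x \<in> U \<Longrightarrow> g x \<noteq> 0"
  shows "holo_fun U (\<lambda>x. f x / g x)"
  unfolding holo_fun_def o_def
proof (intro ballI, clarify)
  fix V and z :: "'a \<Rightarrow> complex" assume c: "(V, z) \<in> charts"
  show "(\<lambda>x. f (inv_into V z x) / g (inv_into V z x)) holomorphic_on z ` (U \<inter> V)"
    using holo_funD[OF assms(1) c order_refl] holo_funD[OF assms(2) c order_refl] assms(3)
      chart_facts(4)[OF c]
    by (intro holomorphic_intros) (auto simp: o_def)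
qed

lemma holo_fun_sum: "(\<And>i. i \<in> I \<Longrightarrow> holo_fun U (f i)) \<Longrightarrow> holo_fun U (\<lambda>x. \<Sum>i\<in>I. f i x)"
  by (induction I rule: infinite_finite_induct) (auto intro: holo_fun_add)

lemma holo_fun_prod: "(\<And>i. i \<in> I \<Longrightarrow> holo_fun U (f i)) \<Longrightarrow> holo_fun U (\<lambda>x. \<Prod>i\<in>I. f i x)"
  by (induction I rule: infinite_finite_induct) (auto intro: holo_fun_mult)

lemma holo_fun_local:
  assumes "\<And>x. x \<in> U \<Longrightarrow> \<exists>T. open T \<and> x \<in> T \<and> T \<subseteq> U \<and> holo_fun T f" "open U"
  shows "holo_fun U f"
proof (rule holo_fun_localI[OF assms(2)])
  fix x assume "x \<in> U"
  then obtain T where T: "open T" "x \<in> T" "T \<subseteq> U" "holo_fun T f" using assms by blast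
  obtain V and z :: "'a \<Rightarrow> complex" where c: "(V, z) \<in> charts" "x \<in> V" by (rule chart_around)
  show "\<exists>V z T. (V, z) \<in> charts \<and> open T \<and> x \<in> T \<and> T \<subseteq> U \<inter> V \<and> (f \<circ> inv_into V z) holomorphic_on z ` T"
    using T c chart_facts(1)[OF c(1)] holo_funD[OF T(4) c(1)]
    by (intro exI[of _ V] exI[of _ z] exI[of _ "T \<inter> V"]) auto
qed

lemma holo_fun_chart:
  assumes c: "(V, z) \<in> charts" shows "holo_fun V z"
proof (rule holo_fun_localI)
  show "open V" using chart_facts[OF c] by simp
  fix x assume x: "x \<in> V"
  have "z \<circ> inv_into V z holomorphic_on z ` V"
    by (rule holomorphic_transform[OF holomorphic_on_ident]) (use chart_facts(5)[OF c] in auto)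
  then show "\<exists>V' z' T. (V', z') \<in> charts \<and> open T \<and> x \<in> T \<and> T \<subseteq> V \<inter> V' \<and> (z \<circ> inv_into V' z') holomorphic_on z' ` T"
    using x c chart_facts(1)[OF c] by blast
qed

lemma continuous_on_via_charts:
  fixes f :: "'a::riemann_surface \<Rightarrow> 'b::topological_space"
  assumes U: "open U" and f: "\<And>V z. (V, z) \<in> charts \<Longrightarrow> continuous_on (z ` (U \<inter> V)) (f \<circ> inv_into V z)"
  shows "continuous_on U f"
proof -
  have "isCont f x" if x: "x \<in> U" for x
  proof -
    obtain V and z :: "'a \<Rightarrow> complex" where c: "(V, z) \<in> charts" "x \<in> V" by (rule chart_around)
    note C = chart_facts[OF c(1)]
    have "continuous_on (U \<inter> V) (\<lambda>y. (f \<circ> inv_into V z) (z y))"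
      by (rule continuous_on_compose2[OF f[OF c(1)] continuous_on_subset[OF C(7)]]) auto
    then have "continuous_on (U \<inter> V) f"
      using C(4) by (subst continuous_on_cong[OF refl]) auto
    then show ?thesis using U C(1) x c(2) continuous_on_eq_continuous_at[of "U \<inter> V"] by blast
  qed
  then show ?thesis using continuous_at_imp_continuous_on by blast
qed

lemma holo_fun_continuous:
  assumes "holo_fun U f" "open U" shows "continuous_on U f"
  using holo_funD[OF assms(1) _ order_refl]
  by (intro continuous_on_via_charts[OF assms(2)] holomorphic_on_imp_continuous_on)

lemma C2_fun_continuous:
  assumes "C2_fun U f" "open U" shows "continuous_on U f"
proof (rule continuous_on_via_charts[OF assms(2)])
  fix V and z :: "'a \<Rightarrow> complex" assume c: "(V, z) \<in> charts"
  show "continuous_on (z ` (U \<inter> V)) (f \<circ> inv_into V z)"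
    by (rule C2_on_imp_continuous[OF _ C2_funD[OF assms(1) c]])
      (use assms(2) chart_facts(1)[OF c] chart_facts(9)[OF c, of "U \<inter> V"] in auto)
qed

lemma C2_fun_subset: "C2_fun U f \<Longrightarrow> open U \<Longrightarrow> open T \<Longrightarrow> T \<subseteq> U \<Longrightarrow> C2_fun T f"
  unfolding C2_fun_def[of T] by (auto intro!: C2_funD[of U f] open_Int dest: chart_facts(1))

lemma C2_fun_cong:
  assumes "C2_fun U f" "open U" "\<And>x. x \<in> U \<Longrightarrow> f x = g x"
  shows "C2_fun U g"
  unfolding C2_fun_def
proof (intro ballI, clarify)
  fix V and z :: "'a \<Rightarrow> complex" assume c: "(V, z) \<in> charts"
  note C = chart_facts[OF c]
  show "C2_on (z ` (U \<inter> V)) (g \<circ> inv_into V z)"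
    by (rule C2_on_cong[OF C2_funD[OF assms(1) c]])
      (use assms C(1,4) C(9)[of "U \<inter> V"] in auto)
qed

lemma C2_fun_local:
  assumes "open U" "\<And>x. x \<in> U \<Longrightarrow> \<exists>T. open T \<and> x \<in> T \<and> T \<subseteq> U \<and> C2_fun T f"
  shows "C2_fun U f"
proof (rule C2_fun_localI[OF assms(1)])
  fix x assume "x \<in> U"
  then obtain T where T: "open T" "x \<in> T" "T \<subseteq> U" "C2_fun T f" using assms by blast
  obtain V and z :: "'a \<Rightarrow> complex" where c: "(V, z) \<in> charts" "x \<in> V" by (rule chart_around)
  show "\<exists>V z T. (V, z) \<in> charts \<and> open T \<and> x \<in> T \<and> T \<subseteq> U \<inter> V \<and> C2_on (z ` T) (f \<circ> inv_into V z)"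
    using T c chart_facts(1)[OF c(1)] C2_funD[OF T(4) c(1), of "T \<inter> V"]
    by (intro exI[of _ V] exI[of _ z] exI[of _ "T \<inter> V"]) auto
qed

lemma C2_fun_pointwise:
  assumes U: "open U"
    and "\<And>V z. (V, z) \<in> charts \<Longrightarrow> open (z ` (U \<inter> V)) \<Longrightarrow> C2_on (z ` (U \<inter> V)) (\<lambda>p. f (inv_into V z p))"
  shows "C2_fun U f"
  unfolding C2_fun_def o_def
proof (intro ballI, clarify)
  fix V and z :: "'a \<Rightarrow> complex" assume c: "(V, z) \<in> charts"
  then have "open (z ` (U \<inter> V))" using chart_facts(1,9)[OF c] U by auto
  then show "C2_on (z ` (U \<inter> V)) (\<lambda>p. f (inv_into V z p))" using assms(2) c by blast
qed

lemma C2_funD': "C2_fun U f \<Longrightarrow> (V, z) \<in> charts \<Longrightarrow> C2_on (z ` (U \<inter> V)) (\<lambda>p. f (inv_into V z p))"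
  by (auto simp: C2_fun_def o_def)

lemma C2_fun_const: "open U \<Longrightarrow> C2_fun U (\<lambda>_. c)"
  by (rule C2_fun_pointwise) (auto intro: C2_on_const)

lemma C2_fun_add:
  "open U \<Longrightarrow> C2_fun U f \<Longrightarrow> C2_fun U g \<Longrightarrow> C2_fun U (\<lambda>x. f x + g x)"
  by (rule C2_fun_pointwise) (auto intro: C2_on_add C2_funD')

lemma C2_fun_mult:
  "open U \<Longrightarrow> C2_fun U f \<Longrightarrow> C2_fun U g \<Longrightarrow> C2_fun U (\<lambda>x. f x * g x)"
  by (rule C2_fun_pointwise) (auto intro: C2_on_mult C2_funD')

lemma C2_fun_sum:
  assumes "open U" shows "(\<And>i. i \<in> I \<Longrightarrow> C2_fun U (f i)) \<Longrightarrow> C2_fun U (\<lambda>x. \<Sum>i\<in>I. f i x)"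
  by (induction I rule: infinite_finite_induct) (auto intro: C2_fun_add C2_fun_const assms)

lemma C2_fun_ln:
  assumes U: "open U" and f: "C2_fun U f" "\<And>x. x \<in> U \<Longrightarrow> f x > 0"
  shows "C2_fun U (\<lambda>x. ln (f x))"
proof (rule C2_fun_pointwise[OF U])
  fix V and z :: "'a \<Rightarrow> complex" assume c: "(V, z) \<in> charts" and o: "open (z ` (U \<inter> V))"
  show "C2_on (z ` (U \<inter> V)) (\<lambda>p. ln (f (inv_into V z p)))"
    by (rule C2_on_ln[OF o C2_funD'[OF f(1) c]]) (use f(2) chart_facts(4)[OF c] in auto)
qed

lemma C2_fun_inverse:
  assumes U: "open U" and f: "C2_fun U f" "\<And>x. x \<in> U \<Longrightarrow> f x > 0"
  shows "C2_fun U (\<lambda>x. 1 / f x)"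
proof (rule C2_fun_pointwise[OF U])
  fix V and z :: "'a \<Rightarrow> complex" assume c: "(V, z) \<in> charts" and o: "open (z ` (U \<inter> V))"
  show "C2_on (z ` (U \<inter> V)) (\<lambda>p. 1 / f (inv_into V z p))"
    by (rule C2_on_inverse[OF o C2_funD'[OF f(1) c]]) (use f(2) chart_facts(4)[OF c] in auto)
qed

lemma C2_fun_norm_square:
  assumes U: "open U" and f: "holo_fun U f"
  shows "C2_fun U (\<lambda>x. (cmod (f x))\<^sup>2)"
proof (rule C2_fun_pointwise[OF U])
  fix V and z :: "'a \<Rightarrow> complex" assume c: "(V, z) \<in> charts" and o: "open (z ` (U \<inter> V))"
  show "C2_on (z ` (U \<inter> V)) (\<lambda>p. (cmod (f (inv_into V z p)))\<^sup>2)"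
    using C2_on_norm_square_holo[OF _ o] holo_funD[OF f c order_refl] by (simp add: o_def)
qed

section \<open>Orders of vanishing\<close>

lemma holo_fun_punctured_zero:
  assumes "holo_fun U f" "open U" "x \<in> U" "\<And>y. y \<in> U \<Longrightarrow> y \<noteq> x \<Longrightarrow> f y = 0"
  shows "f x = 0"
proof -
  have "isCont f x" using holo_fun_continuous[OF assms(1,2)] assms continuous_on_eq_continuous_at by blast
  then have "f \<midarrow>x\<rightarrow> f x" by (simp add: isCont_def)
  moreover have "eventually (\<lambda>y. f y = 0) (at x)"
    using assms(2-4) eventually_at_topological by blast
  then have "f \<midarrow>x\<rightarrow> 0" by (rule tendsto_eventually)
  ultimately show ?thesis using tendsto_unique surface_at_neq_bot by blast
qed

text \<open>Read in a chart, this is the factorisation of a holomorphic function at a zero: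
  \<open>z - z x\<close> is a uniformizer of the local ring at \<open>x\<close>, and a non-zero germ
  is a power of it times a unit.\<close>

lemma holo_fun_factor:
  assumes f: "holo_fun U f" and U: "open U" and c: "(V, z) \<in> charts" and x: "x \<in> U" "x \<in> V"
  obtains T where "open T" "x \<in> T" "T \<subseteq> U \<inter> V"
    "(\<forall>y\<in>T. f y = 0) \<or> (\<exists>n g. holo_fun T g \<and> (\<forall>y\<in>T. g y \<noteq> 0 \<and> f y = (z y - z x) ^ n * g y))"
proof -
  note C = chart_facts[OF c]
  define F where "F = f \<circ> inv_into V z"
  have oz: "open (z ` (U \<inter> V))" using C(1,9) U by auto
  have hF: "F holomorphic_on z ` (U \<inter> V)" unfolding F_def by (rule holo_funD[OF f c order_refl])
  obtain r where r: "r > 0" "ball (z x) r \<subseteq> z ` (U \<inter> V)" using oz x openE by blast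
  \<comment> \<open>Small balls in the coordinate plane come back as neighbourhoods of
    \<open>x\<close>; injectivity of \<open>z\<close> keeps them inside \<open>U\<close>.\<close>
  have pull: "\<exists>T. open T \<and> x \<in> T \<and> T \<subseteq> U \<inter> V \<and> z ` T = ball (z x) s"
    if s: "0 < s" "s \<le> r" for s
  proof (intro exI conjI)
    let ?T = "V \<inter> z -` ball (z x) s"
    show "open ?T" by (rule continuous_open_preimage[OF C(7,1) open_ball])
    show "x \<in> ?T" using x s by simp
    have sub: "ball (z x) s \<subseteq> z ` (U \<inter> V)" using r(2) subset_ball[OF s(2)] by blast
    show "?T \<subseteq> U \<inter> V"
    proof
      fix y assume y: "y \<in> ?T"
      then obtain y' where y': "y' \<in> U" "y' \<in> V" "z y = z y'" using sub by blast
      then have "y = y'" using y C(3) by (auto dest: inj_onD)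
      then show "y \<in> U \<inter> V" using y' by simp
    qed
    show "z ` ?T = ball (z x) s"
    proof
      show "ball (z x) s \<subseteq> z ` ?T" using sub by (fastforce simp: subset_iff)
    qed auto
  qed
  have Ff: "f y = F (z y)" if "y \<in> V" for y using C(4) that by (simp add: F_def)
  have hr: "F holomorphic_on ball (z x) r" using hF r holomorphic_on_subset by blast
  have lift: "holo_fun T (\<lambda>y. G (z y))" if G: "G holomorphic_on z ` T" "open T" "T \<subseteq> V" for G T
  proof (rule holo_fun_localI[OF G(2)])
    fix y assume y: "y \<in> T"
    have "((\<lambda>y. G (z y)) \<circ> inv_into V z) holomorphic_on z ` T"
      by (rule holomorphic_transform[OF G(1)]) (use G C(4) in \<open>auto simp: subset_iff\<close>)
    then show "\<exists>V z' T'. (V, z') \<in> charts \<and> open T' \<and> y \<in> T' \<and> T' \<subseteq> T \<inter> V \<and>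
       ((\<lambda>y. G (z y)) \<circ> inv_into V z') holomorphic_on z' ` T'"
      using c G y by blast
  qed
  consider "F (z x) \<noteq> 0" | "F constant_on ball (z x) r" "F (z x) = 0"
    | "F (z x) = 0" "\<not> F constant_on ball (z x) r" by blast
  then show ?thesis
  proof cases
    case 1
    have "continuous_on (ball (z x) r) F" using hr holomorphic_on_imp_continuous_on by blast
    then have "isCont F (z x)" using r by (simp add: continuous_on_eq_continuous_at)
    then obtain s where s: "s > 0" "\<And>q. dist (z x) q < s \<Longrightarrow> F q \<noteq> 0"
      using continuous_at_avoid[of "z x" F 0] 1 by auto
    obtain T where T: "open T" "x \<in> T" "T \<subseteq> U \<inter> V" "z ` T = ball (z x) (min r s)"
      using pull[of "min r s"] r s by auto
    have nz: "f y \<noteq> 0" if "y \<in> T" for y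
      using that T s(2)[of "z y"] Ff[of y] by fastforce
    show ?thesis
    proof (rule that[OF T(1-3)], rule disjI2, intro exI conjI)
      show "holo_fun T f" by (rule holo_fun_subset[OF f]) (use T in auto)
      show "\<forall>y\<in>T. f y \<noteq> 0 \<and> f y = (z y - z x) ^ 0 * f y" using nz by simp
    qed
  next
    case 2
    obtain T where T: "open T" "x \<in> T" "T \<subseteq> U \<inter> V" "z ` T = ball (z x) r"
      using pull[of r] r by auto
    have "f y = 0" if "y \<in> T" for y
    proof -
      have "z y \<in> ball (z x) r" "z x \<in> ball (z x) r" using that T by blast+
      then have "F (z y) = F (z x)" using 2 by (metis constant_on_def)
      then show ?thesis using 2 Ff[of y] that T by auto
    qed
    then show ?thesis using that[OF T(1-3)] by blast
  next
    case 3
    obtain g s n where g: "0 < n" "0 < s" "ball (z x) s \<subseteq> ball (z x) r" "g holomorphic_on ball (z x) s"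
      "\<And>w. w \<in> ball (z x) s \<Longrightarrow> F w = (w - z x) ^ n * g w" "\<And>w. w \<in> ball (z x) s \<Longrightarrow> g w \<noteq> 0"
      by (rule holomorphic_factor_zero_nonconstant[OF hr open_ball connected_ball _ 3])
        (use r in auto)
    have sr: "s \<le> r" using g(2,3) r by (simp add: ball_subset_ball_iff)
    obtain T where T: "open T" "x \<in> T" "T \<subseteq> U \<inter> V" "z ` T = ball (z x) s"
      using pull[of s] g(2) sr by auto
    show ?thesis
    proof (rule that[OF T(1-3)], rule disjI2, intro exI conjI)
      show "holo_fun T (\<lambda>y. g (z y))" by (rule lift) (use g T in auto)
      show "\<forall>y\<in>T. g (z y) \<noteq> 0 \<and> f y = (z y - z x) ^ n * g (z y)"
      proof
        fix y assume y: "y \<in> T"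
        then have "z y \<in> ball (z x) s" "y \<in> V" using T by blast+
        then show "g (z y) \<noteq> 0 \<and> f y = (z y - z x) ^ n * g (z y)" using g(5,6) Ff by metis
      qed
    qed
  qed
qed

text \<open>Divisibility in the local ring at \<open>x\<close>: some member of least vanishing order divides
  all the others.\<close>

lemma holo_fun_min_order:
  fixes U :: "'a::riemann_surface set"
  assumes "finite J" and U: "open U" "x \<in> U" and f: "\<And>j. j \<in> J \<Longrightarrow> holo_fun U (f j)"
  obtains T where "open T" "x \<in> T" "T \<subseteq> U" "\<forall>j\<in>J. \<forall>y\<in>T. f j y = 0"
  | T j0 q where "open T" "x \<in> T" "T \<subseteq> U" "j0 \<in> J" "\<And>y. y \<in> T \<Longrightarrow> y \<noteq> x \<Longrightarrow> f j0 y \<noteq> 0"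
    "\<And>j. j \<in> J \<Longrightarrow> holo_fun T (q j)" "\<And>j y. j \<in> J \<Longrightarrow> y \<in> T \<Longrightarrow> f j y = q j y * f j0 y"
proof -
  obtain V and z :: "'a \<Rightarrow> complex" where c: "(V, z) \<in> charts" "x \<in> V" by (rule chart_around)
  note C = chart_facts[OF c(1)]
  let ?P = "\<lambda>j T. open T \<and> x \<in> T \<and> T \<subseteq> U \<inter> V \<and> ((\<forall>y\<in>T. f j y = 0) \<or>
      (\<exists>n g. holo_fun T g \<and> (\<forall>y\<in>T. g y \<noteq> 0 \<and> f j y = (z y - z x) ^ n * g y)))"
  have "\<exists>T. ?P j T" if "j \<in> J" for j
    using holo_fun_factor[OF f[OF that] U(1) c(1) U(2) c(2)] by metis
  then obtain T where T: "\<And>j. j \<in> J \<Longrightarrow> ?P j (T j)" by metis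
  define S where "S = U \<inter> V \<inter> (\<Inter>j\<in>J. T j)"
  have S: "open S" "x \<in> S" "S \<subseteq> U" "S \<subseteq> V" "\<And>j. j \<in> J \<Longrightarrow> S \<subseteq> T j"
    unfolding S_def using T U c C(1) assms(1) by (auto intro!: open_Int open_INT)
  define Z where "Z = {j \<in> J. \<forall>y\<in>T j. f j y = 0}"
  show ?thesis
  proof (cases "Z = J")
    case True
    then have "\<forall>j\<in>J. \<forall>y\<in>S. f j y = 0" using S(5) by (auto simp: Z_def)
    then show ?thesis using that(1) S by blast
  next
    case False
    have "\<exists>n g. holo_fun (T j) g \<and> (\<forall>y\<in>T j. g y \<noteq> 0 \<and> f j y = (z y - z x) ^ n * g y)" if "j \<in> J - Z" for j
      using that T by (auto simp: Z_def)
    then obtain n g where g: "\<And>j. j \<in> J - Z \<Longrightarrow> holo_fun (T j) (g j)"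
      "\<And>j y. j \<in> J - Z \<Longrightarrow> y \<in> T j \<Longrightarrow> g j y \<noteq> 0 \<and> f j y = (z y - z x) ^ (n j) * g j y" by metis
    have "J - Z \<noteq> {}" using False by (auto simp: Z_def)
    then obtain j0 where j0: "j0 \<in> J - Z" "\<And>j. j \<in> J - Z \<Longrightarrow> n j0 \<le> n j"
      using ex_has_least_nat[of "\<lambda>j. j \<in> J - Z" _ n] by blast
    \<comment> \<open>Members that vanish identically have no order and get the quotient 0. For the
      others the subtraction of naturals is exact, since \<open>n j0\<close> is least.\<close>
    define q where "q = (\<lambda>j y. if j \<in> Z then 0 else (z y - z x) ^ (n j - n j0) * g j y / g j0 y)"
    have gS: "holo_fun S (g j)" if "j \<in> J - Z" for j
      using holo_fun_subset[OF g(1)[OF that]] S(5) that by blast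
    have zS: "holo_fun S (\<lambda>y. z y - z x)"
      by (intro holo_fun_diff holo_fun_subset[OF holo_fun_chart[OF c(1)]] S holo_fun_const)
    show ?thesis
    proof (rule that(2)[OF S(1-3)])
      show "j0 \<in> J" using j0 by simp
      show "f j0 y \<noteq> 0" if "y \<in> S" "y \<noteq> x" for y
      proof -
        have "z y \<noteq> z x" using that C(3) S c(2) by (auto simp: inj_on_def)
        then show ?thesis using g(2)[OF j0(1), of y] S(5)[of j0] j0(1) that by auto
      qed
      show "holo_fun S (q j)" if j: "j \<in> J" for j
      proof (cases "j \<in> Z")
        case True
        then show ?thesis by (simp add: q_def)
      next
        case False
        have "holo_fun S (\<lambda>y. (z y - z x) ^ (n j - n j0) * g j y / g j0 y)"
          by (intro holo_fun_divide holo_fun_mult holo_fun_power zS gS)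
            (use j False j0 g(2)[OF j0(1)] S(5)[of j0] in auto)
        then show ?thesis using False by (simp add: q_def)
      qed
      show "f j y = q j y * f j0 y" if j: "j \<in> J" and y: "y \<in> S" for j y
      proof (cases "j \<in> Z")
        case True
        then show ?thesis using y S(5)[OF j] by (auto simp: q_def Z_def)
      next
        case False
        then have "f j y = (z y - z x) ^ (n j) * g j y" "f j0 y = (z y - z x) ^ (n j0) * g j0 y" "g j0 y \<noteq> 0"
          using g(2)[of j y] g(2)[OF j0(1), of y] j y S(5)[OF j] S(5)[of j0] j0(1) by auto
        moreover have "(z y - z x) ^ (n j) = (z y - z x) ^ (n j - n j0) * (z y - z x) ^ (n j0)"
          using j0(2)[of j] j False by (simp add: power_add[symmetric])
        ultimately show ?thesis using False by (simp add: q_def)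
      qed
    qed
  qed
qed

section \<open>Bump functions and partitions of unity\<close>

lemma closure_neq_0_mult_subset:
  fixes f g :: "'b::topological_space \<Rightarrow> 'c::semiring_0"
  shows "closure {x. f x * g x \<noteq> 0} \<subseteq> closure {x. f x \<noteq> 0}"
  by (rule closure_mono) auto

lemma C2_bump:
  fixes x :: "'a::riemann_surface"
  assumes O: "open O'" "x \<in> O'"
  obtains \<rho> where "C2_fun UNIV \<rho>" "\<And>y. \<rho> y \<ge> 0" "\<rho> x > 0" "closure {y. \<rho> y \<noteq> 0} \<subseteq> O'"
proof -
  obtain V and z :: "'a \<Rightarrow> complex" where c: "(V, z) \<in> charts" "x \<in> V" by (rule chart_around)
  note C = chart_facts[OF c(1)]
  have oz: "open (z ` (O' \<inter> V))" using C(1,9) O by auto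
  obtain r where r: "r > 0" "cball (z x) r \<subseteq> z ` (O' \<inter> V)" using oz O c(2) open_contains_cball by blast
  \<comment> \<open>The cube is the least integer power of the positive part with two continuous
    derivatives. It is applied to \<open>r\<^sup>2\<close> minus a squared distance, because the
    distance itself is not smooth at the centre.\<close>
  define b :: "real \<Rightarrow> real" where "b = (\<lambda>t. (max 0 t) ^ 3)"
  define k where "k = (\<lambda>p. b (r\<^sup>2 - (cmod (p - z x))\<^sup>2))"
  define \<rho> where "\<rho> = (\<lambda>y. if y \<in> V then k (z y) else 0)"
  define K where "K = inv_into V z ` cball (z x) r"
  have sub: "cball (z x) r \<subseteq> z ` V" using r by blast
  have "compact K" unfolding K_def
    by (rule compact_continuous_image[OF continuous_on_subset[OF C(8) sub] compact_cball])
  then have clK: "closed K" by (rule compact_imp_closed)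
  have KO: "K \<subseteq> O' \<inter> V"
    using r C(10)[of "O' \<inter> V"] unfolding K_def by blast
  have out: "\<rho> y = 0" if "y \<notin> K" for y
  proof (cases "y \<in> V")
    case True
    have "z y \<notin> cball (z x) r" using that True C(4) unfolding K_def by force
    then have "cmod (z y - z x) > r" by (simp add: dist_norm norm_minus_commute)
    then have "(cmod (z y - z x))\<^sup>2 > r\<^sup>2" using r by (simp add: power_strict_mono)
    then show ?thesis by (simp add: \<rho>_def k_def b_def)
  qed (simp add: \<rho>_def)
  have b1: "(b has_real_derivative 3 * (max 0 t)\<^sup>2) (at t)" for t
  proof (cases t "0 :: real" rule: linorder_cases)
    case less
    have "((\<lambda>_. 0) has_real_derivative 0) (at t)" by simp
    then have "(b has_real_derivative 0) (at t)"
      by (rule has_field_derivative_transform_within[where d = "-t"]) (use less in \<open>auto simp: b_def dist_real_def\<close>)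
    then show ?thesis using less by simp
  next
    case equal
    have "\<bar>b h\<bar> \<le> \<bar>h\<bar> ^ 3" for h by (auto simp: b_def max_def)
    then have "norm (b h / h) \<le> h\<^sup>2" for h
      by (cases "h = 0") (auto simp: divide_le_eq power3_eq_cube power2_eq_square abs_mult)
    then have "eventually (\<lambda>h. norm (b h / h) \<le> h\<^sup>2) (at 0)" by simp
    moreover have "((\<lambda>h::real. h\<^sup>2) \<longlongrightarrow> 0) (at 0)"
      using tendsto_power[OF tendsto_ident_at[of "0::real" UNIV], of 2] by simp
    ultimately have "((\<lambda>h. b h / h) \<longlongrightarrow> 0) (at 0)" by (rule Lim_null_comparison)
    then show ?thesis using equal by (simp add: DERIV_def b_def)
  next
    case greater
    have "((\<lambda>t. t ^ 3) has_real_derivative 3 * t\<^sup>2) (at t)" by (auto intro!: derivative_eq_intros)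
    then have "(b has_real_derivative 3 * t\<^sup>2) (at t)"
      by (rule has_field_derivative_transform_within[where d = t]) (use greater in \<open>auto simp: b_def dist_real_def\<close>)
    then show ?thesis using greater by simp
  qed
  have b2: "((\<lambda>t. 3 * (max 0 t)\<^sup>2) has_real_derivative 6 * max 0 t) (at t)" for t :: real
  proof (cases t "0 :: real" rule: linorder_cases)
    case less
    have "((\<lambda>_. 0) has_real_derivative 0) (at t)" by simp
    then have "((\<lambda>t. 3 * (max 0 t)\<^sup>2) has_real_derivative 0) (at t)"
      by (rule has_field_derivative_transform_within[where d = "-t"]) (use less in \<open>auto simp: dist_real_def\<close>)
    then show ?thesis using less by simp
  next
    case equal
    have "\<bar>3 * (max 0 h)\<^sup>2\<bar> \<le> 3 * \<bar>h\<bar>\<^sup>2" for h :: real by (auto simp: max_def)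
    then have "norm (3 * (max 0 h)\<^sup>2 / h) \<le> 3 * \<bar>h\<bar>" for h :: real
      by (cases "h = 0") (auto simp: divide_le_eq power2_eq_square abs_mult)
    then have "eventually (\<lambda>h::real. norm (3 * (max 0 h)\<^sup>2 / h) \<le> 3 * \<bar>h\<bar>) (at 0)" by simp
    moreover have "((\<lambda>h::real. 3 * \<bar>h\<bar>) \<longlongrightarrow> 0) (at 0)"
      using tendsto_mult_left[OF tendsto_rabs[OF tendsto_ident_at[of "0::real" UNIV]], of 3] by simp
    ultimately have "((\<lambda>h::real. 3 * (max 0 h)\<^sup>2 / h) \<longlongrightarrow> 0) (at 0)"
      by (rule Lim_null_comparison)
    then show ?thesis using equal by (simp add: DERIV_def)
  next
    case greater
    have "((\<lambda>t. 3 * t\<^sup>2) has_real_derivative 6 * t) (at t)" by (auto intro!: derivative_eq_intros)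
    then have "((\<lambda>t. 3 * (max 0 t)\<^sup>2) has_real_derivative 6 * t) (at t)"
      by (rule has_field_derivative_transform_within[where d = t]) (use greater in \<open>auto simp: dist_real_def\<close>)
    then show ?thesis using greater by simp
  qed
  have k: "C2_on UNIV k"
  proof -
    have "C2_on UNIV (\<lambda>p. r\<^sup>2 + (-1) * (cmod (p - z x))\<^sup>2)"
      by (intro C2_on_add C2_on_const C2_on_mult C2_on_norm_square_holo) (auto intro!: holomorphic_intros)
    then show ?thesis unfolding k_def
      by (intro C2_on_comp[OF open_UNIV _ b1 b2]) (auto intro!: continuous_intros)
  qed
  have "C2_fun UNIV \<rho>"
  proof (rule C2_fun_local)
    fix y :: 'a
    show "\<exists>T. open T \<and> y \<in> T \<and> T \<subseteq> UNIV \<and> C2_fun T \<rho>"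
    proof (cases "y \<in> V")
      case True
      have "C2_fun V \<rho>"
      proof (rule C2_fun_localI[OF C(1)])
        fix y assume y: "y \<in> V"
        have "C2_on (z ` V) (\<rho> \<circ> inv_into V z)"
          by (rule C2_on_cong[OF C2_on_subset[OF k open_UNIV C(2)]])
            (use C(2,4) in \<open>auto simp: \<rho>_def\<close>)
        then show "\<exists>V' z' T. (V', z') \<in> charts \<and> open T \<and> y \<in> T \<and> T \<subseteq> V \<inter> V' \<and> C2_on (z' ` T) (\<rho> \<circ> inv_into V' z')"
          using c C(1) y by blast
      qed
      then show ?thesis using True C(1) by blast
    next
      case False
      have "C2_fun (- K) \<rho>"
        by (rule C2_fun_cong[OF C2_fun_const[of _ 0]]) (use clK out in auto)
      then show ?thesis using False KO clK by (intro exI[of _ "- K"]) auto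
    qed
  qed simp
  moreover have "\<rho> y \<ge> 0" for y by (simp add: \<rho>_def k_def b_def)
  moreover have "\<rho> x > 0" using c r by (simp add: \<rho>_def k_def b_def)
  moreover have "closure {y. \<rho> y \<noteq> 0} \<subseteq> O'"
    using closure_minimal[of "{y. \<rho> y \<noteq> 0}" K] out clK KO by blast
  ultimately show ?thesis using that by blast
qed

text \<open>Compactness leaves finitely many bumps. A positive sum is all that the construction of a
  metric needs; dividing by it gives the partition of unity below.\<close>

lemma C2_bump_family:
  fixes O' :: "'a::compact_riemann_surface \<Rightarrow> 'a set"
  assumes "\<And>x. open (O' x)" "\<And>x. x \<in> O' x"
  obtains n :: nat and a \<rho> where "\<And>k. k < n \<Longrightarrow> C2_fun UNIV (\<rho> k)" "\<And>k y. \<rho> k y \<ge> (0::real)"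
    "\<And>k. k < n \<Longrightarrow> closure {y. \<rho> k y \<noteq> 0} \<subseteq> O' (a k)" "\<And>y. (\<Sum>k<n. \<rho> k y) > 0"
proof -
  have "\<exists>\<rho>. C2_fun UNIV \<rho> \<and> (\<forall>y. \<rho> y \<ge> 0) \<and> \<rho> x > 0 \<and> closure {y. \<rho> y \<noteq> 0} \<subseteq> O' x" for x
    using C2_bump[OF assms(1)[of x] assms(2)[of x]] by metis
  then obtain b where b: "\<And>x. C2_fun UNIV (b x)" "\<And>x y. b x y \<ge> 0" "\<And>x. b x x > 0"
    "\<And>x. closure {y. b x y \<noteq> 0} \<subseteq> O' x" by metis
  have op: "open {y. b x y > 0}" for x
  proof -
    have "continuous_on UNIV (b x)" using b(1) C2_fun_continuous by blast
    then show ?thesis by (intro open_Collect_less) (auto intro: continuous_intros)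
  qed
  have cov: "(UNIV :: 'a set) \<subseteq> (\<Union>x\<in>UNIV. {y. b x y > 0})" using b(3) by auto
  obtain D where "finite D" "(UNIV :: 'a set) \<subseteq> (\<Union>x\<in>D. {y. b x y > 0})"
    by (rule compactE_image[OF compact_surface _ cov]) (use op in auto)
  then have D: "finite D" "\<And>y. \<exists>x\<in>D. b x y > 0" by auto
  obtain h where h: "bij_betw h {..<card D} D"
    using ex_bij_betw_nat_finite[OF D(1)] by (auto simp: atLeast0LessThan)
  show ?thesis
  proof (rule that[of "card D" "\<lambda>k. b (h k)" h])
    show "(\<Sum>k<card D. b (h k) y) > 0" for y
    proof -
      have "(\<Sum>k<card D. b (h k) y) = (\<Sum>x\<in>D. b x y)" by (rule sum.reindex_bij_betw[OF h])
      also have "\<dots> > 0" using D b(2) by (meson sum_pos2)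
      finally show ?thesis .
    qed
  qed (use b in auto)
qed

lemma C2_partition_of_unity:
  fixes O' :: "'a::compact_riemann_surface \<Rightarrow> 'a set"
  assumes "\<And>x. open (O' x)" "\<And>x. x \<in> O' x"
  obtains n :: nat and a \<rho> where "\<And>k. k < n \<Longrightarrow> C2_fun UNIV (\<rho> k)" "\<And>k y. \<rho> k y \<ge> (0::real)"
    "\<And>k. k < n \<Longrightarrow> closure {y. \<rho> k y \<noteq> 0} \<subseteq> O' (a k)" "\<And>y. (\<Sum>k<n. \<rho> k y) = 1"
proof -
  obtain n :: nat and a \<rho> where r: "\<And>k. k < n \<Longrightarrow> C2_fun UNIV (\<rho> k)" "\<And>k y. \<rho> k y \<ge> (0::real)"
    "\<And>k. k < n \<Longrightarrow> closure {y. \<rho> k y \<noteq> 0} \<subseteq> O' (a k)" "\<And>y. (\<Sum>k<n. \<rho> k y) > 0"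
    using C2_bump_family[OF assms] by metis
  show ?thesis
  proof (rule that[of n "\<lambda>k y. \<rho> k y * (1 / (\<Sum>k<n. \<rho> k y))" a])
    show "C2_fun UNIV (\<lambda>y. \<rho> k y * (1 / (\<Sum>k<n. \<rho> k y)))" if "k < n" for k
      by (intro C2_fun_mult C2_fun_inverse C2_fun_sum) (use r that in auto)
    show "\<rho> k y * (1 / (\<Sum>k<n. \<rho> k y)) \<ge> 0" for k y
      using r(2,4) by (simp add: less_imp_le)
    show "closure {y. \<rho> k y * (1 / (\<Sum>k<n. \<rho> k y)) \<noteq> 0} \<subseteq> O' (a k)" if "k < n" for k
      using closure_neq_0_mult_subset r(3)[OF that] by fast
    show "(\<Sum>k<n. \<rho> k y * (1 / (\<Sum>k<n. \<rho> k y))) = 1" for y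
      using r(4)[of y] by (simp add: sum_divide_distrib[symmetric])
  qed
qed

section \<open>Integration of two-forms\<close>

text \<open>Coefficients of dx \<and> dy in the charts. The factor is the Jacobian of the transition
  map, so the rule is the one for pulling back two-forms.\<close>

definition two_form :: "('a::riemann_surface chart \<Rightarrow> complex \<Rightarrow> real) \<Rightarrow> bool" where
  "two_form \<omega> \<longleftrightarrow> (\<forall>V z. (V, z) \<in> charts \<longrightarrow> continuous_on (z ` V) (\<omega> (V, z))) \<and>
     (\<forall>V z W w x. (V, z) \<in> charts \<and> (W, w) \<in> charts \<and> x \<in> V \<inter> W \<longrightarrow>
        \<omega> (V, z) (z x) = (cmod (deriv (w \<circ> inv_into V z) (z x)))\<^sup>2 * \<omega> (W, w) (w x))"

definition chart_integral :: "'a chart \<Rightarrow> ('a chart \<Rightarrow> complex \<Rightarrow> real) \<Rightarrow> real" where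
  "chart_integral c \<omega> = set_lebesgue_integral lborel (snd c ` fst c) (\<omega> c)"

definition mult_form ::
    "('a \<Rightarrow> real) \<Rightarrow> ('a chart \<Rightarrow> complex \<Rightarrow> real) \<Rightarrow> 'a chart \<Rightarrow> complex \<Rightarrow> real" where
  "mult_form f \<omega> = (\<lambda>c p. f (inv_into (fst c) (snd c) p) * \<omega> c p)"

definition supported_in :: "('a::riemann_surface chart \<Rightarrow> complex \<Rightarrow> real) \<Rightarrow> 'a set \<Rightarrow> bool" where
  "supported_in \<omega> K \<longleftrightarrow> (\<forall>V z x. (V, z) \<in> charts \<and> x \<in> V - K \<longrightarrow> \<omega> (V, z) (z x) = 0)"

lemma two_form_mult:
  assumes \<omega>: "two_form \<omega>" and f: "continuous_on UNIV f"
  shows "two_form (mult_form f \<omega>)"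
  unfolding two_form_def mult_form_def
proof (intro conjI allI impI; (elim conjE)?; simp only: fst_conv snd_conv)
  fix V and z :: "'a \<Rightarrow> complex" assume c: "(V, z) \<in> charts"
  have "continuous_on (z ` V) (\<lambda>p. f (inv_into V z p))"
    by (rule continuous_on_compose2[OF f chart_facts(8)[OF c]]) auto
  then show "continuous_on (z ` V) (\<lambda>p. f (inv_into V z p) * \<omega> (V, z) p)"
    using \<omega> c by (intro continuous_on_mult) (auto simp: two_form_def)
next
  fix V W x and z w :: "'a \<Rightarrow> complex"
  assume c: "(V, z) \<in> charts" "(W, w) \<in> charts" and x: "x \<in> V \<inter> W"
  then have "\<omega> (V, z) (z x) = (cmod (deriv (w \<circ> inv_into V z) (z x)))\<^sup>2 * \<omega> (W, w) (w x)"
    using \<omega> unfolding two_form_def by blast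
  then show "f (inv_into V z (z x)) * \<omega> (V, z) (z x) =
      (cmod (deriv (w \<circ> inv_into V z) (z x)))\<^sup>2 * (f (inv_into W w (w x)) * \<omega> (W, w) (w x))"
    using chart_facts(4)[OF c(1)] chart_facts(4)[OF c(2)] x by simp
qed

lemma supported_in_mult_left:
  assumes "closure {x. f x \<noteq> 0} \<subseteq> K" shows "supported_in (mult_form f \<omega>) K"
  unfolding supported_in_def mult_form_def
proof (intro allI impI, elim conjE, simp only: fst_conv snd_conv)
  fix V x and z :: "'a \<Rightarrow> complex" assume c: "(V, z) \<in> charts" and x: "x \<in> V - K"
  have "f x = 0" using x assms closure_subset[of "{x. f x \<noteq> 0}"] by blast
  then show "f (inv_into V z (z x)) * \<omega> (V, z) (z x) = 0"
    using x chart_facts(4)[OF c] by simp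
qed

lemma supported_in_mult_right: "supported_in \<omega> K \<Longrightarrow> supported_in (mult_form f \<omega>) K"
  by (auto simp: supported_in_def mult_form_def)

lemma chart_integrable:
  fixes \<omega> :: "'a::compact_riemann_surface chart \<Rightarrow> complex \<Rightarrow> real"
  assumes \<omega>: "two_form \<omega>" and c: "(V, z) \<in> charts" and K: "closed K" "K \<subseteq> V" "supported_in \<omega> K"
  shows "set_integrable lborel (z ` V) (\<omega> (V, z))"
  unfolding set_integrable_def
proof (rule integrable_compact_support)
  have "compact K" using compact_Int_closed[OF compact_surface K(1)] by simp
  then show "compact (z ` K)"
    using compact_continuous_image continuous_on_subset[OF chart_facts(7)[OF c] K(2)] by blast
  have "continuous_on (z ` K) (\<omega> (V, z))"
    by (rule continuous_on_subset[of "z ` V"]) (use \<omega> c K(2) in \<open>auto simp: two_form_def\<close>)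
  then show "continuous_on (z ` K) (\<lambda>p. indicator (z ` V) p *\<^sub>R \<omega> (V, z) p)"
    by (rule continuous_on_eq) (use K(2) in \<open>auto simp: indicator_def\<close>)
  fix p assume "p \<notin> z ` K"
  then show "indicator (z ` V) p *\<^sub>R \<omega> (V, z) p = 0"
    using K(3) c by (auto simp: supported_in_def indicator_def)
qed

text \<open>Off the overlap both coefficients vanish, so both integrals may be cut down to it. There
  the transformation rule of the form cancels the Jacobian of the change of variables.\<close>

lemma chart_integral_change:
  fixes \<omega> :: "'a::compact_riemann_surface chart \<Rightarrow> complex \<Rightarrow> real"
  assumes \<omega>: "two_form \<omega>" and c: "(V, z) \<in> charts" and d: "(W, w) \<in> charts"
    and K: "closed K" "K \<subseteq> V \<inter> W" "supported_in \<omega> K"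
  shows "chart_integral (V, z) \<omega> = chart_integral (W, w) \<omega>"
proof -
  have ind: "indicator (z ` V) p *\<^sub>R \<omega> (V, z) p = indicator (z ` (V \<inter> W)) p *\<^sub>R \<omega> (V, z) p"
    if "(V, z) \<in> charts" "K \<subseteq> W" for V W p and z :: "'a \<Rightarrow> complex"
  proof (cases "p \<in> z ` V - z ` (V \<inter> W)")
    case True
    then obtain x where x: "x \<in> V" "p = z x" "x \<notin> W" by blast
    then have "\<omega> (V, z) p = 0" using that K(3) unfolding supported_in_def by blast
    then show ?thesis by simp
  qed (auto simp: indicator_def)
  have cut: "set_lebesgue_integral lborel (z ` V) (\<omega> (V, z)) =
      set_lebesgue_integral lborel (z ` (V \<inter> W)) (\<omega> (V, z))"
    if "(V, z) \<in> charts" "K \<subseteq> W" for V W and z :: "'a \<Rightarrow> complex"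
    unfolding set_lebesgue_integral_def ind[OF that] ..
  have cutI: "set_integrable lborel (w ` (V \<inter> W)) (\<omega> (W, w))"
  proof -
    have "K \<subseteq> V" "K \<subseteq> W" using K(2) by auto
    then show ?thesis
      using chart_integrable[OF \<omega> d K(1) _ K(3)]
      unfolding set_integrable_def ind[OF d \<open>K \<subseteq> V\<close>] by (simp only: Int_commute)
  qed
  define \<phi> where "\<phi> = w \<circ> inv_into V z"
  define S where "S = z ` (V \<inter> W)"
  note t = chart_transition[OF c d, folded \<phi>_def S_def]
  have "chart_integral (W, w) \<omega> = set_lebesgue_integral lborel (w ` (W \<inter> V)) (\<omega> (W, w))"
    using cut[OF d, of V] K(2) by (simp add: chart_integral_def)
  also have "\<dots> = set_lebesgue_integral lborel (\<phi> ` S) (\<omega> (W, w))"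
    using t(4) by (simp add: Int_commute)
  also have "\<dots> = set_lebesgue_integral lborel S (\<lambda>p. (cmod (deriv \<phi> p))\<^sup>2 * \<omega> (W, w) (\<phi> p))"
    by (rule holo_change_of_variables[OF t(1-3)]) (use cutI t(4) in simp)
  also have "\<dots> = set_lebesgue_integral lborel S (\<omega> (V, z))"
  proof (rule set_lebesgue_integral_cong)
    show "S \<in> sets lborel" using t(2) by simp
    show "\<forall>p. p \<in> S \<longrightarrow> (cmod (deriv \<phi> p))\<^sup>2 * \<omega> (W, w) (\<phi> p) = \<omega> (V, z) p"
    proof (intro allI impI)
      fix p assume "p \<in> S"
      then obtain x where x: "x \<in> V \<inter> W" "p = z x" by (auto simp: S_def)
      then have "\<phi> p = w x" using chart_facts(4)[OF c] by (simp add: \<phi>_def)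
      moreover have "\<omega> (V, z) (z x) = (cmod (deriv \<phi> (z x)))\<^sup>2 * \<omega> (W, w) (w x)"
        using \<omega> c d x(1) unfolding two_form_def \<phi>_def by blast
      ultimately show "(cmod (deriv \<phi> p))\<^sup>2 * \<omega> (W, w) (\<phi> p) = \<omega> (V, z) p" using x by simp
    qed
  qed
  also have "\<dots> = chart_integral (V, z) \<omega>"
    using cut[OF c, of W] K(2) by (simp add: chart_integral_def S_def)
  finally show ?thesis by simp
qed

definition partition_integral ::
    "nat \<Rightarrow> (nat \<Rightarrow> 'a chart) \<Rightarrow> (nat \<Rightarrow> 'a \<Rightarrow> real) \<Rightarrow> ('a chart \<Rightarrow> complex \<Rightarrow> real) \<Rightarrow> real" where
  "partition_integral n c \<rho> \<omega> = (\<Sum>k<n. chart_integral (c k) (mult_form (\<rho> k) \<omega>))"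

lemma chart_integral_cong:
  assumes "(V, z) \<in> charts" "\<And>p. p \<in> z ` V \<Longrightarrow> \<omega> (V, z) p = \<omega>' (V, z) p"
  shows "chart_integral (V, z) \<omega> = chart_integral (V, z) \<omega>'"
  unfolding chart_integral_def
  by (rule set_lebesgue_integral_cong) (use assms chart_facts(2)[OF assms(1)] in auto)

lemma chart_integral_sum:
  fixes \<omega> :: "'i \<Rightarrow> 'a::compact_riemann_surface chart \<Rightarrow> complex \<Rightarrow> real"
  assumes "finite I" "\<And>i. i \<in> I \<Longrightarrow> two_form (\<omega> i)" "(V, z) \<in> charts"
    "\<And>i. i \<in> I \<Longrightarrow> supported_in (\<omega> i) K" "closed K" "K \<subseteq> V"
  shows "chart_integral (V, z) (\<lambda>c p. \<Sum>i\<in>I. \<omega> i c p) = (\<Sum>i\<in>I. chart_integral (V, z) (\<omega> i))"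
proof -
  have "integrable lborel (\<lambda>p. indicator (z ` V) p *\<^sub>R \<omega> i (V, z) p)" if "i \<in> I" for i
    using chart_integrable[OF assms(2)[OF that] assms(3,5,6) assms(4)[OF that]]
    by (simp add: set_integrable_def)
  then show ?thesis
    unfolding chart_integral_def set_lebesgue_integral_def
    by (simp add: sum_distrib_left Bochner_Integration.integral_sum)
qed

lemma partition_of_unityD:
  assumes "partition_of_unity n c \<rho>" "k < n"
  shows "c k \<in> charts" "continuous_on UNIV (\<rho> k)" "closure {x. \<rho> k x \<noteq> 0} \<subseteq> fst (c k)"
  using assms by (auto simp: partition_of_unity_def)

text \<open>Every weighted piece is supported in its own chart and in \<open>W\<close>, so it can be
  moved to \<open>W\<close>, where the weights add up to 1.\<close>

lemma partition_integral_supported: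
  fixes \<omega> :: "'a::compact_riemann_surface chart \<Rightarrow> complex \<Rightarrow> real"
  assumes p: "partition_of_unity n c \<rho>" and \<omega>: "two_form \<omega>"
    and d: "(W, w) \<in> charts" and K: "closed K" "K \<subseteq> W" "supported_in \<omega> K"
  shows "partition_integral n c \<rho> \<omega> = chart_integral (W, w) \<omega>"
proof -
  have "chart_integral (c k) (mult_form (\<rho> k) \<omega>) = chart_integral (W, w) (mult_form (\<rho> k) \<omega>)"
    if k: "k < n" for k
  proof -
    note P = partition_of_unityD[OF p k]
    obtain V z where c: "c k = (V, z)" by (cases "c k")
    show ?thesis unfolding c
    proof (rule chart_integral_change[where K = "closure {x. \<rho> k x \<noteq> 0} \<inter> K"])
      show "supported_in (mult_form (\<rho> k) \<omega>) (closure {x. \<rho> k x \<noteq> 0} \<inter> K)"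
        using supported_in_mult_left[OF order_refl, of "\<rho> k" \<omega>] supported_in_mult_right[OF K(3), of "\<rho> k"]
        unfolding supported_in_def by blast
    qed (use P c d K two_form_mult[OF \<omega> P(2)] in auto)
  qed
  then have "partition_integral n c \<rho> \<omega> = (\<Sum>k<n. chart_integral (W, w) (mult_form (\<rho> k) \<omega>))"
    by (simp add: partition_integral_def)
  also have "\<dots> = chart_integral (W, w) (\<lambda>c p. \<Sum>k<n. mult_form (\<rho> k) \<omega> c p)"
    by (rule chart_integral_sum[symmetric, where K = K])
      (use d K two_form_mult[OF \<omega>] partition_of_unityD[OF p] supported_in_mult_right in auto)
  also have "\<dots> = chart_integral (W, w) \<omega>"
    by (rule chart_integral_cong[OF d])
      (use p in \<open>auto simp: mult_form_def sum_distrib_right[symmetric] partition_of_unity_def\<close>)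
  finally show ?thesis .
qed

text \<open>Pass to the products of the two families of weights and exchange the sums.\<close>

lemma partition_integral_unique:
  fixes \<omega> :: "'a::compact_riemann_surface chart \<Rightarrow> complex \<Rightarrow> real"
  assumes p: "partition_of_unity n c \<rho>" and q: "partition_of_unity m d \<sigma>" and \<omega>: "two_form \<omega>"
  shows "partition_integral n c \<rho> \<omega> = partition_integral m d \<sigma> \<omega>"
proof -
  have comm: "mult_form (\<rho> k) (mult_form (\<sigma> l) \<omega>) = mult_form (\<sigma> l) (mult_form (\<rho> k) \<omega>)" for k l
    by (auto simp: mult_form_def fun_eq_iff)
  have "partition_integral m d \<sigma> \<omega> = (\<Sum>l<m. partition_integral n c \<rho> (mult_form (\<sigma> l) \<omega>))"
    unfolding partition_integral_def[of m]
  proof (rule sum.cong[OF refl])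
    fix l assume "l \<in> {..<m}"
    then have l: "l < m" by simp
    note Q = partition_of_unityD[OF q l]
    obtain W w where c: "d l = (W, w)" by (cases "d l")
    show "chart_integral (d l) (mult_form (\<sigma> l) \<omega>) = partition_integral n c \<rho> (mult_form (\<sigma> l) \<omega>)"
      unfolding c
      by (rule partition_integral_supported[OF p two_form_mult[OF \<omega> Q(2)], symmetric,
            where K = "closure {x. \<sigma> l x \<noteq> 0}"])
        (use Q c supported_in_mult_left[OF order_refl] in auto)
  qed
  also have "\<dots> = (\<Sum>k<n. \<Sum>l<m. chart_integral (c k) (mult_form (\<sigma> l) (mult_form (\<rho> k) \<omega>)))"
    unfolding partition_integral_def comm by (rule sum.swap)
  also have "\<dots> = (\<Sum>k<n. chart_integral (c k) (mult_form (\<rho> k) \<omega>))"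
  proof (rule sum.cong[OF refl])
    fix k assume "k \<in> {..<n}"
    then have k: "k < n" by simp
    note P = partition_of_unityD[OF p k]
    obtain V z where c: "c k = (V, z)" by (cases "c k")
    have cc: "(V, z) \<in> charts" using P c by simp
    have "(\<Sum>l<m. chart_integral (V, z) (mult_form (\<sigma> l) (mult_form (\<rho> k) \<omega>))) =
      chart_integral (V, z) (\<lambda>c p. \<Sum>l<m. mult_form (\<sigma> l) (mult_form (\<rho> k) \<omega>) c p)"
      by (rule chart_integral_sum[symmetric, where K = "closure {x. \<rho> k x \<noteq> 0}"])
        (use P c two_form_mult[OF two_form_mult[OF \<omega>]] partition_of_unityD[OF q]
          supported_in_mult_right[OF supported_in_mult_left[OF order_refl]] in auto)
    also have "\<dots> = chart_integral (V, z) (mult_form (\<rho> k) \<omega>)"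
      by (rule chart_integral_cong[OF cc])
        (use q in \<open>auto simp: mult_form_def sum_distrib_right[symmetric] partition_of_unity_def\<close>)
    finally show "(\<Sum>l<m. chart_integral (c k) (mult_form (\<sigma> l) (mult_form (\<rho> k) \<omega>))) =
      chart_integral (c k) (mult_form (\<rho> k) \<omega>)" by (simp add: c)
  qed
  finally show ?thesis by (simp add: partition_integral_def)
qed

lemma exists_C2_partition_of_unity:
  obtains n and c :: "nat \<Rightarrow> 'a::compact_riemann_surface chart" and \<rho>
  where "partition_of_unity n c \<rho>" "\<And>k. k < n \<Longrightarrow> C2_fun UNIV (\<rho> k)"
proof -
  have "\<exists>c. c \<in> charts \<and> x \<in> fst c" for x :: 'a
    using chart_around[of x] by (metis fst_conv)
  then obtain h where h: "\<And>x::'a. h x \<in> charts" "\<And>x. x \<in> fst (h x)" by metis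
  have o: "open (fst (h x))" for x using chart_facts(1)[of "fst (h x)" "snd (h x)"] h(1) by simp
  obtain n :: nat and a \<rho> where r: "\<And>k. k < n \<Longrightarrow> C2_fun UNIV (\<rho> k)" "\<And>k y. \<rho> k y \<ge> (0::real)"
    "\<And>k. k < n \<Longrightarrow> closure {y. \<rho> k y \<noteq> 0} \<subseteq> fst (h (a k))" "\<And>y. (\<Sum>k<n. \<rho> k y) = 1"
    using C2_partition_of_unity[of "\<lambda>x. fst (h x)", OF o h(2)] by metis
  have "partition_of_unity n (\<lambda>k. h (a k)) \<rho>"
    unfolding partition_of_unity_def using r h(1) C2_fun_continuous[OF r(1) open_UNIV] by auto
  then show ?thesis using that r(1) by blast
qed

lemma surface_integral_eq:
  fixes \<omega> :: "'a::compact_riemann_surface chart \<Rightarrow> complex \<Rightarrow> real"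
  assumes \<omega>: "two_form \<omega>" and p: "partition_of_unity n c \<rho>"
  shows "surface_integral \<omega> = partition_integral n c \<rho> \<omega>"
proof -
  have e: "(\<Sum>k<n. case c k of (V, z) \<Rightarrow>
      set_lebesgue_integral lborel (z ` V) (\<lambda>p. \<rho> k (inv_into V z p) * \<omega> (V, z) p)) =
      partition_integral n c \<rho> \<omega>" for n \<rho> and c :: "nat \<Rightarrow> 'a chart"
    unfolding partition_integral_def chart_integral_def mult_form_def
    by (rule sum.cong[OF refl]) (simp split: prod.split)
  show ?thesis unfolding surface_integral_def e
    by (rule the_equality) (use p partition_integral_unique[OF _ _ \<omega>] in metis)+
qed

lemma surface_integral_cong:
  fixes \<omega> \<omega>' :: "'a::compact_riemann_surface chart \<Rightarrow> complex \<Rightarrow> real"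
  assumes "\<And>V z x. (V, z) \<in> charts \<Longrightarrow> x \<in> V \<Longrightarrow> \<omega> (V, z) (z x) = \<omega>' (V, z) (z x)"
    "two_form \<omega>" "two_form \<omega>'"
  shows "surface_integral \<omega> = surface_integral \<omega>'"
proof -
  obtain n and c :: "nat \<Rightarrow> 'a chart" and \<rho> where p: "partition_of_unity n c \<rho>"
    using exists_C2_partition_of_unity by metis
  have "chart_integral (c k) (mult_form (\<rho> k) \<omega>) = chart_integral (c k) (mult_form (\<rho> k) \<omega>')"
    if "k < n" for k
  proof -
    obtain V z where c: "c k = (V, z)" by (cases "c k")
    then have cc: "(V, z) \<in> charts" using partition_of_unityD(1)[OF p that] by simp
    show ?thesis unfolding c
      by (rule chart_integral_cong[OF cc]) (use assms(1)[OF cc] in \<open>auto simp: mult_form_def\<close>)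
  qed
  then show ?thesis
    unfolding surface_integral_eq[OF assms(2) p] surface_integral_eq[OF assms(3) p]
    by (simp add: partition_integral_def)
qed

lemma two_form_sum:
  assumes "\<And>i. i \<in> I \<Longrightarrow> two_form (\<omega> i)"
  shows "two_form (\<lambda>c p. \<Sum>i\<in>I. \<omega> i c p)"
proof -
  have "(\<Sum>i\<in>I. \<omega> i (V, z) (z x)) =
      (cmod (deriv (w \<circ> inv_into V z) (z x)))\<^sup>2 * (\<Sum>i\<in>I. \<omega> i (W, w) (w x))"
    if "(V, z) \<in> charts" "(W, w) \<in> charts" "x \<in> V \<inter> W" for V W x and z w :: "'b \<Rightarrow> complex"
    unfolding sum_distrib_left
    by (rule sum.cong[OF refl]) (use assms that in \<open>unfold two_form_def, blast\<close>)
  moreover have "continuous_on (z ` V) (\<lambda>p. \<Sum>i\<in>I. \<omega> i (V, z) p)"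
    if "(V, z) \<in> charts" for V and z :: "'b \<Rightarrow> complex"
    by (rule continuous_on_sum) (use assms that in \<open>unfold two_form_def, blast\<close>)
  ultimately show ?thesis unfolding two_form_def by blast
qed

lemma surface_integral_sum:
  fixes \<omega> :: "'i \<Rightarrow> 'a::compact_riemann_surface chart \<Rightarrow> complex \<Rightarrow> real"
  assumes I: "finite I" and \<omega>: "\<And>i. i \<in> I \<Longrightarrow> two_form (\<omega> i)"
  shows "surface_integral (\<lambda>c p. \<Sum>i\<in>I. \<omega> i c p) = (\<Sum>i\<in>I. surface_integral (\<omega> i))"
proof -
  obtain n and c :: "nat \<Rightarrow> 'a chart" and \<rho> where p: "partition_of_unity n c \<rho>"
    using exists_C2_partition_of_unity by metis
  have "chart_integral (c k) (mult_form (\<rho> k) (\<lambda>c p. \<Sum>i\<in>I. \<omega> i c p)) =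
      (\<Sum>i\<in>I. chart_integral (c k) (mult_form (\<rho> k) (\<omega> i)))" if k: "k < n" for k
  proof -
    note P = partition_of_unityD[OF p k]
    obtain V z where c: "c k = (V, z)" by (cases "c k")
    have "mult_form (\<rho> k) (\<lambda>c p. \<Sum>i\<in>I. \<omega> i c p) = (\<lambda>c p. \<Sum>i\<in>I. mult_form (\<rho> k) (\<omega> i) c p)"
      by (simp add: mult_form_def sum_distrib_left)
    moreover have "chart_integral (V, z) (\<lambda>c p. \<Sum>i\<in>I. mult_form (\<rho> k) (\<omega> i) c p) =
        (\<Sum>i\<in>I. chart_integral (V, z) (mult_form (\<rho> k) (\<omega> i)))"
      by (rule chart_integral_sum[OF I, where K = "closure {x. \<rho> k x \<noteq> 0}"])
        (use P c two_form_mult[OF \<omega>] supported_in_mult_left[OF order_refl] in auto)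
    ultimately show ?thesis by (simp add: c)
  qed
  then have "partition_integral n c \<rho> (\<lambda>c p. \<Sum>i\<in>I. \<omega> i c p) = (\<Sum>i\<in>I. partition_integral n c \<rho> (\<omega> i))"
    unfolding partition_integral_def by (subst sum.swap) simp
  then show ?thesis
    using surface_integral_eq[OF two_form_sum[of I \<omega>, OF \<omega>] p] surface_integral_eq[OF \<omega> p] by simp
qed

lemma surface_integral_add:
  assumes "two_form \<omega>" "two_form \<omega>'"
  shows "surface_integral (\<lambda>c p. \<omega> c p + \<omega>' c p) = surface_integral \<omega> + surface_integral \<omega>'"
    and "two_form (\<lambda>c p. \<omega> c p + \<omega>' c p)"
  using surface_integral_sum[of "{0, 1::nat}" "\<lambda>i. if i = 0 then \<omega> else \<omega>'"]
    two_form_sum[of "{0, 1::nat}" "\<lambda>i. if i = 0 then \<omega> else \<omega>'"] assms by auto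

lemma surface_integral_cmult:
  assumes "two_form \<omega>"
  shows "surface_integral (\<lambda>c p. r * \<omega> c p) = r * surface_integral \<omega>"
    and "two_form (\<lambda>c p. r * \<omega> c p)"
proof -
  obtain n and c :: "nat \<Rightarrow> 'a chart" and \<rho> where p: "partition_of_unity n c \<rho>"
    using exists_C2_partition_of_unity by metis
  show t: "two_form (\<lambda>c p. r * \<omega> c p)"
    using two_form_mult[OF assms continuous_on_const, of r] by (simp add: mult_form_def)
  have "chart_integral (c k) (mult_form (\<rho> k) (\<lambda>c p. r * \<omega> c p)) =
      r * chart_integral (c k) (mult_form (\<rho> k) \<omega>)" for k
    by (simp add: chart_integral_def mult_form_def mult.left_commute[of _ r] set_integral_mult_right)
  then show "surface_integral (\<lambda>c p. r * \<omega> c p) = r * surface_integral \<omega>"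
    unfolding surface_integral_eq[OF assms p] surface_integral_eq[OF t p]
    by (simp add: partition_integral_def sum_distrib_left)
qed

section \<open>The integral of a Laplacian vanishes\<close>

definition laplacian_form :: "('a::riemann_surface \<Rightarrow> real) \<Rightarrow> 'a chart \<Rightarrow> complex \<Rightarrow> real" where
  "laplacian_form u = (\<lambda>c. laplacian (\<lambda>p. u (inv_into (fst c) (snd c) p)))"

text \<open>Conformal invariance turns the Laplacian into a two-form. It is stated over an open set
  because it will also be applied to the logarithm of a metric, which is defined only on the domain
  of a frame.\<close>

lemma laplacian_chart_change:
  assumes U: "open U" and u: "C2_fun U u" and c: "(V, z) \<in> charts" "(W, w) \<in> charts" and x: "x \<in> U \<inter> V \<inter> W"
  shows "laplacian (\<lambda>p. u (inv_into V z p)) (z x) =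
    (cmod (deriv (w \<circ> inv_into V z) (z x)))\<^sup>2 * laplacian (\<lambda>p. u (inv_into W w p)) (w x)"
proof -
  note C = chart_facts[OF c(1)] and D = chart_facts[OF c(2)]
  define \<phi> where "\<phi> = w \<circ> inv_into V z"
  define S where "S = z ` (U \<inter> V \<inter> W)"
  have S: "open S" unfolding S_def by (rule C(9)) (use U C(1) D(1) in auto)
  have T: "open (w ` (U \<inter> W))" by (rule D(9)) (use U D(1) in auto)
  have h: "\<phi> holomorphic_on S" unfolding \<phi>_def S_def
    by (rule holomorphic_on_subset[OF chart_transition(1)[OF c]]) auto
  have sub: "\<phi> ` S \<subseteq> w ` (U \<inter> W)" using C(4) by (auto simp: \<phi>_def S_def)
  have xS: "z x \<in> S" using x by (auto simp: S_def)
  have \<phi>x: "\<phi> (z x) = w x" using C(4) x by (simp add: \<phi>_def)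
  have "laplacian (\<lambda>p. u (inv_into V z p)) (z x) = laplacian (\<lambda>p. u (inv_into W w (\<phi> p))) (z x)"
  proof (rule laplacian_cong[OF _ S xS])
    show "C2_on S (\<lambda>p. u (inv_into V z p))"
      using C2_funD[OF u c(1), of "U \<inter> V \<inter> W"] U C(1) D(1) by (auto simp: S_def o_def)
    show "u (inv_into V z q) = u (inv_into W w (\<phi> q))" if "q \<in> S" for q
      using that C(4) D(4) by (auto simp: S_def \<phi>_def)
  qed
  also have "\<dots> = (cmod (deriv \<phi> (z x)))\<^sup>2 * laplacian (\<lambda>p. u (inv_into W w p)) (\<phi> (z x))"
    using laplacian_holo_comp[OF C2_funD'[OF u c(2)] T h S sub xS] .
  finally show ?thesis by (simp add: \<phi>x \<phi>_def[symmetric])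
qed

lemma two_form_laplacian:
  assumes u: "C2_fun UNIV u" shows "two_form (laplacian_form u)"
  unfolding two_form_def laplacian_form_def fst_conv snd_conv
proof (intro conjI allI impI; (elim conjE)?)
  fix V and z :: "'a \<Rightarrow> complex" assume c: "(V, z) \<in> charts"
  show "continuous_on (z ` V) (laplacian (\<lambda>p. u (inv_into V z p)))"
    by (rule laplacian_continuous[OF chart_facts(2)[OF c]]) (use C2_funD'[OF u c] in simp)
next
  fix V W x and z w :: "'a \<Rightarrow> complex"
  assume "(V, z) \<in> charts" "(W, w) \<in> charts" "x \<in> V \<inter> W"
  then show "laplacian (\<lambda>p. u (inv_into V z p)) (z x) =
      (cmod (deriv (w \<circ> inv_into V z) (z x)))\<^sup>2 * laplacian (\<lambda>p. u (inv_into W w p)) (w x)"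
    by (intro laplacian_chart_change[OF open_UNIV u]) auto
qed

text \<open>One chart carries the whole integral, and there it is the integral over the plane of the
  Laplacian of a compactly supported function.\<close>

lemma surface_integral_laplacian_supported:
  fixes v :: "'a::compact_riemann_surface \<Rightarrow> real"
  assumes v: "C2_fun UNIV v" and c: "(V, z) \<in> charts" and K: "closed K" "K \<subseteq> V" "\<And>x. x \<notin> K \<Longrightarrow> v x = 0"
  shows "surface_integral (laplacian_form v) = 0"
proof -
  note C = chart_facts[OF c]
  have ze: "laplacian (\<lambda>p. v (inv_into W w p)) (w x) = 0"
    if d: "(W, w) \<in> charts" and x: "x \<in> W - K" for W x and w :: "'a \<Rightarrow> complex"
  proof -
    note D = chart_facts[OF d]
    have o: "open (w ` (W - K))" by (rule D(9)) (use D(1) K(1) in auto)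
    have "laplacian (\<lambda>p. 0) (w x) = laplacian (\<lambda>p. v (inv_into W w p)) (w x)"
      by (rule laplacian_cong[OF C2_on_const[OF o] o]) (use x K(3) D(4) in auto)
    moreover have "laplacian (\<lambda>p. 0) (w x) = 0"
      using laplacian_eq[OF open_UNIV UNIV_I has_partials_const has_partials_const has_partials_const] by simp
    ultimately show ?thesis by simp
  qed
  have sup: "supported_in (laplacian_form v) K"
    using ze by (auto simp: supported_in_def laplacian_form_def)
  obtain n and d :: "nat \<Rightarrow> 'a chart" and \<rho> where p: "partition_of_unity n d \<rho>"
    using exists_C2_partition_of_unity by metis
  have "surface_integral (laplacian_form v) = chart_integral (V, z) (laplacian_form v)"
    using surface_integral_eq[OF two_form_laplacian[OF v] p]
      partition_integral_supported[OF p two_form_laplacian[OF v] c K(1,2) sup] by simp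
  also have "\<dots> = 0"
  proof -
    \<comment> \<open>Extended by zero, \<open>v\<close> stays twice differentiable: near the image
      of \<open>K\<close> it is read in the chart, and off that compact set it vanishes.\<close>
    define e where "e = (\<lambda>p. if p \<in> z ` V then v (inv_into V z p) else 0)"
    have cK: "compact (z ` K)"
      using compact_continuous_image[OF continuous_on_subset[OF C(7) K(2)]]
        compact_Int_closed[OF compact_surface K(1)] by simp
    have out: "e p = 0" if "p \<notin> z ` K" for p
    proof (cases "p \<in> z ` V")
      case True
      then obtain x where "x \<in> V" "p = z x" by blast
      then have "x \<notin> K" "inv_into V z p = x" using that C(4) by auto
      then show ?thesis using K(3) by (simp add: e_def)
    qed (simp add: e_def)
    have oK: "open (- z ` K)" using cK compact_imp_closed by blast
    have c1: "C2_on (z ` V) (\<lambda>p. v (inv_into V z p))" using C2_funD'[OF v c] by simp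
    have e1: "C2_on (z ` V) e" by (rule C2_on_cong[OF c1 C(2)]) (simp add: e_def)
    have e2: "C2_on (- z ` K) e" by (rule C2_on_cong[OF C2_on_const[OF oK, of 0] oK]) (use out in auto)
    have "C2_on UNIV e"
    proof (rule C2_on_local)
      fix p :: complex
      show "\<exists>T. open T \<and> p \<in> T \<and> T \<subseteq> UNIV \<and> C2_on T e"
        using e1 e2 C(2) oK K(2) by (cases "p \<in> z ` V") blast+
    qed
    then have "(\<integral>p. laplacian e p \<partial>lborel) = 0"
      using integral_laplacian_eq_0[OF _ cK] out by blast
    moreover have "indicator (z ` V) p *\<^sub>R laplacian_form v (V, z) p = laplacian e p" for p
    proof (cases "p \<in> z ` V")
      case True
      have "laplacian (\<lambda>p. v (inv_into V z p)) p = laplacian e p"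
        by (rule laplacian_cong[OF c1 C(2) True]) (simp add: e_def)
      then show ?thesis using True by (simp add: laplacian_form_def)
    next
      case False
      have "laplacian (\<lambda>p. 0) p = laplacian e p"
        by (rule laplacian_cong[OF C2_on_const[OF oK] oK]) (use False K(2) out in auto)
      moreover have "laplacian (\<lambda>p. 0) p = 0"
        using laplacian_eq[OF open_UNIV UNIV_I has_partials_const has_partials_const has_partials_const] by simp
      ultimately show ?thesis using False by simp
    qed
    ultimately show ?thesis
      by (simp add: chart_integral_def set_lebesgue_integral_def)
  qed
  finally show ?thesis .
qed

text \<open>A partition of unity that is itself of class C2 splits \<open>u\<close> into pieces,
  each supported in one chart, to which the previous lemma applies.\<close>

lemma surface_integral_laplacian:
  fixes u :: "'a::compact_riemann_surface \<Rightarrow> real"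
  assumes u: "C2_fun UNIV u"
  shows "surface_integral (laplacian_form u) = 0"
proof -
  obtain n and c :: "nat \<Rightarrow> 'a chart" and \<rho> where p: "partition_of_unity n c \<rho>"
    and C2: "\<And>k. k < n \<Longrightarrow> C2_fun UNIV (\<rho> k)"
    using exists_C2_partition_of_unity by metis
  define v where "v = (\<lambda>k x. \<rho> k x * u x)"
  have v: "C2_fun UNIV (v k)" if "k < n" for k
    unfolding v_def using C2_fun_mult[OF open_UNIV C2[OF that] u] .
  have uv: "u x = (\<Sum>k<n. v k x)" for x
    using p by (simp add: v_def sum_distrib_right[symmetric] partition_of_unity_def)
  have lap: "laplacian_form u (V, z) (z x) = (\<Sum>k<n. laplacian_form (v k) (V, z) (z x))"
    if c: "(V, z) \<in> charts" and x: "x \<in> V" for V x and z :: "'a \<Rightarrow> complex"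
  proof -
    have o: "open (z ` V)" and zx: "z x \<in> z ` V" using chart_facts(2)[OF c] x by auto
    have C: "C2_on (z ` V) (\<lambda>p. v k (inv_into V z p))" if "k < n" for k
      using C2_funD'[OF v[OF that] c] by simp
    have "m \<le> n \<Longrightarrow> C2_on (z ` V) (\<lambda>p. \<Sum>k<m. v k (inv_into V z p)) \<and>
        laplacian (\<lambda>p. \<Sum>k<m. v k (inv_into V z p)) (z x) = (\<Sum>k<m. laplacian (\<lambda>p. v k (inv_into V z p)) (z x))" for m
    proof (induction m)
      case 0
      have "laplacian (\<lambda>p. 0) (z x) = 0"
        using laplacian_eq[OF open_UNIV UNIV_I has_partials_const has_partials_const has_partials_const] by simp
      then show ?case using C2_on_const[OF o] by simp
    next
      case (Suc m)
      then show ?case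
        using C2_on_add[OF o _ C[of m]] laplacian_add[OF o zx _ C[of m]] by simp
    qed
    from this[of n] show ?thesis by (simp add: laplacian_form_def uv)
  qed
  have "surface_integral (laplacian_form u) = surface_integral (\<lambda>c p. \<Sum>k<n. laplacian_form (v k) c p)"
    by (rule surface_integral_cong[OF _ two_form_laplacian[OF u] two_form_sum])
      (use lap two_form_laplacian[OF v] in auto)
  also have "\<dots> = (\<Sum>k<n. surface_integral (laplacian_form (v k)))"
    by (rule surface_integral_sum) (use two_form_laplacian[OF v] in auto)
  also have "\<dots> = 0"
  proof (rule sum.neutral, rule ballI)
    fix k assume "k \<in> {..<n}"
    then have k: "k < n" by simp
    obtain V z where c: "c k = (V, z)" by (cases "c k")
    show "surface_integral (laplacian_form (v k)) = 0"
    proof (rule surface_integral_laplacian_supported[OF v[OF k], of V z "closure {x. \<rho> k x \<noteq> 0}"])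
      show "v k x = 0" if "x \<notin> closure {x. \<rho> k x \<noteq> 0}" for x
        using that closure_subset[of "{x. \<rho> k x \<noteq> 0}"] by (auto simp: v_def)
    qed (use partition_of_unityD[OF p k] c in auto)
  qed
  finally show ?thesis .
qed

section \<open>Frames\<close>

lemma restr_apply: "restr U s x = (if x \<in> U then s x else 0)"
  by (simp add: restr_def)

lemma restr_restr: "restr V (restr U s) = restr (V \<inter> U) s"
  by (auto simp: restr_def fun_eq_iff)

lemma module_sheafD:
  assumes "module_sheaf F" "open U"
  shows "0 \<in> F U" "s \<in> F U \<Longrightarrow> restr U s = s" "s \<in> F U \<Longrightarrow> t \<in> F U \<Longrightarrow> s + t \<in> F U"
    "holo_fun U f \<Longrightarrow> s \<in> F U \<Longrightarrow> fmult U f s \<in> F U"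
    "open V \<Longrightarrow> V \<subseteq> U \<Longrightarrow> s \<in> F U \<Longrightarrow> restr V s \<in> F V"
  using assms unfolding module_sheaf_def by metis+

lemma module_sheaf_glue:
  assumes "module_sheaf F" "\<And>U. U \<in> \<U> \<Longrightarrow> open U" "\<And>U. U \<in> \<U> \<Longrightarrow> restr U s \<in> F U"
  shows "restr (\<Union>\<U>) s \<in> F (\<Union>\<U>)"
  using assms unfolding module_sheaf_def by metis

lemma module_sheaf_zero_outside:
  assumes "module_sheaf F" "open U" "s \<in> F U" "x \<notin> U"
  shows "s x = 0"
  using module_sheafD(2)[OF assms(1-3)] assms(4) by (metis restr_apply)

lemma module_sheaf_lincomb:
  assumes F: "module_sheaf F" "open U"
  shows "(\<And>i. i < (r::nat) \<Longrightarrow> holo_fun U (f i)) \<Longrightarrow> (\<And>i. i < r \<Longrightarrow> s i \<in> F U) \<Longrightarrow>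
    restr U (\<lambda>x k. \<Sum>i<r. f i x * s i x k) \<in> F U"
proof (induction r)
  case 0
  have "restr U (\<lambda>x k. \<Sum>i<0::nat. f i x * s i x k) = 0" by (auto simp: restr_def fun_eq_iff)
  then show ?case using module_sheafD(1)[OF F] by (simp only:)
next
  case (Suc r)
  have eq: "restr U (\<lambda>x k. \<Sum>i<Suc r. f i x * s i x k) =
      restr U (\<lambda>x k. \<Sum>i<r. f i x * s i x k) + fmult U (f r) (s r)"
    by (auto simp: restr_def fmult_def fun_eq_iff)
  show ?case unfolding eq
    by (rule module_sheafD(3)[OF F]; (rule module_sheafD(4)[OF F])?; (rule Suc.IH)?) (use Suc.prems in auto)
qed

lemma frameD:
  assumes "frame r F U e"
  shows "open U" "i < r \<Longrightarrow> e i \<in> F U"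
  using assms by (auto simp: frame_def)

lemma frame_onD:
  assumes "frame r F U e" "open V" "V \<subseteq> U"
  shows "\<forall>s\<in>F V. \<exists>f. (\<forall>i<r. holo_fun V (f i)) \<and> (\<forall>x\<in>V. \<forall>k. s x k = (\<Sum>i<r. f i x * e i x k))"
    "\<forall>f. (\<forall>i<r. holo_fun V (f i)) \<and> (\<forall>x\<in>V. \<forall>k. (\<Sum>i<r. f i x * e i x k) = 0) \<longrightarrow>
      (\<forall>i<r. \<forall>x\<in>V. f i x = 0)"
  using assms(1)[unfolded frame_def, THEN conjunct2, THEN conjunct2, THEN spec, of V] assms(2,3) by auto

lemma frame_coeffs:
  assumes "frame r F U e" "open V" "V \<subseteq> U" "s \<in> F V"
  obtains f where "\<And>i. i < r \<Longrightarrow> holo_fun V (f i)"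
    "\<And>x k. x \<in> V \<Longrightarrow> s x k = (\<Sum>i<r. f i x * e i x k)"
proof -
  obtain f where "\<forall>i<r. holo_fun V (f i)" "\<forall>x\<in>V. \<forall>k. s x k = (\<Sum>i<r. f i x * e i x k)"
    using bspec[OF frame_onD(1)[OF assms(1-3)] assms(4)] by auto
  then show ?thesis using that by metis
qed

lemma frame_indep:
  assumes "frame r F U e" "open V" "V \<subseteq> U" "\<And>i. i < r \<Longrightarrow> holo_fun V (f i)"
    "\<And>x k. x \<in> V \<Longrightarrow> (\<Sum>i<r. f i x * e i x k) = 0" "i < r" "x \<in> V"
  shows "f i x = 0"
proof -
  have "\<forall>i<r. \<forall>x\<in>V. f i x = 0"
    by (rule frame_onD(2)[OF assms(1-3), THEN spec, THEN mp]) (simp add: assms(4,5))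
  then show ?thesis using assms(6,7) by simp
qed

lemma frame_unique:
  assumes "frame r F U e" "open V" "V \<subseteq> U" "\<And>i. i < r \<Longrightarrow> holo_fun V (f i)" "\<And>i. i < r \<Longrightarrow> holo_fun V (g i)"
    "\<And>x k. x \<in> V \<Longrightarrow> (\<Sum>i<r. f i x * e i x k) = (\<Sum>i<r. g i x * e i x k)" "i < r" "x \<in> V"
  shows "f i x = g i x"
proof -
  have "f i x - g i x = 0"
    by (rule frame_indep[OF assms(1-3), where f = "\<lambda>i x. f i x - g i x"])
      (use assms in \<open>auto simp: algebra_simps sum_subtractf intro: holo_fun_diff\<close>)
  then show ?thesis by simp
qed

lemma frameI:
  assumes "open U" "\<And>i. i < r \<Longrightarrow> e i \<in> F U"
    "\<And>V s. open V \<Longrightarrow> V \<subseteq> U \<Longrightarrow> s \<in> F V \<Longrightarrow>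
      \<exists>f. (\<forall>i<r. holo_fun V (f i)) \<and> (\<forall>x\<in>V. \<forall>k. s x k = (\<Sum>i<r. f i x * e i x k))"
    "\<And>V f i x. open V \<Longrightarrow> V \<subseteq> U \<Longrightarrow> (\<And>i. i < r \<Longrightarrow> holo_fun V (f i)) \<Longrightarrow>
      (\<And>x k. x \<in> V \<Longrightarrow> (\<Sum>i<r. f i x * e i x k) = 0) \<Longrightarrow> i < r \<Longrightarrow> x \<in> V \<Longrightarrow> f i x = 0"
  shows "frame r F U e"
  using assms unfolding frame_def by (intro conjI allI impI ballI) auto

lemma frame_restrict:
  assumes F: "module_sheaf F" and e: "frame r F U e" and V: "open V" "V \<subseteq> U"
  shows "frame r F V (\<lambda>i. restr V (e i))"
proof -
  \<comment> \<open>Sections over \<open>V\<close> vanish off \<open>V\<close>, so the members of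
    \<open>e\<close> must be cut off. The argument only uses that the new sections agree with
    \<open>e\<close> on \<open>V\<close>.\<close>
  have "frame r F V e'" if "\<And>i x. i < r \<Longrightarrow> x \<in> V \<Longrightarrow> e i x = e' i x" "\<And>i. i < r \<Longrightarrow> e' i \<in> F V" for e'
  proof (rule frameI)
    have eq: "(\<Sum>i<r. f i x * e' i x k) = (\<Sum>i<r. f i x * e i x k)" if "x \<in> V" for f x k
      by (rule sum.cong) (use \<open>\<And>i x. i < r \<Longrightarrow> x \<in> V \<Longrightarrow> e i x = e' i x\<close> that in auto)
    show "\<exists>f. (\<forall>i<r. holo_fun W (f i)) \<and> (\<forall>x\<in>W. \<forall>k. s x k = (\<Sum>i<r. f i x * e' i x k))"
      if W: "open W" "W \<subseteq> V" "s \<in> F W" for W s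
    proof -
      obtain f where "\<And>i. i < r \<Longrightarrow> holo_fun W (f i)" "\<And>x k. x \<in> W \<Longrightarrow> s x k = (\<Sum>i<r. f i x * e i x k)"
        using frame_coeffs[OF e W(1) _ W(3)] W(2) V(2) by blast
      then show ?thesis using eq W(2) by (intro exI[of _ f]) (auto simp: subset_iff)
    qed
    show "f i x = 0"
      if W: "open W" "W \<subseteq> V" "\<And>i. i < r \<Longrightarrow> holo_fun W (f i)"
        "\<And>x k. x \<in> W \<Longrightarrow> (\<Sum>i<r. f i x * e' i x k) = 0" "i < r" "x \<in> W" for W f i x
    proof (rule frame_indep[OF e W(1) _ W(3) _ W(5,6)])
      show "W \<subseteq> U" using W(2) V(2) by simp
      show "(\<Sum>i<r. f i x * e i x k) = 0" if "x \<in> W" for x k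
        using W(4)[OF that] eq W(2) that by (metis subsetD)
    qed
  qed (use V that in auto)
  then show ?thesis
    using frameD[OF e] V module_sheafD(5)[OF F] by (auto simp: restr_apply)
qed

lemma sheaf_homD:
  assumes "sheaf_hom F G \<phi>" "open U" "s \<in> F U"
  shows "\<phi> U s \<in> G U" "t \<in> F U \<Longrightarrow> \<phi> U (s + t) = \<phi> U s + \<phi> U t"
    "holo_fun U f \<Longrightarrow> \<phi> U (fmult U f s) = fmult U f (\<phi> U s)"
    "open V \<Longrightarrow> V \<subseteq> U \<Longrightarrow> \<phi> V (restr V s) = restr V (\<phi> U s)"
  using assms unfolding sheaf_hom_def by metis+

lemma sheaf_hom_zero:
  assumes "sheaf_hom F G \<phi>" "open U" "module_sheaf F"
  shows "\<phi> U 0 = 0"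
proof -
  have "fmult U (\<lambda>_. 0) s = 0" for s :: "'a sect"
    by (auto simp: fmult_def restr_def fun_eq_iff)
  then show ?thesis
    using sheaf_homD(3)[OF assms(1,2) module_sheafD(1)[OF assms(3,2)] holo_fun_const, of 0] by simp
qed

lemma sheaf_hom_lincomb:
  assumes F: "module_sheaf F" and \<phi>: "sheaf_hom F G \<phi>" and U: "open U"
  shows "(\<And>i. i < (r::nat) \<Longrightarrow> holo_fun U (f i)) \<Longrightarrow> (\<And>i. i < r \<Longrightarrow> s i \<in> F U) \<Longrightarrow>
    \<phi> U (restr U (\<lambda>x k. \<Sum>i<r. f i x * s i x k)) = restr U (\<lambda>x k. \<Sum>i<r. f i x * \<phi> U (s i) x k)"
proof (induction r)
  case 0
  have "restr U (\<lambda>x k. \<Sum>i<0::nat. f i x * s i x k) = 0" for s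
    by (auto simp: restr_def fun_eq_iff)
  then show ?case using sheaf_hom_zero[OF \<phi> U F] by (simp only:)
next
  case (Suc r)
  have eq: "restr U (\<lambda>x k. \<Sum>i<Suc r. f i x * s i x k) =
      restr U (\<lambda>x k. \<Sum>i<r. f i x * s i x k) + fmult U (f r) (s r)" for s
    by (auto simp: restr_def fmult_def fun_eq_iff)
  have f: "holo_fun U (f r)" "s r \<in> F U" using Suc.prems by auto
  have m: "restr U (\<lambda>x k. \<Sum>i<r. f i x * s i x k) \<in> F U"
    by (rule module_sheaf_lincomb[OF F U]) (use Suc.prems in auto)
  have IH: "\<phi> U (restr U (\<lambda>x k. \<Sum>i<r. f i x * s i x k)) = restr U (\<lambda>x k. \<Sum>i<r. f i x * \<phi> U (s i) x k)"
    by (rule Suc.IH) (use Suc.prems in auto)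
  show ?case
    unfolding eq sheaf_homD(2)[OF \<phi> U m module_sheafD(4)[OF F U f]] sheaf_homD(3)[OF \<phi> U f(2,1)] IH ..
qed

text \<open>Compatibility with restriction: images of frame sections are taken once, over
  \<open>U\<close>, and serve for sections over every smaller open set.\<close>

lemma sheaf_hom_coeffs:
  fixes r :: nat
  assumes F: "module_sheaf F" and \<phi>: "sheaf_hom F G \<phi>" and U: "open U" "\<And>i. i < r \<Longrightarrow> e i \<in> F U"
    and V: "open V" "V \<subseteq> U" "s \<in> F V" and f: "\<And>i. i < r \<Longrightarrow> holo_fun V (f i)"
      "\<And>x k. x \<in> V \<Longrightarrow> s x k = (\<Sum>i<r. f i x * e i x k)" and x: "x \<in> V"
  shows "\<phi> V s x k = (\<Sum>i<r. f i x * \<phi> U (e i) x k)"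
proof -
  have eV: "restr V (e i) \<in> F V" if "i < r" for i
    using module_sheafD(5)[OF F U(1) V(1,2) U(2)[OF that]] .
  have "restr V (\<lambda>x k. \<Sum>i<r. f i x * restr V (e i) x k) = s"
  proof -
    have "restr V (\<lambda>x k. \<Sum>i<r. f i x * restr V (e i) x k) = restr V s"
      by (auto simp: restr_def fun_eq_iff f(2))
    then show ?thesis using module_sheafD(2)[OF F V(1,3)] by simp
  qed
  then have "\<phi> V s = restr V (\<lambda>x k. \<Sum>i<r. f i x * \<phi> V (restr V (e i)) x k)"
    using sheaf_hom_lincomb[OF F \<phi> V(1), of r f "\<lambda>i. restr V (e i)"] f(1) eV by simp
  then show ?thesis
    using x sheaf_homD(4)[OF \<phi> U V(1,2)] by (simp add: restr_apply)
qed

section \<open>Transition matrices between frames\<close>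

definition matrix_id :: "nat \<Rightarrow> nat \<Rightarrow> complex" where
  "matrix_id i j = (if i = j then 1 else 0)"

lemma sum_matrix_id: "i < r \<Longrightarrow> (\<Sum>j<r. matrix_id i j * f j) = f i"
  "i < r \<Longrightarrow> (\<Sum>j<r. f j * matrix_id j i) = f i"
  by (simp_all add: matrix_id_def if_distrib[of "\<lambda>x. x * _"] if_distrib[of "\<lambda>x. _ * x"] cong: if_cong)

lemma square_matrix_inverse:
  assumes "\<And>i l. i < r \<Longrightarrow> l < r \<Longrightarrow> (\<Sum>j<r. A i j * B j l) = matrix_id i l" "i < r" "l < r"
  shows "(\<Sum>j<r. B i j * A j l) = matrix_id i l"
proof -
  define M where "M = mat r r (\<lambda>(i, j). A i j)"
  define N where "N = mat r r (\<lambda>(i, j). B i j)"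
  have c: "M \<in> carrier_mat r r" "N \<in> carrier_mat r r" by (auto simp: M_def N_def)
  have prod: "(mat r r (\<lambda>(i, j). P i j) * mat r r (\<lambda>(i, j). Q i j)) $$ (i, l) = (\<Sum>j<r. P i j * Q j l)"
    if "i < r" "l < r" for P Q :: "nat \<Rightarrow> nat \<Rightarrow> complex" and i l
    using that by (simp add: times_mat_def scalar_prod_def atLeast0LessThan)
  have "M * N = 1\<^sub>m r"
    by (rule eq_matI) (use assms(1) prod[of _ _ A B] in \<open>auto simp: M_def N_def matrix_id_def\<close>)
  then have "N * M = 1\<^sub>m r" using mat_mult_left_right_inverse[OF c] by blast
  then show ?thesis
    using prod[OF assms(2,3), of B A] assms(2,3) by (simp add: M_def N_def matrix_id_def)
qed

text \<open>If \<open>m\<close> were smaller than \<open>r\<close>, padding with zeros would give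
  square inverse matrices, one of which has a zero row at index \<open>m\<close>.\<close>

lemma matrix_right_inverse_le:
  assumes "\<And>i l. i < r \<Longrightarrow> l < r \<Longrightarrow> (\<Sum>j<m. A i j * B j l) = matrix_id i l"
  shows "r \<le> m"
proof (rule ccontr)
  assume "\<not> r \<le> m"
  then have m: "m < r" by simp
  define A' where "A' = (\<lambda>i j. if j < m then A i j else 0)"
  define B' where "B' = (\<lambda>j l. if j < m then B j l else 0)"
  have eq: "(\<Sum>j<r. A' i j * B' j l) = (\<Sum>j<m. A i j * B j l)" for i l
    by (rule sum.mono_neutral_cong_right) (use m in \<open>auto simp: A'_def B'_def\<close>)
  have "(\<Sum>j<r. B' m j * A' j m) = matrix_id m m"
    by (rule square_matrix_inverse[of r A' B' m m]) (use assms m eq in auto)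
  then show False by (simp add: B'_def matrix_id_def)
qed

text \<open>Column \<open>j\<close> holds the coefficients of \<open>s j\<close> in terms of
  \<open>e\<close>. The equation is required on \<open>V\<close> only, so sections over larger sets
  can be compared without restricting them.\<close>

definition transition ::
    "'a::riemann_surface set \<Rightarrow> nat \<Rightarrow> nat \<Rightarrow> (nat \<Rightarrow> 'a sect) \<Rightarrow> (nat \<Rightarrow> 'a sect) \<Rightarrow> (nat \<Rightarrow> nat \<Rightarrow> 'a \<Rightarrow> complex) \<Rightarrow> bool" where
  "transition V r m e s A \<longleftrightarrow> (\<forall>i<r. \<forall>j<m. holo_fun V (A i j)) \<and>
     (\<forall>x\<in>V. \<forall>j<m. \<forall>k. s j x k = (\<Sum>i<r. A i j x * e i x k))"

lemma transitionD:
  assumes "transition V r m e s A" "j < m"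
  shows "i < r \<Longrightarrow> holo_fun V (A i j)" "x \<in> V \<Longrightarrow> s j x k = (\<Sum>i<r. A i j x * e i x k)"
  using assms by (auto simp: transition_def)

lemma transitionI:
  assumes "\<And>i j. i < r \<Longrightarrow> j < m \<Longrightarrow> holo_fun V (A i j)"
    "\<And>j x k. j < m \<Longrightarrow> x \<in> V \<Longrightarrow> s j x k = (\<Sum>i<r. A i j x * e i x k)"
  shows "transition V r m e s A"
  using assms by (auto simp: transition_def)

lemma transition_subset: "transition V r m e s A \<Longrightarrow> W \<subseteq> V \<Longrightarrow> transition W r m e s A"
  by (auto simp: transition_def subset_iff intro: holo_fun_subset)

lemma transition_exists:
  assumes e: "frame r F U e" and V: "open V" "V \<subseteq> U" and s: "\<And>j. j < m \<Longrightarrow> s j \<in> F V"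
  shows "\<exists>A. transition V r m e s A"
proof -
  define P where "P = (\<lambda>j f. (\<forall>i<r. holo_fun V (f i)) \<and> (\<forall>x\<in>V. \<forall>k. s j x k = (\<Sum>i<r. f i x * e i x k)))"
  define g where "g = (\<lambda>j. SOME f. P j f)"
  have "P j (g j)" if "j < m" for j
    unfolding g_def by (rule someI_ex[of "P j"]) (unfold P_def, rule bspec[OF frame_onD(1)[OF e V] s[OF that]])
  then have "transition V r m e s (\<lambda>i j. g j i)"
    by (intro transitionI) (unfold P_def, simp_all)
  then show ?thesis by blast
qed

lemma lincomb_lincomb:
  fixes f :: "nat \<Rightarrow> complex" and B A :: "nat \<Rightarrow> nat \<Rightarrow> complex"
  assumes "\<And>j. j < m \<Longrightarrow> t j = (\<Sum>i<r. A i j * e i)"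
  shows "(\<Sum>j<m. f j * t j) = (\<Sum>i<r. (\<Sum>j<m. A i j * f j) * e i)"
proof -
  have "(\<Sum>j<m. f j * t j) = (\<Sum>j<m. \<Sum>i<r. A i j * f j * e i)"
    by (rule sum.cong) (auto simp: assms sum_distrib_left mult_ac)
  also have "\<dots> = (\<Sum>i<r. \<Sum>j<m. A i j * f j * e i)" by (rule sum.swap)
  finally show ?thesis by (simp add: sum_distrib_right)
qed

lemma transition_mult:
  assumes A: "transition V r m e s A" and B: "transition V m n s t B"
  shows "transition V r n e t (\<lambda>i l x. \<Sum>j<m. A i j x * B j l x)"
proof (rule transitionI)
  show "holo_fun V (\<lambda>x. \<Sum>j<m. A i j x * B j l x)" if "i < r" "l < n" for i l
    by (intro holo_fun_sum holo_fun_mult) (use transitionD(1)[OF A] transitionD(1)[OF B] that in auto)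
  show "t l x k = (\<Sum>i<r. (\<Sum>j<m. A i j x * B j l x) * e i x k)" if "l < n" "x \<in> V" for l x k
    unfolding transitionD(2)[OF B that]
    by (rule lincomb_lincomb[where t = "\<lambda>j. s j x k" and f = "\<lambda>j. B j l x"
          and A = "\<lambda>i j. A i j x" and e = "\<lambda>i. e i x k"]) (use transitionD(2)[OF A] that in auto)
qed

lemma transition_unique:
  assumes e: "frame r F U e" and V: "open V" "V \<subseteq> U"
    and A: "transition V r m e s A" and B: "transition V r m e s B" and ij: "i < r" "j < m" "x \<in> V"
  shows "A i j x = B i j x"
proof (rule frame_unique[OF e V, where f = "\<lambda>i. A i j" and g = "\<lambda>i. B i j"])
  show "(\<Sum>i<r. A i j y * e i y k) = (\<Sum>i<r. B i j y * e i y k)" if "y \<in> V" for y k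
    using transitionD(2)[OF A ij(2) that, of k] transitionD(2)[OF B ij(2) that, of k] by (simp only:)
qed (use transitionD(1)[OF A ij(2)] transitionD(1)[OF B ij(2)] ij in auto)

lemma transition_id: "transition V r r e e (\<lambda>i j x. matrix_id i j)"
  by (rule transitionI) (auto simp: matrix_id_def if_distrib[of "\<lambda>x. x * _"] cong: if_cong)

lemma transition_inverse:
  assumes e: "frame r F U e" and V: "open V" "V \<subseteq> U"
    and A: "transition V r m e s A" and B: "transition V m r s e B" and il: "i < r" "l < r" "x \<in> V"
  shows "(\<Sum>j<m. A i j x * B j l x) = matrix_id i l"
  using transition_unique[OF e V transition_mult[OF A B] transition_id il] .

lemma transition_sections:
  assumes F: "module_sheaf F" and e: "frame r F U e" and U': "open U'" and s: "\<And>j. j < m \<Longrightarrow> s j \<in> F U'"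
    and V: "open V" "V \<subseteq> U" "V \<subseteq> U'"
  shows "\<exists>A. transition V r m e s A"
proof -
  have "restr V (s j) \<in> F V" if "j < m" for j
    using module_sheafD(5)[OF F U' V(1,3) s[OF that]] .
  then obtain A where "transition V r m e (\<lambda>j. restr V (s j)) A"
    using transition_exists[OF e V(1,2), of m "\<lambda>j. restr V (s j)"] by blast
  then have "transition V r m e s A" by (auto simp: transition_def restr_apply)
  then show ?thesis by blast
qed

lemma transition_frames:
  assumes F: "module_sheaf F" and e: "frame r F U e" and e': "frame m F U' e'"
    and V: "open V" "V \<subseteq> U" "V \<subseteq> U'"
  shows "\<exists>A. transition V r m e e' A"
  by (rule transition_sections[OF F e frameD(1)[OF e'] _ V]) (rule frameD(2)[OF e'])

text \<open>At a common point the identity of size \<open>r\<close> factors through \<open>m\<close>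
  coordinates.\<close>

lemma frame_rank_le:
  assumes F: "module_sheaf F" and e: "frame r F U e" and e': "frame m F U' e'" and x: "x \<in> U" "x \<in> U'"
  shows "r \<le> m"
proof -
  define W where "W = U \<inter> U'"
  have V: "open W" "W \<subseteq> U" "W \<subseteq> U'" using frameD(1)[OF e] frameD(1)[OF e'] by (auto simp: W_def)
  obtain A where A: "transition W r m e e' A" using transition_frames[OF F e e' V] by blast
  obtain B where B: "transition W m r e' e B" using transition_frames[OF F e' e V(1,3,2)] by blast
  have "x \<in> W" using x by (simp add: W_def)
  then show ?thesis
    using transition_inverse[OF e V(1,2) A B]
    by (intro matrix_right_inverse_le[where A = "\<lambda>i j. A i j x" and B = "\<lambda>i j. B i j x"])
qed

lemma frame_rank_unique:
  assumes "module_sheaf F" "frame r F U e" "frame m F U' e'" "x \<in> U" "x \<in> U'"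
  shows "r = m"
  using frame_rank_le[OF assms] frame_rank_le[OF assms(1,3,2,5,4)] by simp

text \<open>As many generators as the rank: a one-sided inverse of a square matrix is two-sided, so
  the generators are also independent.\<close>

lemma frame_generating:
  assumes e: "frame r F U e" and e': "\<And>j. j < r \<Longrightarrow> e' j \<in> F U"
    and tB: "transition U r r e' e B"
  shows "frame r F U e'"
proof -
  have U: "open U" using frameD(1)[OF e] .
  obtain A where tA: "transition U r r e e' A"
    using transition_exists[OF e U order_refl, of r e'] e' by blast
  note A = transitionD[OF tA] and B = transitionD[OF tB]
  have BA: "(\<Sum>l<r. B m l x * A l j x) = matrix_id m j" if "x \<in> U" "m < r" "j < r" for x m j
    using transition_inverse[OF e U order_refl tA tB _ _ that(1)] that
    by (intro square_matrix_inverse[where A = "\<lambda>i j. A i j x" and B = "\<lambda>i j. B i j x"]) auto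
  show ?thesis
  proof (rule frameI[OF U])
    show "e' j \<in> F U" if "j < r" for j using e' that .
  next
    fix V s assume V: "open V" "V \<subseteq> U" "s \<in> F V"
    obtain f where f: "\<And>i. i < r \<Longrightarrow> holo_fun V (f i)" "\<And>x k. x \<in> V \<Longrightarrow> s x k = (\<Sum>i<r. f i x * e i x k)"
      using frame_coeffs[OF e V] by blast
    show "\<exists>f. (\<forall>i<r. holo_fun V (f i)) \<and> (\<forall>x\<in>V. \<forall>k. s x k = (\<Sum>i<r. f i x * e' i x k))"
    proof (intro exI[of _ "\<lambda>j x. \<Sum>i<r. B j i x * f i x"] conjI allI impI ballI)
      show "holo_fun V (\<lambda>x. \<Sum>i<r. B j i x * f i x)" if "j < r" for j
        by (intro holo_fun_sum holo_fun_mult) (use holo_fun_subset[OF B(1) V(2)] f(1) that in auto)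
      show "s x k = (\<Sum>j<r. (\<Sum>i<r. B j i x * f i x) * e' j x k)" if "x \<in> V" for x k
        unfolding f(2)[OF that]
        by (rule lincomb_lincomb[where t = "\<lambda>i. e i x k" and f = "\<lambda>i. f i x"
              and A = "\<lambda>j i. B j i x" and e = "\<lambda>j. e' j x k"]) (use B(2) V(2) that in auto)
    qed
  next
    fix V f i x assume V: "open V" "V \<subseteq> U" and f: "\<And>i. i < r \<Longrightarrow> holo_fun V (f i)"
      "\<And>x k. x \<in> V \<Longrightarrow> (\<Sum>i<r. f i x * e' i x k) = 0" and i: "i < r" and x: "x \<in> V"
    have Af: "(\<Sum>j<r. A l j x * f j x) = 0" if l: "l < r" for l
    proof (rule frame_indep[OF e V, where f = "\<lambda>l x. \<Sum>j<r. A l j x * f j x"])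
      show "holo_fun V (\<lambda>x. \<Sum>j<r. A l j x * f j x)" if "l < r" for l
        by (intro holo_fun_sum holo_fun_mult) (use holo_fun_subset[OF A(1) V(2)] f(1) that in auto)
      show "(\<Sum>i<r. (\<Sum>j<r. A i j x * f j x) * e i x k) = 0" if "x \<in> V" for x k
        using f(2)[OF that, of k] lincomb_lincomb[where t = "\<lambda>j. e' j x k" and f = "\<lambda>j. f j x" and m = r and r = r
            and A = "\<lambda>i j. A i j x" and e = "\<lambda>i. e i x k"] A(2) V(2) that by auto
    qed (use l x in auto)
    have "f i x = (\<Sum>j<r. matrix_id i j * f j x)" using sum_matrix_id(1)[OF i] by simp
    also have "\<dots> = (\<Sum>j<r. (\<Sum>l<r. B i l x * A l j x) * f j x)"
      by (rule sum.cong) (use BA i x V(2) in auto)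
    also have "\<dots> = (\<Sum>l<r. B i l x * (\<Sum>j<r. A l j x * f j x))"
      by (simp add: sum_distrib_left sum_distrib_right mult.assoc) (rule sum.swap)
    also have "\<dots> = 0" using Af by simp
    finally show "f i x = 0" .
  qed
qed

text \<open>The rank is locally constant because it is unique at each point, hence constant because
  the surface is connected.\<close>

lemma vector_bundleI:
  fixes F :: "'a::riemann_surface sheaf"
  assumes F: "module_sheaf F" and fr: "\<And>x. \<exists>U e r. x \<in> U \<and> frame r F U e"
  shows "vector_bundle F"
proof -
  define S where "S = (\<lambda>r. {x. \<exists>U e. x \<in> U \<and> frame r F U e})"
  have op: "open (S r)" for r
  proof (rule Topological_Spaces.openI)
    fix x assume "x \<in> S r"
    then obtain U e where "x \<in> U" "frame r F U e" by (auto simp: S_def)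
    then have "open U" "x \<in> U" "U \<subseteq> S r" using frameD(1)[of r F U e] unfolding S_def by blast+
    then show "\<exists>T. open T \<and> x \<in> T \<and> T \<subseteq> S r" by blast
  qed
  have disj: "r = m" if "x \<in> S r" "x \<in> S m" for x r m
    using that frame_rank_unique[OF F] unfolding S_def by blast
  obtain r where r: "(undefined::'a) \<in> S r" using fr[of undefined] by (auto simp: S_def)
  have "S r \<inter> (\<Union>m\<in>- {r}. S m) = {}" using disj by auto
  moreover have cov: "x \<in> S r \<union> (\<Union>m\<in>- {r}. S m)" for x
  proof -
    obtain m where "x \<in> S m" using fr[of x] by (auto simp: S_def)
    then show ?thesis by (cases "m = r") auto
  qed
  moreover have "open (S r)" "open (\<Union>m\<in>- {r}. S m)" using op by auto
  ultimately have "(\<Union>m\<in>- {r}. S m) = {}"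
    using connectedD[OF connected_surface, of "S r" "\<Union>m\<in>- {r}. S m"] r by blast
  then have "x \<in> S r" for x using cov by auto
  then have "locally_free r F" using F by (auto simp: locally_free_def S_def)
  then show ?thesis by (auto simp: vector_bundle_def)
qed

lemma locally_free_unique: "locally_free r F \<Longrightarrow> locally_free m F \<Longrightarrow> r = m"
  unfolding locally_free_def using frame_rank_unique by metis

lemma rk_eq: "locally_free r F \<Longrightarrow> rk F = r"
  unfolding rk_def using locally_free_unique by blast

lemma vector_bundleD:
  assumes "vector_bundle F"
  shows "module_sheaf F" "locally_free (rk F) F" "\<exists>U e. x \<in> U \<and> frame (rk F) F U e"
proof -
  obtain r where r: "locally_free r F" using assms by (auto simp: vector_bundle_def)
  then show l: "locally_free (rk F) F" using rk_eq[OF r] by simp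
  then show "module_sheaf F" "\<exists>U e. x \<in> U \<and> frame (rk F) F U e"
    unfolding locally_free_def by blast+
qed

lemma rk_eq_frame:
  assumes "vector_bundle F" "frame r F U e" "x \<in> U"
  shows "rk F = r"
  using vector_bundleD(3)[OF assms(1), of x] frame_rank_unique[OF vector_bundleD(1)[OF assms(1)] _ assms(2)] assms(3)
  by blast

section \<open>Kernel and image\<close>

text \<open>Row reduction of the matrix \<open>A\<close> of a homomorphism over the local ring at \<open>x\<close>: after
  \<open>i\<close> rows, the columns \<open>j < c\<close> are lower triangular with pivots \<open>A (p j) j\<close> that vanish
  at most at \<open>x\<close>, and the remaining columns vanish in the rows treated so far.\<close>

definition echelon where
  "echelon F \<phi> g s r x i U e A p c \<longleftrightarrow> frame r F U e \<and> x \<in> U \<and>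
     transition U s r g (\<lambda>j. \<phi> U (e j)) A \<and> c \<le> r \<and>
     (\<forall>l<i. \<forall>j. c \<le> j \<and> j < r \<longrightarrow> (\<forall>y\<in>U. A l j y = 0)) \<and>
     (\<forall>j<c. p j < (i::nat) \<and> (\<forall>y\<in>U. y \<noteq> x \<longrightarrow> A (p j) j y \<noteq> 0) \<and>
        (\<forall>j'. j < j' \<and> j' < r \<longrightarrow> (\<forall>y\<in>U. A (p j) j' y = 0)))"

text \<open>If row \<open>i\<close> vanishes near \<open>x\<close> in all remaining columns,
  restricting is enough. Otherwise an entry of least vanishing order divides the others in the row:
  its column is swapped to position \<open>c\<close> and used to clear the later ones. Earlier pivot
  rows survive since they vanish in all columns involved.\<close>

lemma echelon_step:
  fixes F G :: "'a::riemann_surface sheaf"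
  assumes F: "module_sheaf F" and \<phi>: "sheaf_hom F G \<phi>"
    and E: "echelon F \<phi> g s r x i U e A p c" and i: "i < s"
  shows "\<exists>T e A p c. T \<subseteq> U \<and> echelon F \<phi> g s r x (Suc i) T e A p c"
proof -
  have e: "frame r F U e" and x: "x \<in> U" and tA: "transition U s r g (\<lambda>j. \<phi> U (e j)) A" and c: "c \<le> r"
    and Z: "\<And>l j y. l < i \<Longrightarrow> c \<le> j \<Longrightarrow> j < r \<Longrightarrow> y \<in> U \<Longrightarrow> A l j y = 0"
    and p: "\<And>j. j < c \<Longrightarrow> p j < i"
    and P: "\<And>j y. j < c \<Longrightarrow> y \<in> U \<Longrightarrow> y \<noteq> x \<Longrightarrow> A (p j) j y \<noteq> 0"
    and L: "\<And>j j' y. j < c \<Longrightarrow> j < j' \<Longrightarrow> j' < r \<Longrightarrow> y \<in> U \<Longrightarrow> A (p j) j' y = 0"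
    using E unfolding echelon_def by auto
  note U = frameD(1)[OF e] and eF = frameD(2)[OF e]
  have hA: "holo_fun U (A l j)" if "l < s" "j < r" for l j using transitionD(1)[OF tA] that by blast
  have "finite {c..<r}" by simp
  then show ?thesis
  proof (rule holo_fun_min_order[OF _ U x, where f = "A i"])
    show "holo_fun U (A i j)" if "j \<in> {c..<r}" for j using hA[OF i] that by simp
  next
    fix T assume T: "open T" "x \<in> T" "T \<subseteq> U" "\<forall>j\<in>{c..<r}. \<forall>y\<in>T. A i j y = 0"
    have "echelon F \<phi> g s r x (Suc i) T (\<lambda>j. restr T (e j)) A p c"
      unfolding echelon_def
    proof (intro conjI allI impI ballI; (elim conjE)?)
      show "frame r F T (\<lambda>j. restr T (e j))" by (rule frame_restrict[OF F e T(1,3)])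
      show "transition T s r g (\<lambda>j. \<phi> T (restr T (e j))) A"
      proof (rule transitionI)
        show "holo_fun T (A l j)" if "l < s" "j < r" for l j
          using holo_fun_subset[OF hA[OF that] T(3)] .
        show "\<phi> T (restr T (e j)) y k = (\<Sum>l<s. A l j y * g l y k)" if "j < r" "y \<in> T" for j y k
          using sheaf_homD(4)[OF \<phi> U eF[OF that(1)] T(1,3)] transitionD(2)[OF tA that(1)] that(2) T(3)
          by (auto simp: restr_apply)
      qed
      show "A l j y = 0" if "l < Suc i" "c \<le> j" "j < r" "y \<in> T" for l j y
        using that Z[of l j y] T(3,4) by (cases "l = i") auto
      show "p j < Suc i" if "j < c" for j using p[OF that] by simp
    qed (use T c P L in auto)
    then show ?thesis using T by blast
  next
    fix T j0 q assume T: "open T" "x \<in> T" "T \<subseteq> U" and j0: "j0 \<in> {c..<r}"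
      and nz: "\<And>y. y \<in> T \<Longrightarrow> y \<noteq> x \<Longrightarrow> A i j0 y \<noteq> 0"
      and hq: "\<And>j. j \<in> {c..<r} \<Longrightarrow> holo_fun T (q j)"
      and q: "\<And>j y. j \<in> {c..<r} \<Longrightarrow> y \<in> T \<Longrightarrow> A i j y = q j y * A i j0 y"
    define \<sigma> where "\<sigma> = Transposition.transpose c j0"
    have \<sigma>: "\<sigma> j < r" "\<sigma> (\<sigma> j) = j" "c \<le> \<sigma> j \<longleftrightarrow> c \<le> j" "j < c \<Longrightarrow> \<sigma> j = j" if "j < r" for j
      using that j0 by (auto simp: \<sigma>_def Transposition.transpose_def)
    have \<sigma>c: "\<sigma> c = j0" "\<sigma> j0 = c" by (auto simp: \<sigma>_def)
    \<comment> \<open>Only columns after the new pivot \<open>c\<close> are cleared.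
      \<open>\<sigma>\<close> occurs because the quotients are indexed by the columns before the
      swap.\<close>
    define m where "m = (\<lambda>j. if j \<le> c then (\<lambda>_. 0) else q (\<sigma> j))"
    have hm: "holo_fun T (m j)" if "j < r" for j
      using hq[of "\<sigma> j"] \<sigma>[OF that] by (auto simp: m_def)
    define e' where "e' = (\<lambda>j. restr T (\<lambda>y k. e (\<sigma> j) y k - m j y * e j0 y k))"
    define A' where "A' = (\<lambda>l j y. A l (\<sigma> j) y - m j y * A l j0 y)"
    have j0r: "j0 < r" "c < r" using j0 by auto
    have e'F: "e' j \<in> F T" if j: "j < r" for j
    proof -
      \<comment> \<open>The new section as a linear combination of two sections with coefficients
        \<open>1\<close> and \<open>- m j\<close>.\<close>
      have "restr T (\<lambda>y k. \<Sum>l<2::nat. (if l = 0 then (\<lambda>_. 1) else (\<lambda>y. - m j y)) y *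
          (restr T (if l = 0 then e (\<sigma> j) else e j0)) y k) \<in> F T"
        by (rule module_sheaf_lincomb[OF F T(1)])
          (use holo_fun_minus[OF hm[OF j]] eF \<sigma>(1)[OF j] j0r module_sheafD(5)[OF F U T(1,3)] in auto)
      moreover have "restr T (\<lambda>y k. \<Sum>l<2::nat. (if l = 0 then (\<lambda>_. 1) else (\<lambda>y. - m j y)) y *
          (restr T (if l = 0 then e (\<sigma> j) else e j0)) y k) = e' j"
        by (auto simp: e'_def restr_def fun_eq_iff numeral_2_eq_2)
      ultimately show ?thesis by simp
    qed
    have fr: "frame r F T e'"
    proof (rule frame_generating[OF frame_restrict[OF F e T(1,3)] e'F])
      \<comment> \<open>The column operation is undone by expressing \<open>e l\<close> as
        \<open>e' (\<sigma> l)\<close> plus \<open>m (\<sigma> l)\<close> times \<open>e' c\<close>,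
        because \<open>e' c\<close> is the restriction of \<open>e j0\<close>.\<close>
      show "transition T r r e' (\<lambda>j. restr T (e j))
          (\<lambda>j l y. (if j = \<sigma> l then 1 else 0) + (if j = c then m (\<sigma> l) y else 0))"
      proof (rule transitionI)
        show "holo_fun T (\<lambda>y. (if j = \<sigma> l then 1 else 0) + (if j = c then m (\<sigma> l) y else 0))" if "l < r" for j l
          using hm[OF \<sigma>(1)[OF that]] by (cases "j = c") (auto intro!: holo_fun_add)
        show "restr T (e l) y k = (\<Sum>j<r. ((if j = \<sigma> l then 1 else 0) + (if j = c then m (\<sigma> l) y else 0)) * e' j y k)"
          if l: "l < r" and y: "y \<in> T" for l y k
        proof -
          have "(\<Sum>j<r. ((if j = \<sigma> l then 1 else 0) + (if j = c then m (\<sigma> l) y else 0)) * e' j y k) =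
              (\<Sum>j<r. if j = \<sigma> l then e' j y k else 0) + (\<Sum>j<r. if j = c then m (\<sigma> l) y * e' j y k else 0)"
            by (simp add: distrib_right sum.distrib if_distrib[of "\<lambda>t. t * _"] cong: if_cong)
          also have "\<dots> = e' (\<sigma> l) y k + m (\<sigma> l) y * e' c y k"
            using \<sigma>(1)[OF l] j0r by simp
          also have "\<dots> = e l y k"
            using y \<sigma>(2)[OF l] \<sigma>c by (simp add: e'_def restr_apply m_def)
          finally show ?thesis using y by (simp add: restr_apply)
        qed
      qed
    qed
    have "echelon F \<phi> g s r x (Suc i) T e' A' (p(c := i)) (Suc c)"
      unfolding echelon_def
    proof (intro conjI allI impI ballI; (elim conjE)?)
      show "frame r F T e'" by (rule fr)
      show "x \<in> T" "Suc c \<le> r" using T j0r by auto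
      show "transition T s r g (\<lambda>j. \<phi> T (e' j)) A'"
      proof (rule transitionI)
        show "holo_fun T (A' l j)" if "l < s" "j < r" for l j
          unfolding A'_def using that \<sigma>(1) hm j0r
          by (intro holo_fun_diff holo_fun_mult holo_fun_subset[OF hA T(3)]) auto
        show "\<phi> T (e' j) y k = (\<Sum>l<s. A' l j y * g l y k)" if j: "j < r" and y: "y \<in> T" for j y k
        proof -
          have yU: "y \<in> U" using y T by blast
          have "\<phi> T (e' j) y k = (\<Sum>l<r. ((if l = \<sigma> j then 1 else 0) - (if l = j0 then m j y else 0)) * \<phi> U (e l) y k)"
          proof (rule sheaf_hom_coeffs[OF F \<phi> U eF T(1,3) e'F[OF j] _ _ y])
            show "holo_fun T (\<lambda>y. (if l = \<sigma> j then 1 else 0) - (if l = j0 then m j y else 0))" for l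
              using hm[OF j] by (cases "l = j0") (auto intro!: holo_fun_diff holo_fun_minus)
            show "e' j y k = (\<Sum>l<r. ((if l = \<sigma> j then 1 else 0) - (if l = j0 then m j y else 0)) * e l y k)"
              if "y \<in> T" for y k
              using that \<sigma>(1)[OF j] j0r
              by (simp add: e'_def restr_apply left_diff_distrib sum_subtractf if_distrib[of "\<lambda>t. t * _"] cong: if_cong)
          qed
          also have "\<dots> = \<phi> U (e (\<sigma> j)) y k - m j y * \<phi> U (e j0) y k"
            using \<sigma>(1)[OF j] j0r
            by (simp add: left_diff_distrib sum_subtractf if_distrib[of "\<lambda>t. t * _"] cong: if_cong)
          also have "\<dots> = (\<Sum>l<s. A' l j y * g l y k)"
            unfolding transitionD(2)[OF tA \<sigma>(1)[OF j] yU] transitionD(2)[OF tA j0r(1) yU]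
            by (simp add: A'_def left_diff_distrib sum_subtractf sum_distrib_left mult.assoc)
          finally show ?thesis .
        qed
      qed
      show "A' l j y = 0" if l: "l < Suc i" and j: "Suc c \<le> j" "j < r" and y: "y \<in> T" for l j y
      proof (cases "l = i")
        case True
        have "\<sigma> j \<in> {c..<r}" using \<sigma>[OF j(2)] j by auto
        then show ?thesis using q[of "\<sigma> j" y] j y True by (simp add: A'_def m_def)
      next
        case False
        have "c \<le> \<sigma> j" "\<sigma> j < r" using \<sigma>[OF j(2)] j by auto
        then have "A l (\<sigma> j) y = 0" "A l j0 y = 0" using Z[of l] False l y T(3) j0 by auto
        then show ?thesis by (simp add: A'_def)
      qed
      fix j assume j: "j < Suc c"
      show "(p(c := i)) j < Suc i" using p[of j] j by auto
      show "A' ((p(c := i)) j) j y \<noteq> 0" if y: "y \<in> T" "y \<noteq> x" for y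
      proof (cases "j = c")
        case True
        then show ?thesis using nz[OF y] \<sigma>c by (simp add: A'_def m_def)
      next
        case False
        then have "j < c" using j by simp
        then show ?thesis using P[of j y] y T(3) \<sigma>(4)[of j] c by (auto simp: A'_def m_def)
      qed
      show "A' ((p(c := i)) j) j' y = 0" if j': "j < j'" "j' < r" and y: "y \<in> T" for j' y
      proof (cases "j = c")
        case True
        have "\<sigma> j' \<in> {c..<r}" using \<sigma>[OF j'(2)] j' True by auto
        then show ?thesis using q[of "\<sigma> j'" y] j' y True by (simp add: A'_def m_def)
      next
        case False
        then have jc: "j < c" using j by simp
        have "j < \<sigma> j'" using jc j' \<sigma>(3,4)[OF j'(2)] by (cases "c \<le> j'") auto
        then have "A (p j) (\<sigma> j') y = 0" "A (p j) j0 y = 0"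
          using L[OF jc] \<sigma>(1)[OF j'(2)] y T(3) j0 jc by auto
        then show ?thesis using False by (simp add: A'_def)
      qed
    qed
    then show ?thesis using T by blast
  qed
qed

lemma echelon_exists:
  fixes F G :: "'a::riemann_surface sheaf"
  assumes F: "module_sheaf F" and \<phi>: "sheaf_hom F G \<phi>" and e: "frame r F U e" and g: "frame s G U g"
    and x: "x \<in> U"
  shows "i \<le> s \<Longrightarrow> \<exists>T e A p c. T \<subseteq> U \<and> echelon F \<phi> g s r x i T e A p c"
proof (induction i)
  case 0
  note U = frameD(1)[OF e]
  have "\<phi> U (e j) \<in> G U" if "j < r" for j
    using sheaf_homD(1)[OF \<phi> U frameD(2)[OF e that]] .
  then obtain A where "transition U s r g (\<lambda>j. \<phi> U (e j)) A"
    using transition_exists[OF g U order_refl, of r "\<lambda>j. \<phi> U (e j)"] by blast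
  then have "echelon F \<phi> g s r x 0 U e A undefined 0"
    using e x by (simp add: echelon_def)
  then show ?case by blast
next
  case (Suc i)
  then obtain T e A p c where T: "T \<subseteq> U" "echelon F \<phi> g s r x i T e A p c" by auto
  then show ?case using echelon_step[OF F \<phi> T(2)] Suc.prems by (meson Suc_le_eq order_trans)
qed

text \<open>A local splitting: the last \<open>r - c\<close> sections will frame the kernel, and the
  images of the first \<open>c\<close> will frame the image.\<close>

definition adapted_frame where
  "adapted_frame F \<phi> r c U e \<longleftrightarrow> frame r F U e \<and> c \<le> r \<and>
     (\<forall>j. c \<le> j \<and> j < r \<longrightarrow> \<phi> U (e j) = 0) \<and>
     (\<forall>V f. open V \<and> V \<subseteq> U \<and> (\<forall>j<c. holo_fun V (f j)) \<and>
        (\<forall>x\<in>V. \<forall>k. (\<Sum>j<c. f j x * \<phi> U (e j) x k) = 0) \<longrightarrow> (\<forall>j<c. \<forall>x\<in>V. f j x = 0))"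

text \<open>After all rows have been reduced, the columns without pivot are zero, so their sections
  lie in the kernel, and the columns with pivots are independent because they are
  triangular.\<close>

lemma adapted_frame_exists:
  fixes F G :: "'a::riemann_surface sheaf"
  assumes F: "vector_bundle F" and G: "vector_bundle G" and \<phi>: "sheaf_hom F G \<phi>"
  shows "\<exists>U e c. x \<in> U \<and> adapted_frame F \<phi> (rk F) c U e \<and> c \<le> rk G"
proof -
  note mF = vector_bundleD(1)[OF F] and mG = vector_bundleD(1)[OF G]
  define r s where "r = rk F" and "s = rk G"
  obtain U1 e1 where 1: "x \<in> U1" "frame r F U1 e1" using vector_bundleD(3)[OF F] unfolding r_def by blast
  obtain U2 g2 where 2: "x \<in> U2" "frame s G U2 g2" using vector_bundleD(3)[OF G] unfolding s_def by blast
  define W where "W = U1 \<inter> U2"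
  have W: "open W" "W \<subseteq> U1" "W \<subseteq> U2" "x \<in> W"
    using 1 2 frameD(1)[OF 1(2)] frameD(1)[OF 2(2)] by (auto simp: W_def)
  define g where "g = (\<lambda>i. restr W (g2 i))"
  have gW: "frame s G W g" unfolding g_def by (rule frame_restrict[OF mG 2(2) W(1,3)])
  obtain U e A p c where UW: "U \<subseteq> W" and E: "echelon F \<phi> g s r x s U e A p c"
    using echelon_exists[OF mF \<phi> frame_restrict[OF mF 1(2) W(1,2)] gW W(4), of s] by blast
  have e: "frame r F U e" and x: "x \<in> U" and tA: "transition U s r g (\<lambda>j. \<phi> U (e j)) A" and c: "c \<le> r"
    and Z: "\<And>l j y. l < s \<Longrightarrow> c \<le> j \<Longrightarrow> j < r \<Longrightarrow> y \<in> U \<Longrightarrow> A l j y = 0"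
    and p: "\<And>j. j < c \<Longrightarrow> p j < s"
    and P: "\<And>j y. j < c \<Longrightarrow> y \<in> U \<Longrightarrow> y \<noteq> x \<Longrightarrow> A (p j) j y \<noteq> 0"
    and L: "\<And>j j' y. j < c \<Longrightarrow> j < j' \<Longrightarrow> j' < r \<Longrightarrow> y \<in> U \<Longrightarrow> A (p j) j' y = 0"
    using E unfolding echelon_def by auto
  note U = frameD(1)[OF e] and eF = frameD(2)[OF e]
  have "\<phi> U (e j) = 0" if j: "c \<le> j" "j < r" for j
  proof -
    have "\<phi> U (e j) y k = 0" for y k
    proof (cases "y \<in> U")
      case True
      then show ?thesis unfolding transitionD(2)[OF tA j(2) True] using Z j by simp
    next
      case False
      then show ?thesis
        using module_sheaf_zero_outside[OF mG U sheaf_homD(1)[OF \<phi> U eF[OF j(2)]]] by simp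
    qed
    then show ?thesis by (simp add: fun_eq_iff)
  qed
  moreover have "f j y = 0"
    if V: "open V" "V \<subseteq> U" and f: "\<And>j. j < c \<Longrightarrow> holo_fun V (f j)"
      and rel: "\<And>y k. y \<in> V \<Longrightarrow> (\<Sum>j<c. f j y * \<phi> U (e j) y k) = 0" and j: "j < c" and y: "y \<in> V" for V f j y
  proof -
    have Af: "(\<Sum>j<c. A l j y * f j y) = 0" if "l < s" "y \<in> V" for l y
    proof (rule frame_indep[OF gW, where f = "\<lambda>l y. \<Sum>j<c. A l j y * f j y"])
      show "open V" "V \<subseteq> W" using V UW by auto
      show "holo_fun V (\<lambda>y. \<Sum>j<c. A l j y * f j y)" if "l < s" for l
        by (intro holo_fun_sum holo_fun_mult)
          (use holo_fun_subset[OF transitionD(1)[OF tA] V(2)] f c that in auto)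
      show "(\<Sum>l<s. (\<Sum>j<c. A l j y * f j y) * g l y k) = 0" if "y \<in> V" for y k
        using rel[OF that, of k] lincomb_lincomb[where t = "\<lambda>j. \<phi> U (e j) y k" and f = "\<lambda>j. f j y" and m = c
            and r = s and A = "\<lambda>l j. A l j y" and e = "\<lambda>l. g l y k"]
          transitionD(2)[OF tA _ subsetD[OF V(2) that]] c by simp
    qed (use that in auto)
    \<comment> \<open>Forward substitution: in row \<open>p j\<close> the later columns vanish and
      the earlier coefficients are already zero, so the pivot forces \<open>f j\<close> to vanish
      away from \<open>x\<close>. The pivot may vanish at \<open>x\<close> itself; there continuity
      decides.\<close>
    show ?thesis using j y
    proof (induction j arbitrary: y rule: less_induct)
      case (less j)
      have nz: "f j w = 0" if w: "w \<in> V" "w \<noteq> x" for w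
      proof -
        have "(\<Sum>l<c. A (p j) l w * f l w) = (\<Sum>l<c. if l = j then A (p j) j w * f j w else 0)"
        proof (rule sum.cong[OF refl])
          fix l assume l: "l \<in> {..<c}"
          consider "l < j" | "l = j" | "l > j" by linarith
          then show "A (p j) l w * f l w = (if l = j then A (p j) j w * f j w else 0)"
          proof cases
            case 1
            then show ?thesis using less.IH[of l w] l w by simp
          next
            case 3
            then show ?thesis using L[OF less.prems(1), of l w] l c w V(2) by auto
          qed simp
        qed
        then have "A (p j) j w * f j w = 0" using Af[OF p[OF less.prems(1)] w(1)] less.prems(1) by simp
        then show ?thesis using P[OF less.prems(1), of w] w V(2) by auto
      qed
      show ?case
      proof (cases "y = x")
        case True
        show ?thesis unfolding True
          by (rule holo_fun_punctured_zero[OF f[OF less.prems(1)] V(1)]) (use less.prems(2) True nz in auto)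
      next
        case False
        then show ?thesis using nz less.prems(2) by blast
      qed
    qed
  qed
  ultimately have "adapted_frame F \<phi> r c U e"
    unfolding adapted_frame_def using e c by blast
  moreover have "c \<le> s"
  proof -
    \<comment> \<open>Pivots may vanish at \<open>x\<close>, so that distinct columns have distinct
      pivot rows is tested at another point, which exists because no point is isolated.\<close>
    have "U \<noteq> {x}" using U surface_at_neq_bot[of x] at_eq_bot_iff by blast
    then obtain y where y: "y \<in> U" "y \<noteq> x" using x by blast
    have neq: "p j \<noteq> p j'" if "j < j'" "j' < c" for j j'
    proof
      assume "p j = p j'"
      then show False using L[of j j' y] P[of j' y] that y c by simp
    qed
    have "inj_on p {..<c}"
    proof (rule inj_onI)
      fix j j' assume "j \<in> {..<c}" "j' \<in> {..<c}" "p j = p j'"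
      then show "j = j'" using neq[of j j'] neq[of j' j] by (cases j j' rule: linorder_cases) auto
    qed
    then have "card {..<c} \<le> card {..<s}" by (rule card_inj_on_le) (use p in auto)
    then show ?thesis by simp
  qed
  ultimately show ?thesis using x unfolding r_def s_def by blast
qed

section \<open>Kernel and image sheaves and their frames\<close>

definition ker_sheaf :: "'a::riemann_surface sheaf \<Rightarrow> ('a set \<Rightarrow> 'a sect \<Rightarrow> 'a sect) \<Rightarrow> 'a sheaf" where
  "ker_sheaf F \<phi> = (\<lambda>U. {s \<in> F U. \<phi> U s = 0})"

text \<open>Sections that lift locally. The images of the single maps \<open>\<phi> U\<close> need
  not satisfy the gluing axiom, and this is the sheaf that they generate inside
  \<open>G\<close>.\<close>

definition im_sheaf ::
    "'a::riemann_surface sheaf \<Rightarrow> 'a sheaf \<Rightarrow> ('a set \<Rightarrow> 'a sect \<Rightarrow> 'a sect) \<Rightarrow> 'a sheaf" where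
  "im_sheaf F G \<phi> = (\<lambda>U. {t \<in> G U. \<forall>x\<in>U. \<exists>V s. open V \<and> x \<in> V \<and> V \<subseteq> U \<and> s \<in> F V \<and> \<phi> V s = restr V t})"

lemma module_sheafI:
  assumes "\<And>U. open U \<Longrightarrow> 0 \<in> F U" "\<And>U s. open U \<Longrightarrow> s \<in> F U \<Longrightarrow> restr U s = s"
    "\<And>U s t. open U \<Longrightarrow> s \<in> F U \<Longrightarrow> t \<in> F U \<Longrightarrow> s + t \<in> F U"
    "\<And>U f s. open U \<Longrightarrow> holo_fun U f \<Longrightarrow> s \<in> F U \<Longrightarrow> fmult U f s \<in> F U"
    "\<And>U V s. open U \<Longrightarrow> open V \<Longrightarrow> V \<subseteq> U \<Longrightarrow> s \<in> F U \<Longrightarrow> restr V s \<in> F V"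
    "\<And>\<U> s. (\<And>U. U \<in> \<U> \<Longrightarrow> open U) \<Longrightarrow> (\<And>U. U \<in> \<U> \<Longrightarrow> restr U s \<in> F U) \<Longrightarrow> restr (\<Union>\<U>) s \<in> F (\<Union>\<U>)"
  shows "module_sheaf F"
  unfolding module_sheaf_def by (intro conjI allI impI ballI; (elim conjE)?; rule assms; simp)

lemma restr_0 [simp]: "restr U 0 = 0"
  by (simp add: restr_def fun_eq_iff)

lemma fmult_0 [simp]: "fmult U f 0 = 0"
  by (simp add: fmult_def restr_def fun_eq_iff)

lemma restr_add: "restr U (s + t) = restr U s + restr U t"
  by (auto simp: restr_def fun_eq_iff)

lemma restr_fmult: "V \<subseteq> U \<Longrightarrow> restr V (fmult U f s) = fmult V f (restr V s)"
  by (auto simp: restr_def fmult_def fun_eq_iff)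

lemma sect_eq_0I:
  assumes "module_sheaf G" "open U" "t \<in> G U" "\<And>x. x \<in> U \<Longrightarrow> \<exists>V. x \<in> V \<and> restr V t = 0"
  shows "t = 0"
proof
  fix x
  show "t x = 0 x"
  proof (cases "x \<in> U")
    case True
    then obtain V where "x \<in> V" "restr V t = 0" using assms(4) by blast
    then have "restr V t x = 0 x" by simp
    then show ?thesis using \<open>x \<in> V\<close> by (simp add: restr_apply)
  next
    case False
    then show ?thesis using module_sheaf_zero_outside[OF assms(1-3)] by simp
  qed
qed

lemma module_sheaf_ker:
  assumes F: "module_sheaf F" and G: "module_sheaf G" and \<phi>: "sheaf_hom F G \<phi>"
  shows "module_sheaf (ker_sheaf F \<phi>)"
proof (rule module_sheafI)
  fix U :: "'a set" assume U: "open U"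
  show "0 \<in> ker_sheaf F \<phi> U"
    unfolding ker_sheaf_def using module_sheafD(1)[OF F U] sheaf_hom_zero[OF \<phi> U F] by blast
  show "restr U s = s" if "s \<in> ker_sheaf F \<phi> U" for s
    using module_sheafD(2)[OF F U] that by (auto simp: ker_sheaf_def)
  show "s + t \<in> ker_sheaf F \<phi> U" if st: "s \<in> ker_sheaf F \<phi> U" "t \<in> ker_sheaf F \<phi> U" for s t
  proof -
    have s: "s \<in> F U" "\<phi> U s = 0" "t \<in> F U" "\<phi> U t = 0" using st unfolding ker_sheaf_def by blast+
    have "\<phi> U (s + t) = 0" using sheaf_homD(2)[OF \<phi> U s(1,3)] s(2,4) by (simp only: add_0)
    then show ?thesis using module_sheafD(3)[OF F U s(1,3)] unfolding ker_sheaf_def by blast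
  qed
  show "fmult U f s \<in> ker_sheaf F \<phi> U" if f: "holo_fun U f" and st: "s \<in> ker_sheaf F \<phi> U" for f s
  proof -
    have s: "s \<in> F U" "\<phi> U s = 0" using st unfolding ker_sheaf_def by blast+
    have "\<phi> U (fmult U f s) = 0" using sheaf_homD(3)[OF \<phi> U s(1) f] s(2) by (simp only: fmult_0)
    then show ?thesis using module_sheafD(4)[OF F U f s(1)] unfolding ker_sheaf_def by blast
  qed
  show "restr V s \<in> ker_sheaf F \<phi> V" if V: "open V" "V \<subseteq> U" and st: "s \<in> ker_sheaf F \<phi> U" for V s
  proof -
    have s: "s \<in> F U" "\<phi> U s = 0" using st unfolding ker_sheaf_def by blast+
    have "\<phi> V (restr V s) = 0" using sheaf_homD(4)[OF \<phi> U s(1) V] s(2) by (simp only: restr_0)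
    then show ?thesis using module_sheafD(5)[OF F U V s(1)] unfolding ker_sheaf_def by blast
  qed
next
  fix \<U> s assume op: "\<And>U. U \<in> \<U> \<Longrightarrow> open U" and s: "\<And>U. U \<in> \<U> \<Longrightarrow> restr U s \<in> ker_sheaf F \<phi> U"
  let ?U = "\<Union>\<U>"
  have oU: "open ?U" using op by blast
  have sF: "restr U s \<in> F U" "\<phi> U (restr U s) = 0" if "U \<in> \<U>" for U
    using s[OF that] unfolding ker_sheaf_def by blast+
  have t: "restr ?U s \<in> F ?U" by (rule module_sheaf_glue[OF F op sF(1)])
  have "\<phi> ?U (restr ?U s) = 0"
  proof (rule sect_eq_0I[OF G oU sheaf_homD(1)[OF \<phi> oU t]])
    fix x assume "x \<in> ?U"
    then obtain U where U: "U \<in> \<U>" "x \<in> U" by blast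
    have "restr U (\<phi> ?U (restr ?U s)) = \<phi> U (restr U (restr ?U s))"
      by (rule sheaf_homD(4)[OF \<phi> oU t op[OF U(1)], symmetric]) (use U in blast)
    also have "restr U (restr ?U s) = restr U s"
      unfolding restr_restr using Int_absorb2[OF Sup_upper[OF U(1)]] by (simp only:)
    finally show "\<exists>V. x \<in> V \<and> restr V (\<phi> ?U (restr ?U s)) = 0"
      using U sF(2)[OF U(1)] by (intro exI[of _ U]) (simp only:)
  qed
  then show "restr ?U s \<in> ker_sheaf F \<phi> ?U" using t unfolding ker_sheaf_def by blast
qed

lemma im_sheafI:
  assumes "t \<in> G U" "\<And>x. x \<in> U \<Longrightarrow> \<exists>V s. open V \<and> x \<in> V \<and> V \<subseteq> U \<and> s \<in> F V \<and> \<phi> V s = restr V t"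
  shows "t \<in> im_sheaf F G \<phi> U"
  using assms unfolding im_sheaf_def by blast

lemma im_sheafE:
  assumes "t \<in> im_sheaf F G \<phi> U" "x \<in> U"
  obtains V s where "open V" "x \<in> V" "V \<subseteq> U" "s \<in> F V" "\<phi> V s = restr V t"
  using assms unfolding im_sheaf_def by blast

lemma im_sheaf_subset: "im_sheaf F G \<phi> U \<subseteq> G U"
  unfolding im_sheaf_def by blast

lemma im_sheaf_image:
  assumes G: "module_sheaf G" and \<phi>: "sheaf_hom F G \<phi>" and "open U" "s \<in> F U"
  shows "\<phi> U s \<in> im_sheaf F G \<phi> U"
proof (rule im_sheafI)
  show g: "\<phi> U s \<in> G U" using sheaf_homD(1)[OF \<phi>] assms by blast
  show "\<exists>V t. open V \<and> x \<in> V \<and> V \<subseteq> U \<and> t \<in> F V \<and> \<phi> V t = restr V (\<phi> U s)" if "x \<in> U" for x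
    using assms(3,4) that module_sheafD(2)[OF G assms(3) g] by (intro exI[of _ U] exI[of _ s]) simp
qed

lemma module_sheaf_im:
  assumes F: "module_sheaf F" and G: "module_sheaf G" and \<phi>: "sheaf_hom F G \<phi>"
  shows "module_sheaf (im_sheaf F G \<phi>)"
proof (rule module_sheafI)
  fix U :: "'a set" assume U: "open U"
  have "\<phi> U 0 \<in> im_sheaf F G \<phi> U" by (rule im_sheaf_image[OF G \<phi> U module_sheafD(1)[OF F U]])
  then show "0 \<in> im_sheaf F G \<phi> U" unfolding sheaf_hom_zero[OF \<phi> U F] .
  show "restr U s = s" if "s \<in> im_sheaf F G \<phi> U" for s
    using module_sheafD(2)[OF G U] that im_sheaf_subset by blast
  show "s + t \<in> im_sheaf F G \<phi> U" if st: "s \<in> im_sheaf F G \<phi> U" "t \<in> im_sheaf F G \<phi> U" for s t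
  proof (rule im_sheafI)
    show "s + t \<in> G U" by (rule module_sheafD(3)[OF G U]) (use st im_sheaf_subset in blast)+
    fix x assume x: "x \<in> U"
    obtain V s' where V: "open V" "x \<in> V" "V \<subseteq> U" "s' \<in> F V" "\<phi> V s' = restr V s"
      using im_sheafE[OF st(1) x] by blast
    obtain W t' where W: "open W" "x \<in> W" "W \<subseteq> U" "t' \<in> F W" "\<phi> W t' = restr W t"
      using im_sheafE[OF st(2) x] by blast
    let ?T = "V \<inter> W"
    have T: "open ?T" "?T \<subseteq> V" "?T \<subseteq> W" using V W by auto
    have m: "restr ?T s' \<in> F ?T" "restr ?T t' \<in> F ?T"
      using module_sheafD(5)[OF F V(1) T(1,2) V(4)] module_sheafD(5)[OF F W(1) T(1,3) W(4)] by auto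
    have "\<phi> ?T (restr ?T s' + restr ?T t') = restr ?T (s + t)"
      unfolding sheaf_homD(2)[OF \<phi> T(1) m] sheaf_homD(4)[OF \<phi> V(1,4) T(1,2)]
        sheaf_homD(4)[OF \<phi> W(1,4) T(1,3)] V(5) W(5) restr_restr restr_add
      by (simp add: Int_ac)
    moreover have "restr ?T s' + restr ?T t' \<in> F ?T" by (rule module_sheafD(3)[OF F T(1) m])
    ultimately show "\<exists>V r. open V \<and> x \<in> V \<and> V \<subseteq> U \<and> r \<in> F V \<and> \<phi> V r = restr V (s + t)"
      using T V W by (intro exI[of _ ?T] exI[of _ "restr ?T s' + restr ?T t'"] conjI) auto
  qed
  show "fmult U f s \<in> im_sheaf F G \<phi> U" if f: "holo_fun U f" and s: "s \<in> im_sheaf F G \<phi> U" for f s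
  proof (rule im_sheafI)
    show "fmult U f s \<in> G U" by (rule module_sheafD(4)[OF G U f]) (use s im_sheaf_subset in blast)
    fix x assume x: "x \<in> U"
    obtain V s' where V: "open V" "x \<in> V" "V \<subseteq> U" "s' \<in> F V" "\<phi> V s' = restr V s"
      using im_sheafE[OF s x] by blast
    have fV: "holo_fun V f" using holo_fun_subset[OF f V(3)] .
    have "\<phi> V (fmult V f s') = restr V (fmult U f s)"
      unfolding sheaf_homD(3)[OF \<phi> V(1,4) fV] V(5) restr_fmult[OF V(3)] ..
    then show "\<exists>V r. open V \<and> x \<in> V \<and> V \<subseteq> U \<and> r \<in> F V \<and> \<phi> V r = restr V (fmult U f s)"
      using V module_sheafD(4)[OF F V(1) fV V(4)] by blast
  qed
  show "restr W s \<in> im_sheaf F G \<phi> W" if W: "open W" "W \<subseteq> U" and s: "s \<in> im_sheaf F G \<phi> U" for W s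
  proof (rule im_sheafI)
    show "restr W s \<in> G W" by (rule module_sheafD(5)[OF G U W]) (use s im_sheaf_subset in blast)
    fix x assume x: "x \<in> W"
    obtain V s' where V: "open V" "x \<in> V" "V \<subseteq> U" "s' \<in> F V" "\<phi> V s' = restr V s"
      using im_sheafE[OF s] x W by blast
    let ?T = "V \<inter> W"
    have T: "open ?T" "?T \<subseteq> V" "?T \<subseteq> W" using V W by auto
    have "\<phi> ?T (restr ?T s') = restr ?T (restr W s)"
      unfolding sheaf_homD(4)[OF \<phi> V(1,4) T(1,2)] V(5) restr_restr by (simp add: Int_ac)
    then show "\<exists>V r. open V \<and> x \<in> V \<and> V \<subseteq> W \<and> r \<in> F V \<and> \<phi> V r = restr V (restr W s)"
      using T V x module_sheafD(5)[OF F V(1) T(1,2) V(4)]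
      by (intro exI[of _ ?T] exI[of _ "restr ?T s'"] conjI) auto
  qed
next
  fix \<U> s assume op: "\<And>U. U \<in> \<U> \<Longrightarrow> open U" and s: "\<And>U. U \<in> \<U> \<Longrightarrow> restr U s \<in> im_sheaf F G \<phi> U"
  let ?U = "\<Union>\<U>"
  show "restr ?U s \<in> im_sheaf F G \<phi> ?U"
  proof (rule im_sheafI)
    show "restr ?U s \<in> G ?U" by (rule module_sheaf_glue[OF G op]) (use s im_sheaf_subset in blast)+
    fix x assume "x \<in> ?U"
    then obtain U where U: "U \<in> \<U>" "x \<in> U" by blast
    obtain V s' where V: "open V" "x \<in> V" "V \<subseteq> U" "s' \<in> F V" "\<phi> V s' = restr V (restr U s)"
      using im_sheafE[OF s[OF U(1)] U(2)] by blast
    have VU: "V \<subseteq> ?U" using V(3) U(1) by blast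
    have "restr V (restr U s) = restr V (restr ?U s)"
      unfolding restr_restr using V(3) VU by (simp add: Int_absorb2)
    then show "\<exists>V r. open V \<and> x \<in> V \<and> V \<subseteq> ?U \<and> r \<in> F V \<and> \<phi> V r = restr V (restr ?U s)"
      using V VU by metis
  qed
qed

lemma sum_split_at:
  fixes h :: "nat \<Rightarrow> 'b::comm_monoid_add"
  assumes "c \<le> r" shows "(\<Sum>i<r. h i) = (\<Sum>j<c. h j) + (\<Sum>i<r - c. h (c + i))"
proof -
  have "(\<Sum>i<c + n. h i) = (\<Sum>j<c. h j) + (\<Sum>i<n. h (c + i))" for n
    by (induction n) (auto simp: add.assoc)
  from this[of "r - c"] show ?thesis using assms by simp
qed

lemma adapted_frameD:
  assumes "adapted_frame F \<phi> r c U e"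
  shows "frame r F U e" "c \<le> r" "c \<le> j \<Longrightarrow> j < r \<Longrightarrow> \<phi> U (e j) = 0"
  using assms by (auto simp: adapted_frame_def)

lemma adapted_frame_indep:
  assumes "adapted_frame F \<phi> r c U e" "open V" "V \<subseteq> U" "\<And>j. j < c \<Longrightarrow> holo_fun V (f j)"
    "\<And>x k. x \<in> V \<Longrightarrow> (\<Sum>j<c. f j x * \<phi> U (e j) x k) = 0" "j < c" "x \<in> V"
  shows "f j x = 0"
proof -
  have "\<forall>j<c. \<forall>x\<in>V. f j x = 0"
    by (rule assms(1)[unfolded adapted_frame_def, THEN conjunct2, THEN conjunct2, THEN conjunct2, THEN spec,
          THEN spec, THEN mp]) (use assms(2-5) in simp)
  then show ?thesis using assms(6,7) by simp
qed

lemma adapted_frame_image: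
  assumes F: "module_sheaf F" and \<phi>: "sheaf_hom F G \<phi>" and a: "adapted_frame F \<phi> r c U e"
    and V: "open V" "V \<subseteq> U" "s \<in> F V" and f: "\<And>i. i < r \<Longrightarrow> holo_fun V (f i)"
      "\<And>x k. x \<in> V \<Longrightarrow> s x k = (\<Sum>i<r. f i x * e i x k)" and x: "x \<in> V"
  shows "\<phi> V s x k = (\<Sum>j<c. f j x * \<phi> U (e j) x k)"
proof -
  note e = adapted_frameD(1)[OF a]
  have "\<phi> V s x k = (\<Sum>i<r. f i x * \<phi> U (e i) x k)"
    by (rule sheaf_hom_coeffs[OF F \<phi> frameD[OF e] V f x])
  also have "\<dots> = (\<Sum>j<c. f j x * \<phi> U (e j) x k)"
    using adapted_frameD(2,3)[OF a] by (intro sum.mono_neutral_right) auto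
  finally show ?thesis .
qed

lemma ker_frame:
  assumes F: "module_sheaf F" and \<phi>: "sheaf_hom F G \<phi>" and a: "adapted_frame F \<phi> r c U e"
  shows "frame (r - c) (ker_sheaf F \<phi>) U (\<lambda>i. e (c + i))"
proof (rule frameI)
  note e = adapted_frameD(1)[OF a] and c = adapted_frameD(2)[OF a]
  show "open U" by (rule frameD(1)[OF e])
  show "e (c + i) \<in> ker_sheaf F \<phi> U" if "i < r - c" for i
  proof -
    have "c + i < r" using that by simp
    then have "e (c + i) \<in> F U" "\<phi> U (e (c + i)) = 0"
      using frameD(2)[OF e] adapted_frameD(3)[OF a le_add1] by blast+
    then show ?thesis unfolding ker_sheaf_def by blast
  qed
  fix V assume V: "open V" "V \<subseteq> U"
  show "\<exists>f. (\<forall>i<r - c. holo_fun V (f i)) \<and> (\<forall>x\<in>V. \<forall>k. s x k = (\<Sum>i<r - c. f i x * e (c + i) x k))"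
    if s: "s \<in> ker_sheaf F \<phi> V" for s
  proof -
    have sF: "s \<in> F V" "\<phi> V s = 0" using s unfolding ker_sheaf_def by blast+
    obtain f where f: "\<And>i. i < r \<Longrightarrow> holo_fun V (f i)" "\<And>x k. x \<in> V \<Longrightarrow> s x k = (\<Sum>i<r. f i x * e i x k)"
      using frame_coeffs[OF e V sF(1)] by blast
    have z: "f j x = 0" if "j < c" "x \<in> V" for j x
    proof (rule adapted_frame_indep[OF a V _ _ that])
      show "holo_fun V (f j)" if "j < c" for j using f(1) that c by simp
      show "(\<Sum>j<c. f j x * \<phi> U (e j) x k) = 0" if "x \<in> V" for x k
        using adapted_frame_image[OF F \<phi> a V sF(1) f that, of k] sF(2) by (simp only: zero_fun_apply)
    qed
    show ?thesis
    proof (intro exI[of _ "\<lambda>i. f (c + i)"] conjI allI impI ballI)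
      show "holo_fun V (f (c + i))" if "i < r - c" for i using f(1) that by simp
      show "s x k = (\<Sum>i<r - c. f (c + i) x * e (c + i) x k)" if "x \<in> V" for x k
        unfolding f(2)[OF that] using sum_split_at[OF c, of "\<lambda>i. f i x * e i x k"] z that by simp
    qed
  qed
  fix f i x
  assume f: "\<And>i. i < r - c \<Longrightarrow> holo_fun V (f i)" and i: "i < r - c" and x: "x \<in> V"
    and rel: "\<And>x k. x \<in> V \<Longrightarrow> (\<Sum>i<r - c. f i x * e (c + i) x k) = 0"
  define g where "g = (\<lambda>j. if j < c then (\<lambda>_. 0) else f (j - c))"
  have "g (c + i) x = 0"
  proof (rule frame_indep[OF e V])
    show "holo_fun V (g j)" if "j < r" for j using f that by (auto simp: g_def)
    show "(\<Sum>j<r. g j y * e j y k) = 0" if "y \<in> V" for y k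
      using sum_split_at[OF c, of "\<lambda>j. g j y * e j y k"] rel[OF that, of k] by (simp add: g_def)
  qed (use i x in auto)
  then show "f i x = 0" by (simp add: g_def)
qed

text \<open>A section of the image lifts only locally, but its coefficients with respect to the
  images of the frame are unique and therefore glue.\<close>

lemma im_frame:
  assumes F: "module_sheaf F" and G: "module_sheaf G" and \<phi>: "sheaf_hom F G \<phi>"
    and a: "adapted_frame F \<phi> r c U e"
  shows "frame c (im_sheaf F G \<phi>) U (\<lambda>j. \<phi> U (e j))"
proof (rule frameI)
  note e = adapted_frameD(1)[OF a] and c = adapted_frameD(2)[OF a]
  show U: "open U" by (rule frameD(1)[OF e])
  show "\<phi> U (e j) \<in> im_sheaf F G \<phi> U" if "j < c" for j
    by (rule im_sheaf_image[OF G \<phi> U frameD(2)[OF e]]) (use that c in simp)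
  show "f j x = 0" if "open V" "V \<subseteq> U" "\<And>j. j < c \<Longrightarrow> holo_fun V (f j)"
    "\<And>x k. x \<in> V \<Longrightarrow> (\<Sum>j<c. f j x * \<phi> U (e j) x k) = 0" "j < c" "x \<in> V" for V f j x
    using adapted_frame_indep[OF a that] .
  fix V t assume V: "open V" "V \<subseteq> U" and t: "t \<in> im_sheaf F G \<phi> V"
  define P where "P = (\<lambda>x W f. open W \<and> x \<in> W \<and> W \<subseteq> V \<and> (\<forall>j<c. holo_fun W (f j)) \<and>
    (\<forall>y\<in>W. \<forall>k. t y k = (\<Sum>j<c. f j y * \<phi> U (e j) y k)))"
  have "\<exists>W f. P x W f" if x: "x \<in> V" for x
  proof -
    obtain W s where W: "open W" "x \<in> W" "W \<subseteq> V" "s \<in> F W" "\<phi> W s = restr W t"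
      using im_sheafE[OF t x] by blast
    have WU: "W \<subseteq> U" using W(3) V(2) by blast
    obtain f where f: "\<And>i. i < r \<Longrightarrow> holo_fun W (f i)" "\<And>x k. x \<in> W \<Longrightarrow> s x k = (\<Sum>i<r. f i x * e i x k)"
      using frame_coeffs[OF e W(1) WU W(4)] by blast
    have "t y k = (\<Sum>j<c. f j y * \<phi> U (e j) y k)" if "y \<in> W" for y k
      using adapted_frame_image[OF F \<phi> a W(1) WU W(4) f that, of k] W(5) that by (simp add: restr_apply)
    then have "P x W f" unfolding P_def using W f(1) c by auto
    then show ?thesis by blast
  qed
  then obtain W f where Wf: "\<And>x. x \<in> V \<Longrightarrow> P x (W x) (f x)" by metis
  \<comment> \<open>At each point the coefficient is read off from the lift chosen for that point;
    \<open>eq\<close> shows that on the neighbourhood of \<open>x\<close> it is the function chosen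
    for \<open>x\<close>.\<close>
  define g where "g = (\<lambda>j x. f x j x)"
  have P: "open (W x)" "x \<in> W x" "W x \<subseteq> V" "\<And>j. j < c \<Longrightarrow> holo_fun (W x) (f x j)"
    "\<And>y k. y \<in> W x \<Longrightarrow> t y k = (\<Sum>j<c. f x j y * \<phi> U (e j) y k)" if "x \<in> V" for x
    using Wf[OF that] unfolding P_def by auto
  have eq: "f y j y = f x j y" if "x \<in> V" "y \<in> W x" "j < c" for x y j
  proof -
    have y: "y \<in> V" using P(3)[OF that(1)] that(2) by blast
    let ?T = "W x \<inter> W y"
    have T: "open ?T" "?T \<subseteq> U" "y \<in> ?T" using P(1-3)[OF that(1)] P(1-3)[OF y] that V(2) by auto
    have "f y j y - f x j y = 0"
    proof (rule adapted_frame_indep[OF a T(1,2), where f = "\<lambda>j z. f y j z - f x j z"])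
      show "holo_fun ?T (\<lambda>z. f y j z - f x j z)" if "j < c" for j
        by (intro holo_fun_diff; rule holo_fun_subset[OF P(4)]) (use y \<open>x \<in> V\<close> that in auto)
      show "(\<Sum>j<c. (f y j z - f x j z) * \<phi> U (e j) z k) = 0" if "z \<in> ?T" for z k
        using P(5)[OF y, of z k] P(5)[OF \<open>x \<in> V\<close>, of z k] that
        by (simp add: left_diff_distrib sum_subtractf)
    qed (use T that in auto)
    then show ?thesis by simp
  qed
  show "\<exists>f. (\<forall>i<c. holo_fun V (f i)) \<and> (\<forall>x\<in>V. \<forall>k. t x k = (\<Sum>i<c. f i x * \<phi> U (e i) x k))"
  proof (intro exI[of _ g] conjI allI impI ballI)
    show "t x k = (\<Sum>j<c. g j x * \<phi> U (e j) x k)" if "x \<in> V" for x k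
      unfolding g_def using P(5)[OF that P(2)[OF that]] .
    show "holo_fun V (g j)" if j: "j < c" for j
    proof (rule holo_fun_local[OF _ V(1)])
      fix x assume x: "x \<in> V"
      have "holo_fun (W x) (g j)"
        by (rule holo_fun_cong[OF P(4)[OF x j]]) (use eq[OF x _ j] in \<open>simp add: g_def\<close>)
      then show "\<exists>T. open T \<and> x \<in> T \<and> T \<subseteq> V \<and> holo_fun T (g j)"
        using P(1-3)[OF x] by blast
    qed
  qed
qed

text \<open>The number of pivots at any point is the rank of the image sheaf, hence the same
  everywhere. The last clause records this, so that transition matrices between adapted frames have
  blocks of one fixed size.\<close>

theorem ker_im_vector_bundle:
  fixes F G :: "'a::riemann_surface sheaf"
  assumes F: "vector_bundle F" and G: "vector_bundle G" and \<phi>: "sheaf_hom F G \<phi>"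
  shows "vector_bundle (ker_sheaf F \<phi>)" "vector_bundle (im_sheaf F G \<phi>)"
    "rk F = rk (ker_sheaf F \<phi>) + rk (im_sheaf F G \<phi>)" "rk (im_sheaf F G \<phi>) \<le> rk G"
    "\<exists>U e. x \<in> U \<and> adapted_frame F \<phi> (rk F) (rk (im_sheaf F G \<phi>)) U e"
proof -
  note mF = vector_bundleD(1)[OF F] and mG = vector_bundleD(1)[OF G]
  note mK = module_sheaf_ker[OF mF mG \<phi>] and mI = module_sheaf_im[OF mF mG \<phi>]
  have ex: "\<exists>U e c. x \<in> U \<and> adapted_frame F \<phi> (rk F) c U e \<and> c \<le> rk G" for x
    by (rule adapted_frame_exists[OF F G \<phi>])
  show K: "vector_bundle (ker_sheaf F \<phi>)"
  proof (rule vector_bundleI[OF mK])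
    fix x
    obtain U e c where "x \<in> U" "adapted_frame F \<phi> (rk F) c U e" using ex by blast
    then show "\<exists>U e r. x \<in> U \<and> frame r (ker_sheaf F \<phi>) U e" using ker_frame[OF mF \<phi>] by metis
  qed
  show I: "vector_bundle (im_sheaf F G \<phi>)"
  proof (rule vector_bundleI[OF mI])
    fix x
    obtain U e c where "x \<in> U" "adapted_frame F \<phi> (rk F) c U e" using ex by blast
    then show "\<exists>U e r. x \<in> U \<and> frame r (im_sheaf F G \<phi>) U e" using im_frame[OF mF mG \<phi>] by metis
  qed
  have r: "rk (im_sheaf F G \<phi>) = c" "rk (ker_sheaf F \<phi>) = rk F - c" "c \<le> rk F"
    if "x \<in> U" "adapted_frame F \<phi> (rk F) c U e" for x U e c
    by (rule rk_eq_frame[OF I im_frame[OF mF mG \<phi> that(2)] that(1)]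
        rk_eq_frame[OF K ker_frame[OF mF \<phi> that(2)] that(1)] adapted_frameD(2)[OF that(2)])+
  obtain U e c where U: "x \<in> U" "adapted_frame F \<phi> (rk F) c U e" and le: "c \<le> rk G" using ex by blast
  show "rk (im_sheaf F G \<phi>) \<le> rk G" unfolding r(1)[OF U] by (rule le)
  show "\<exists>U e. x \<in> U \<and> adapted_frame F \<phi> (rk F) (rk (im_sheaf F G \<phi>)) U e"
    unfolding r(1)[OF U] using U by blast
  show "rk F = rk (ker_sheaf F \<phi>) + rk (im_sheaf F G \<phi>)"
    using r[OF U] by simp
qed

section \<open>Degree\<close>

definition det_at :: "nat \<Rightarrow> (nat \<Rightarrow> nat \<Rightarrow> 'a \<Rightarrow> complex) \<Rightarrow> 'a \<Rightarrow> complex" where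
  "det_at r A x = Determinant.det (mat r r (\<lambda>(i, j). A i j x))"

lemma det_at_cong:
  assumes "\<And>i j. i < r \<Longrightarrow> j < r \<Longrightarrow> A i j x = B i j y"
  shows "det_at r A x = det_at r B y"
proof -
  have "mat r r (\<lambda>(i, j). A i j x) = mat r r (\<lambda>(i, j). B i j y)"
    by (rule cong_mat) (use assms in auto)
  then show ?thesis by (simp add: det_at_def)
qed

lemma det_at_mult: "det_at r (\<lambda>i l x. \<Sum>j<r. A i j x * B j l x) x = det_at r A x * det_at r B x"
proof -
  have "mat r r (\<lambda>(i, l). \<Sum>j<r. A i j x * B j l x) = mat r r (\<lambda>(i, j). A i j x) * mat r r (\<lambda>(i, j). B i j x)"
    by (rule eq_matI) (auto simp: times_mat_def scalar_prod_def atLeast0LessThan)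
  then show ?thesis
    unfolding det_at_def by (simp add: det_mult[of _ r])
qed

lemma det_at_id: "det_at r (\<lambda>i j x. matrix_id i j) x = 1"
proof -
  have "mat r r (\<lambda>(i, j). matrix_id i j) = 1\<^sub>m r"
    by (rule eq_matI) (auto simp: matrix_id_def)
  then show ?thesis by (simp add: det_at_def)
qed

lemma holo_fun_det_at:
  assumes "\<And>i j. i < r \<Longrightarrow> j < r \<Longrightarrow> holo_fun U (A i j)"
  shows "holo_fun U (det_at r A)"
proof -
  have "det_at r A = (\<lambda>x. \<Sum>p\<in>{p. p permutes {0..<r}}. signof p * (\<Prod>i = 0..<r. A i (p i) x))"
  proof
    fix x
    have "det_at r A x = (\<Sum>p\<in>{p. p permutes {0..<r}}. signof p *
        (\<Prod>i = 0..<r. mat r r (\<lambda>(i, j). A i j x) $$ (i, p i)))"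
      unfolding det_at_def by (rule det_def') simp
    also have "\<dots> = (\<Sum>p\<in>{p. p permutes {0..<r}}. signof p * (\<Prod>i = 0..<r. A i (p i) x))"
    proof (rule sum.cong[OF refl])
      fix p assume "p \<in> {p. p permutes {0..<r}}"
      then have "p i < r" if "i < r" for i
        using that permutes_in_image[of p "{0..<r}" i] by simp
      then have "(\<Prod>i = 0..<r. mat r r (\<lambda>(i, j). A i j x) $$ (i, p i)) = (\<Prod>i = 0..<r. A i (p i) x)"
        by (intro prod.cong) auto
      then show "signof p * (\<Prod>i = 0..<r. mat r r (\<lambda>(i, j). A i j x) $$ (i, p i)) =
          signof p * (\<Prod>i = 0..<r. A i (p i) x)" by simp
    qed
    finally show "det_at r A x = (\<Sum>p\<in>{p. p permutes {0..<r}}. signof p * (\<Prod>i = 0..<r. A i (p i) x))" .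
  qed
  moreover have "holo_fun U (\<lambda>x. \<Sum>p\<in>{p. p permutes {0..<r}}. signof p * (\<Prod>i = 0..<r. A i (p i) x))"
  proof (rule holo_fun_sum, rule holo_fun_mult[OF holo_fun_const], rule holo_fun_prod)
    fix p i assume p: "p \<in> {p. p permutes {0..<r}}" and i: "i \<in> {0..<r}"
    then have "p i < r" using permutes_in_image[of p "{0..<r}" i] by simp
    then show "holo_fun U (A i (p i))" using assms i by simp
  qed
  ultimately show ?thesis by simp
qed

lemma det_at_block:
  assumes c: "c \<le> r" and z: "\<And>i j. i < c \<Longrightarrow> c \<le> j \<Longrightarrow> j < r \<Longrightarrow> A i j x = 0"
  shows "det_at r A x = det_at c A x * det_at (r - c) (\<lambda>i j. A (c + i) (c + j)) x"
proof -
  let ?A1 = "mat c c (\<lambda>(i, j). A i j x)" and ?A3 = "mat (r - c) c (\<lambda>(i, j). A (c + i) j x)"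
    and ?A4 = "mat (r - c) (r - c) (\<lambda>(i, j). A (c + i) (c + j) x)"
  have "mat r r (\<lambda>(i, j). A i j x) = four_block_mat ?A1 (0\<^sub>m c (r - c)) ?A3 ?A4"
    by (rule eq_matI) (use c z in \<open>auto simp: four_block_mat_def Let_def\<close>)
  then show ?thesis
    unfolding det_at_def by (subst det_four_block_mat_upper_right_zero[symmetric, of _ c _ "r - c"]) auto
qed

text \<open>The factor by which the squared length of the wedge product changes from
  \<open>e\<close> to \<open>e'\<close>. The choice of \<open>A\<close> does not matter, because
  coefficients in a frame are unique.\<close>

definition transition_norm ::
    "nat \<Rightarrow> 'a::riemann_surface set \<Rightarrow> (nat \<Rightarrow> 'a sect) \<Rightarrow> 'a set \<Rightarrow> (nat \<Rightarrow> 'a sect) \<Rightarrow> 'a \<Rightarrow> real" where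
  "transition_norm r U e U' e' x = (cmod (det_at r (SOME A. transition (U \<inter> U') r r e e' A) x))\<^sup>2"

lemma transition_norm_eq:
  assumes F: "module_sheaf F" and e: "frame r F U e" and e': "frame r F U' e'"
    and W: "open W" "W \<subseteq> U" "W \<subseteq> U'" "x \<in> W" and A: "transition W r r e e' A"
  shows "transition_norm r U e U' e' x = (cmod (det_at r A x))\<^sup>2"
proof -
  define B where "B = (SOME A. transition (U \<inter> U') r r e e' A)"
  have "\<exists>A. transition (U \<inter> U') r r e e' A"
    by (rule transition_frames[OF F e e']) (use frameD(1)[OF e] frameD(1)[OF e'] in auto)
  then have "transition (U \<inter> U') r r e e' B" unfolding B_def by (rule someI_ex)
  then have "transition W r r e e' B" by (rule transition_subset) (use W in auto)
  then have "det_at r B x = det_at r A x"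
    by (intro det_at_cong transition_unique[OF e W(1,2) _ A _ _ W(4)])
  then show ?thesis by (simp add: transition_norm_def B_def)
qed

lemma transition_norm_cocycle:
  assumes F: "module_sheaf F" and e: "frame r F U e" "frame r F U' e'" "frame r F U'' e''"
    and x: "x \<in> U" "x \<in> U'" "x \<in> U''"
  shows "transition_norm r U e U'' e'' x = transition_norm r U e U' e' x * transition_norm r U' e' U'' e'' x"
proof -
  define W where "W = U \<inter> U' \<inter> U''"
  have W: "open W" "W \<subseteq> U" "W \<subseteq> U'" "W \<subseteq> U''" "x \<in> W"
    using frameD(1)[OF e(1)] frameD(1)[OF e(2)] frameD(1)[OF e(3)] x by (auto simp: W_def)
  obtain A where A: "transition W r r e e' A" using transition_frames[OF F e(1,2) W(1-3)] by blast
  obtain B where B: "transition W r r e' e'' B" using transition_frames[OF F e(2,3) W(1,3,4)] by blast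
  show ?thesis
    unfolding transition_norm_eq[OF F e(1,3) W(1,2,4,5) transition_mult[OF A B]]
      transition_norm_eq[OF F e(1,2) W(1,2,3,5) A] transition_norm_eq[OF F e(2,3) W(1,3,4,5) B] det_at_mult
    by (simp add: norm_mult power_mult_distrib)
qed

lemma transition_norm_self:
  assumes "module_sheaf F" "frame r F U e" "x \<in> U"
  shows "transition_norm r U e U e x = 1"
  using transition_norm_eq[OF assms(1,2,2) frameD(1)[OF assms(2)] order_refl order_refl assms(3) transition_id]
  by (simp add: det_at_id)

lemma transition_norm_pos:
  assumes "module_sheaf F" "frame r F U e" "frame r F U' e'" "x \<in> U" "x \<in> U'"
  shows "transition_norm r U e U' e' x > 0"
proof -
  have "transition_norm r U e U' e' x * transition_norm r U' e' U e x = 1"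
    using transition_norm_cocycle[OF assms(1-3,2,4,5,4)] transition_norm_self[OF assms(1,2,4)] by simp
  moreover have "transition_norm r U e U' e' x \<ge> 0" by (simp add: transition_norm_def)
  ultimately show ?thesis by (cases "transition_norm r U e U' e' x = 0") auto
qed

lemma transition_norm_holo:
  assumes F: "module_sheaf F" and e: "frame r F U e" "frame r F U' e'"
  obtains d where "holo_fun (U \<inter> U') d" "\<And>x. x \<in> U \<inter> U' \<Longrightarrow> transition_norm r U e U' e' x = (cmod (d x))\<^sup>2"
    "\<And>x. x \<in> U \<inter> U' \<Longrightarrow> d x \<noteq> 0"
proof -
  have W: "open (U \<inter> U')" "U \<inter> U' \<subseteq> U" "U \<inter> U' \<subseteq> U'" using frameD(1)[OF e(1)] frameD(1)[OF e(2)] by auto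
  obtain A where A: "transition (U \<inter> U') r r e e' A" using transition_frames[OF F e W] by blast
  have eq: "transition_norm r U e U' e' x = (cmod (det_at r A x))\<^sup>2" if "x \<in> U \<inter> U'" for x
    using transition_norm_eq[OF F e W that A] .
  show ?thesis
  proof (rule that[of "det_at r A"])
    show "holo_fun (U \<inter> U') (det_at r A)" by (rule holo_fun_det_at) (rule transitionD(1)[OF A])
    show "det_at r A x \<noteq> 0" if "x \<in> U \<inter> U'" for x
      using transition_norm_pos[OF F e, of x] eq[OF that] that by auto
  qed (rule eq)
qed

lemma transition_norm_C2:
  assumes "module_sheaf F" "frame r F U e" "frame r F U' e'"
  shows "C2_fun (U \<inter> U') (transition_norm r U e U' e')"
proof -
  obtain d where d: "holo_fun (U \<inter> U') d" "\<And>x. x \<in> U \<inter> U' \<Longrightarrow> transition_norm r U e U' e' x = (cmod (d x))\<^sup>2"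
    using transition_norm_holo[OF assms] by metis
  have o: "open (U \<inter> U')" using frameD(1)[OF assms(2)] frameD(1)[OF assms(3)] by auto
  show ?thesis by (rule C2_fun_cong[OF C2_fun_norm_square[OF o d(1)] o]) (use d(2) in auto)
qed

text \<open>\<open>transition_norm\<close> absorbs the quantifier over matrices: one exists on each
  overlap of frames, and any two agree there.\<close>

lemma det_metric_iff:
  assumes F: "module_sheaf F"
  shows "det_metric F h \<longleftrightarrow>
     (\<forall>U e. frame (rk F) F U e \<longrightarrow> (\<forall>x\<in>U. h U e x > 0) \<and> C2_fun U (h U e)) \<and>
     (\<forall>U e U' e' x. frame (rk F) F U e \<and> frame (rk F) F U' e' \<and> x \<in> U \<and> x \<in> U' \<longrightarrow>
        h U' e' x = transition_norm (rk F) U e U' e' x * h U e x)"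
    (is "_ \<longleftrightarrow> ?P \<and> ?Q")
proof -
  let ?R = "\<forall>U e U' e' g.
        frame (rk F) F U e \<and> frame (rk F) F U' e' \<and>
        (\<forall>i<rk F. \<forall>j<rk F. holo_fun (U \<inter> U') (g i j)) \<and>
        (\<forall>x\<in>U \<inter> U'. \<forall>j<rk F. \<forall>k. e' j x k = (\<Sum>i<rk F. g i j x * e i x k)) \<longrightarrow>
        (\<forall>x\<in>U \<inter> U'.
           h U' e' x = (cmod (Determinant.det (mat (rk F) (rk F) (\<lambda>(i, j). g i j x))))\<^sup>2 * h U e x)"
  have "?R \<longleftrightarrow> ?Q"
  proof
    assume R: ?R
    show ?Q
    proof (intro allI impI, elim conjE)
      fix U e U' e' x assume e: "frame (rk F) F U e" "frame (rk F) F U' e'" and x: "x \<in> U" "x \<in> U'"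
      have W: "open (U \<inter> U')" "U \<inter> U' \<subseteq> U" "U \<inter> U' \<subseteq> U'" "x \<in> U \<inter> U'"
        using frameD(1)[OF e(1)] frameD(1)[OF e(2)] x by auto
      obtain A where A: "transition (U \<inter> U') (rk F) (rk F) e e' A" using transition_frames[OF F e W(1-3)] by blast
      have "\<forall>x\<in>U \<inter> U'. h U' e' x = (cmod (Determinant.det (mat (rk F) (rk F) (\<lambda>(i, j). A i j x))))\<^sup>2 * h U e x"
        by (rule R[THEN spec, THEN spec, THEN spec, THEN spec, THEN spec, THEN mp, of U e U' e' A])
          (use e A in \<open>simp add: transition_def\<close>)
      then show "h U' e' x = transition_norm (rk F) U e U' e' x * h U e x"
        using transition_norm_eq[OF F e W A] W(4) by (simp add: det_at_def)
    qed
  next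
    assume Q: ?Q
    show ?R
    proof (intro allI impI ballI, elim conjE)
      fix U e U' e' g x
      assume e: "frame (rk F) F U e" "frame (rk F) F U' e'" and x: "x \<in> U \<inter> U'"
        and g: "\<forall>i<rk F. \<forall>j<rk F. holo_fun (U \<inter> U') (g i j)"
          "\<forall>x\<in>U \<inter> U'. \<forall>j<rk F. \<forall>k. e' j x k = (\<Sum>i<rk F. g i j x * e i x k)"
      have W: "open (U \<inter> U')" "U \<inter> U' \<subseteq> U" "U \<inter> U' \<subseteq> U'"
        using frameD(1)[OF e(1)] frameD(1)[OF e(2)] by auto
      have "transition (U \<inter> U') (rk F) (rk F) e e' g" using g by (simp add: transition_def)
      note t = transition_norm_eq[OF F e W x this]
      have "h U' e' x = transition_norm (rk F) U e U' e' x * h U e x" using Q e x by blast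
      then show "h U' e' x = (cmod (Determinant.det (mat (rk F) (rk F) (\<lambda>(i, j). g i j x))))\<^sup>2 * h U e x"
        unfolding t det_at_def .
    qed
  qed
  then show ?thesis unfolding det_metric_def by simp
qed

lemma det_metricD:
  assumes "module_sheaf F" "det_metric F h" "frame (rk F) F U e"
  shows "x \<in> U \<Longrightarrow> h U e x > 0" "C2_fun U (h U e)"
    "frame (rk F) F U' e' \<Longrightarrow> x \<in> U \<Longrightarrow> x \<in> U' \<Longrightarrow> h U' e' x = transition_norm (rk F) U e U' e' x * h U e x"
proof -
  note h = assms(2)[unfolded det_metric_iff[OF assms(1)]]
  have 1: "(\<forall>x\<in>U. h U e x > 0) \<and> C2_fun U (h U e)"
    by (rule h[THEN conjunct1, THEN spec, THEN spec, THEN mp, OF assms(3)])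
  then show "x \<in> U \<Longrightarrow> h U e x > 0" "C2_fun U (h U e)" by blast+
  show "h U' e' x = transition_norm (rk F) U e U' e' x * h U e x"
    if "frame (rk F) F U' e'" "x \<in> U" "x \<in> U'"
    by (rule h[THEN conjunct2, THEN spec, THEN spec, THEN spec, THEN spec, THEN spec, THEN mp])
      (intro conjI that assms(3))
qed

text \<open>Positive combinations of metrics on a line bundle are metrics. Here the determinant of
  each chosen local frame gets length 1, and these local metrics are added with bump functions as
  weights.\<close>

lemma det_metric_exists:
  fixes F :: "'a::compact_riemann_surface sheaf"
  assumes F: "vector_bundle F"
  shows "\<exists>h. det_metric F h"
proof -
  note mF = vector_bundleD(1)[OF F]
  define r where "r = rk F"
  have "\<exists>p. x \<in> fst p \<and> frame r F (fst p) (snd p)" for x :: 'a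
    using vector_bundleD(3)[OF F, of x] unfolding r_def by (metis fst_conv snd_conv)
  then obtain p where p: "\<And>x. x \<in> fst (p x)" "\<And>x. frame r F (fst (p x)) (snd (p x))" by metis
  define O' where "O' = (\<lambda>x. fst (p x))"
  define b where "b = (\<lambda>x. snd (p x))"
  have O': "open (O' x)" "x \<in> O' x" and b: "frame r F (O' x) (b x)" for x
    using p frameD(1)[OF p(2)] by (auto simp: O'_def b_def)
  obtain n :: nat and a \<rho> where \<rho>: "\<And>k. k < n \<Longrightarrow> C2_fun UNIV (\<rho> k)" "\<And>k y. \<rho> k y \<ge> (0::real)"
    "\<And>k. k < n \<Longrightarrow> closure {y. \<rho> k y \<noteq> 0} \<subseteq> O' (a k)" "\<And>y. (\<Sum>k<n. \<rho> k y) > 0"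
    using C2_bump_family[of O', OF O'] by metis
  have in_O: "x \<in> O' (a k)" if "k < n" "\<rho> k x \<noteq> 0" for k x
    using \<rho>(3)[OF that(1)] closure_subset[of "{y. \<rho> k y \<noteq> 0}"] that(2) by blast
  define h where "h = (\<lambda>U e x. \<Sum>k<n. \<rho> k x * transition_norm r (O' (a k)) (b (a k)) U e x)"
  have "det_metric F h"
    unfolding det_metric_iff[OF mF] r_def[symmetric]
  proof (intro conjI allI impI ballI; (elim conjE)?)
    fix U e assume e: "frame r F U e"
    note U = frameD(1)[OF e]
    show "h U e x > 0" if x: "x \<in> U" for x
    proof -
      have nn: "\<rho> k x * transition_norm r (O' (a k)) (b (a k)) U e x \<ge> 0" for k
        using \<rho>(2) by (simp add: transition_norm_def)
      obtain k where k: "k < n" "\<rho> k x \<noteq> 0"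
        using \<rho>(4)[of x] by (metis lessThan_iff less_irrefl sum.neutral)
      have "\<rho> k x * transition_norm r (O' (a k)) (b (a k)) U e x > 0"
        using \<rho>(2)[of k x] k transition_norm_pos[OF mF b e in_O[OF k] x] by simp
      then show ?thesis unfolding h_def using k(1) nn by (intro sum_pos2[of _ k]) auto
    qed
    show "C2_fun U (h U e)"
      unfolding h_def
    proof (rule C2_fun_sum[OF U])
      fix k assume "k \<in> {..<n}"
      then have k: "k < n" by simp
      define t where "t = transition_norm r (O' (a k)) (b (a k)) U e"
      show "C2_fun U (\<lambda>x. \<rho> k x * t x)"
      proof (rule C2_fun_local[OF U])
        fix x assume x: "x \<in> U"
        show "\<exists>T. open T \<and> x \<in> T \<and> T \<subseteq> U \<and> C2_fun T (\<lambda>x. \<rho> k x * t x)"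
        proof (cases "x \<in> O' (a k)")
          case True
          let ?T = "O' (a k) \<inter> U"
          have T: "open ?T" using O'(1) U by auto
          have "C2_fun ?T (\<lambda>x. \<rho> k x * t x)"
            unfolding t_def
            by (rule C2_fun_mult[OF T C2_fun_subset[OF \<rho>(1)[OF k] open_UNIV T] transition_norm_C2[OF mF b e]]) simp
          then show ?thesis using T True x by (intro exI[of _ ?T]) auto
        next
          case False
          let ?T = "U - closure {y. \<rho> k y \<noteq> 0}"
          have T: "open ?T" using U by auto
          have "C2_fun ?T (\<lambda>x. \<rho> k x * t x)"
            by (rule C2_fun_cong[OF C2_fun_const[OF T, of 0] T])
              (use closure_subset[of "{y. \<rho> k y \<noteq> 0}"] in auto)
          then show ?thesis using T False x \<rho>(3)[OF k] by (intro exI[of _ ?T]) auto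
        qed
      qed
    qed
  next
    fix U e U' e' x assume e: "frame r F U e" "frame r F U' e'" and x: "x \<in> U" "x \<in> U'"
    show "h U' e' x = transition_norm r U e U' e' x * h U e x"
      unfolding h_def sum_distrib_left
    proof (rule sum.cong[OF refl])
      fix k assume "k \<in> {..<n}"
      then have k: "k < n" by simp
      show "\<rho> k x * transition_norm r (O' (a k)) (b (a k)) U' e' x =
          transition_norm r U e U' e' x * (\<rho> k x * transition_norm r (O' (a k)) (b (a k)) U e x)"
      proof (cases "\<rho> k x = 0")
        case False
        show ?thesis
          unfolding transition_norm_cocycle[OF mF b e in_O[OF k False] x] by simp
      qed simp
    qed
  qed
  then show ?thesis by blast
qed

text \<open>A metric on the determinant is fixed by its values on any covering family
  \<open>S\<close> of frames, and compatible values on the family extend. This is meant for adapted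
  frames, the only ones on which the product of two metrics is defined directly.\<close>

lemma det_metric_extend:
  fixes F :: "'a::riemann_surface sheaf"
  assumes F: "vector_bundle F"
    and fr: "\<And>U e. S U e \<Longrightarrow> frame (rk F) F U e" and cov: "\<And>x. \<exists>U e. S U e \<and> x \<in> U"
    and pos: "\<And>U e x. S U e \<Longrightarrow> x \<in> U \<Longrightarrow> \<kappa> U e x > 0" and C2: "\<And>U e. S U e \<Longrightarrow> C2_fun U (\<kappa> U e)"
    and tr: "\<And>U e U' e' x. S U e \<Longrightarrow> S U' e' \<Longrightarrow> x \<in> U \<Longrightarrow> x \<in> U' \<Longrightarrow>
      \<kappa> U' e' x = transition_norm (rk F) U e U' e' x * \<kappa> U e x"
  obtains h where "det_metric F h" "\<And>U e x. S U e \<Longrightarrow> x \<in> U \<Longrightarrow> h U e x = \<kappa> U e x"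
proof -
  note mF = vector_bundleD(1)[OF F]
  define r where "r = rk F"
  note fr = fr[folded r_def] and tr = tr[folded r_def]
  have "\<exists>p. S (fst p) (snd p) \<and> x \<in> fst p" for x using cov[of x] by (metis fst_conv snd_conv)
  then obtain p where p: "\<And>x. S (fst (p x)) (snd (p x))" "\<And>x. x \<in> fst (p x)" by metis
  \<comment> \<open>At each point the value is transported from a frame chosen for that point; the
    cocycle rule and \<open>tr\<close> show that any other frame of the family gives the same
    value.\<close>
  define h where "h = (\<lambda>U e x. transition_norm r (fst (p x)) (snd (p x)) U e x * \<kappa> (fst (p x)) (snd (p x)) x)"
  have h: "h U' e' x = transition_norm r U e U' e' x * \<kappa> U e x"
    if S: "S U e" and e': "frame r F U' e'" and x: "x \<in> U" "x \<in> U'" for U e U' e' x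
    unfolding tr[OF p(1) S p(2) x(1)] h_def
      transition_norm_cocycle[OF mF fr[OF p(1)] fr[OF S] e' p(2) x] by simp
  have "det_metric F h"
    unfolding det_metric_iff[OF mF] r_def[symmetric]
  proof (intro conjI allI impI ballI; (elim conjE)?)
    fix U e assume e: "frame r F U e"
    note U = frameD(1)[OF e]
    show "h U e x > 0" if x: "x \<in> U" for x
      unfolding h_def using transition_norm_pos[OF mF fr[OF p(1)] e p(2) x] pos[OF p] by simp
    show "C2_fun U (h U e)"
    proof (rule C2_fun_local[OF U])
      fix x assume x: "x \<in> U"
      let ?T = "fst (p x) \<inter> U"
      have T: "open ?T" using frameD(1)[OF fr[OF p(1)]] U by auto
      have "C2_fun ?T (\<lambda>y. transition_norm r (fst (p x)) (snd (p x)) U e y * \<kappa> (fst (p x)) (snd (p x)) y)"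
        by (rule C2_fun_mult[OF T transition_norm_C2[OF mF fr[OF p(1)] e]
              C2_fun_subset[OF C2[OF p(1)] frameD(1)[OF fr[OF p(1)]] T]]) simp
      then have "C2_fun ?T (h U e)"
        by (rule C2_fun_cong[OF _ T]) (use h[OF p(1) e] in auto)
      then show "\<exists>T. open T \<and> x \<in> T \<and> T \<subseteq> U \<and> C2_fun T (h U e)"
        using T x p(2) by (intro exI[of _ ?T]) auto
    qed
  next
    fix U e U' e' x assume e: "frame r F U e" "frame r F U' e'" and x: "x \<in> U" "x \<in> U'"
    show "h U' e' x = transition_norm r U e U' e' x * h U e x"
      unfolding h_def transition_norm_cocycle[OF mF fr[OF p(1)] e p(2) x] by simp
  qed
  moreover have "h U e x = \<kappa> U e x" if "S U e" "x \<in> U" for U e x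
    using h[OF that(1) fr[OF that(1)] that(2,2)] transition_norm_self[OF mF fr[OF that(1)] that(2)] by simp
  ultimately show ?thesis using that by blast
qed

text \<open>A change of frame adds the logarithm of the squared modulus of a holomorphic function
  without zeros, and this is harmonic.\<close>

lemma laplacian_ln_transition:
  fixes F :: "'a::riemann_surface sheaf"
  assumes F: "module_sheaf F" and h: "det_metric F h" and e: "frame (rk F) F U e" "frame (rk F) F U' e'"
    and c: "(V, z) \<in> charts" and x: "x \<in> U" "x \<in> U'" "x \<in> V"
  shows "laplacian (\<lambda>q. ln (h U' e' (inv_into V z q))) (z x) = laplacian (\<lambda>q. ln (h U e (inv_into V z q))) (z x)"
proof -
  obtain d where d: "holo_fun (U \<inter> U') d"
    "\<And>x. x \<in> U \<inter> U' \<Longrightarrow> transition_norm (rk F) U e U' e' x = (cmod (d x))\<^sup>2"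
    "\<And>x. x \<in> U \<inter> U' \<Longrightarrow> d x \<noteq> 0"
    using transition_norm_holo[OF F e] by blast
  note C = chart_facts[OF c]
  define W where "W = z ` (U \<inter> U' \<inter> V)"
  have W: "open W" unfolding W_def by (rule C(9)) (use C(1) frameD(1)[OF e(1)] frameD(1)[OF e(2)] in auto)
  have zx: "z x \<in> W" using x by (auto simp: W_def)
  have inv: "inv_into V z q \<in> U \<inter> U'" if "q \<in> W" for q using that C(4) by (auto simp: W_def)
  have hol: "(\<lambda>q. d (inv_into V z q)) holomorphic_on W"
    using holo_funD[OF d(1) c, of "U \<inter> U' \<inter> V"] by (simp add: W_def o_def)
  have C2: "C2_on W (\<lambda>q. ln (h U e (inv_into V z q)))"
  proof -
    have "C2_fun U (\<lambda>x. ln (h U e x))"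
      using C2_fun_ln[OF frameD(1)[OF e(1)] det_metricD(2)[OF F h e(1)]] det_metricD(1)[OF F h e(1)] by blast
    then have "C2_on W ((\<lambda>x. ln (h U e x)) \<circ> inv_into V z)"
      unfolding W_def by (rule C2_funD[OF _ c]) (use C(1) frameD(1)[OF e(1)] frameD(1)[OF e(2)] in auto)
    then show ?thesis by (simp add: o_def)
  qed
  have C2d: "C2_on W (\<lambda>q. ln ((cmod (d (inv_into V z q)))\<^sup>2))"
    by (rule C2_on_ln[OF W C2_on_norm_square_holo[OF hol W]]) (use d(3) inv in auto)
  have "laplacian (\<lambda>q. ln (h U' e' (inv_into V z q))) (z x) =
    laplacian (\<lambda>q. ln ((cmod (d (inv_into V z q)))\<^sup>2) + ln (h U e (inv_into V z q))) (z x)"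
  proof (rule laplacian_cong[OF C2_on_add[OF W C2d C2] W zx, symmetric])
    fix q assume q: "q \<in> W"
    have i: "inv_into V z q \<in> U" "inv_into V z q \<in> U'" "inv_into V z q \<in> U \<inter> U'" using inv[OF q] by auto
    show "ln ((cmod (d (inv_into V z q)))\<^sup>2) + ln (h U e (inv_into V z q)) = ln (h U' e' (inv_into V z q))"
      unfolding det_metricD(3)[OF F h e i(1,2)] d(2)[OF i(3)]
      using d(3)[OF i(3)] det_metricD(1)[OF F h e(1) i(1)] by (subst ln_mult) auto
  qed
  also have "\<dots> = laplacian (\<lambda>q. ln ((cmod (d (inv_into V z q)))\<^sup>2)) (z x) +
      laplacian (\<lambda>q. ln (h U e (inv_into V z q))) (z x)"
    by (rule laplacian_add[OF W zx C2d C2])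
  also have "laplacian (\<lambda>q. ln ((cmod (d (inv_into V z q)))\<^sup>2)) (z x) = 0"
    by (rule laplacian_ln_norm_square_holo[OF hol W zx]) (use d(3) inv in auto)
  finally show ?thesis by simp
qed

lemma chern_form_eq:
  fixes F :: "'a::riemann_surface sheaf"
  assumes F: "module_sheaf F" and h: "det_metric F h" and e: "frame (rk F) F U e"
    and c: "(V, z) \<in> charts" and x: "x \<in> U" "x \<in> V"
  shows "chern_form F h (V, z) (z x) = - (1 / (4 * pi)) * laplacian (\<lambda>q. ln (h U e (inv_into V z q))) (z x)"
  unfolding chern_form_def prod.case
proof (rule the_equality)
  have i: "inv_into V z (z x) = x" using chart_facts(4)[OF c x(2)] .
  show "\<exists>U' e'. frame (rk F) F U' e' \<and> inv_into V z (z x) \<in> U' \<and>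
      - (1 / (4 * pi)) * laplacian (\<lambda>q. ln (h U e (inv_into V z q))) (z x) =
      - (1 / (4 * pi)) * laplacian (\<lambda>q. ln (h U' e' (inv_into V z q))) (z x)"
    using e x i by (intro exI[of _ U] exI[of _ e]) simp
  fix c'
  assume "\<exists>U' e'. frame (rk F) F U' e' \<and> inv_into V z (z x) \<in> U' \<and>
      c' = - (1 / (4 * pi)) * laplacian (\<lambda>q. ln (h U' e' (inv_into V z q))) (z x)"
  then obtain U' e' where e': "frame (rk F) F U' e'" "x \<in> U'"
    "c' = - (1 / (4 * pi)) * laplacian (\<lambda>q. ln (h U' e' (inv_into V z q))) (z x)" using i by auto
  show "c' = - (1 / (4 * pi)) * laplacian (\<lambda>q. ln (h U e (inv_into V z q))) (z x)"
    unfolding e'(3) laplacian_ln_transition[OF F h e e'(1) c x(1) e'(2) x(2)] ..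
qed

lemma two_form_chern_form:
  fixes F :: "'a::riemann_surface sheaf"
  assumes F: "vector_bundle F" and h: "det_metric F h"
  shows "two_form (chern_form F h)"
  unfolding two_form_def
proof (intro conjI allI impI; (elim conjE)?)
  note mF = vector_bundleD(1)[OF F]
  have ln: "C2_fun U (\<lambda>x. ln (h U e x))" if "frame (rk F) F U e" for U e
    using C2_fun_ln[OF frameD(1)[OF that] det_metricD(2)[OF mF h that]] det_metricD(1)[OF mF h that] by blast
  fix V and z :: "'a \<Rightarrow> complex" assume c: "(V, z) \<in> charts"
  note C = chart_facts[OF c]
  have "isCont (chern_form F h (V, z)) p" if p: "p \<in> z ` V" for p
  proof -
    obtain x where x: "x \<in> V" "p = z x" using p by blast
    obtain U e where e: "x \<in> U" "frame (rk F) F U e" using vector_bundleD(3)[OF F] by blast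
    define W where "W = z ` (U \<inter> V)"
    have W: "open W" unfolding W_def by (rule C(9)) (use C(1) frameD(1)[OF e(2)] in auto)
    have "C2_on W (\<lambda>q. ln (h U e (inv_into V z q)))" using C2_funD'[OF ln[OF e(2)] c] by (simp add: W_def)
    then have "continuous_on W (\<lambda>q. - (1 / (4 * pi)) * laplacian (\<lambda>q. ln (h U e (inv_into V z q))) q)"
      by (intro continuous_on_mult continuous_on_const laplacian_continuous[OF W])
    then have "continuous_on W (chern_form F h (V, z))"
      by (rule continuous_on_eq) (use chern_form_eq[OF mF h e(2) c] in \<open>auto simp: W_def\<close>)
    then show ?thesis using W x e(1) continuous_on_eq_continuous_at unfolding W_def by blast
  qed
  then show "continuous_on (z ` V) (chern_form F h (V, z))"
    by (rule continuous_at_imp_continuous_on[rule_format])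
  fix W x and w :: "'a \<Rightarrow> complex" assume d: "(W, w) \<in> charts" and x: "x \<in> V \<inter> W"
  obtain U e where e: "x \<in> U" "frame (rk F) F U e" using vector_bundleD(3)[OF F] by blast
  have "laplacian (\<lambda>q. ln (h U e (inv_into V z q))) (z x) =
      (cmod (deriv (w \<circ> inv_into V z) (z x)))\<^sup>2 * laplacian (\<lambda>q. ln (h U e (inv_into W w q))) (w x)"
    by (rule laplacian_chart_change[OF frameD(1)[OF e(2)] ln[OF e(2)] c d]) (use e x in auto)
  then show "chern_form F h (V, z) (z x) =
      (cmod (deriv (w \<circ> inv_into V z) (z x)))\<^sup>2 * chern_form F h (W, w) (w x)"
    using chern_form_eq[OF mF h e(2) c e(1)] chern_form_eq[OF mF h e(2) d e(1)] x by simp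
qed

text \<open>The quotient of two metrics is a global positive function, and its logarithm is of class
  C2. So the Chern forms differ by a multiple of a Laplacian, whose integral is zero.\<close>

lemma degree_unique:
  fixes F :: "'a::compact_riemann_surface sheaf"
  assumes F: "vector_bundle F" and h: "det_metric F h" and h': "det_metric F h'"
  shows "surface_integral (chern_form F h') = surface_integral (chern_form F h)"
proof -
  note mF = vector_bundleD(1)[OF F]
  have "\<exists>p. x \<in> fst p \<and> frame (rk F) F (fst p) (snd p)" for x :: 'a
    using vector_bundleD(3)[OF F, of x] by (metis fst_conv snd_conv)
  then obtain p where p: "\<And>x. x \<in> fst (p x)" "\<And>x. frame (rk F) F (fst (p x)) (snd (p x))" by metis
  \<comment> \<open>Read off in a frame chosen at each point; any other frame gives the same value
    since both metrics change by the same factor.\<close>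
  define u where "u = (\<lambda>x. ln (h' (fst (p x)) (snd (p x)) x) + (-1) * ln (h (fst (p x)) (snd (p x)) x))"
  have u: "u x = ln (h' U e x) + (-1) * ln (h U e x)" if e: "frame (rk F) F U e" and x: "x \<in> U" for U e x
    unfolding det_metricD(3)[OF mF h p(2) e p(1) x] det_metricD(3)[OF mF h' p(2) e p(1) x] u_def
    using transition_norm_pos[OF mF p(2) e p(1) x] det_metricD(1)[OF mF h p(2) p(1), of x]
      det_metricD(1)[OF mF h' p(2) p(1), of x]
    by (simp add: ln_mult)
  have ln: "C2_fun U (\<lambda>x. ln (k U e x))" if "frame (rk F) F U e" "det_metric F k" for U e k
    using C2_fun_ln[OF frameD(1)[OF that(1)] det_metricD(2)[OF mF that(2,1)]] det_metricD(1)[OF mF that(2,1)] by blast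
  have "C2_fun UNIV u"
  proof (rule C2_fun_local[OF open_UNIV])
    fix x
    note e = p(2)[of x] and U = frameD(1)[OF p(2)[of x]]
    have "C2_fun (fst (p x)) u"
      by (rule C2_fun_cong[OF C2_fun_add[OF U ln[OF e h'] C2_fun_mult[OF U C2_fun_const[OF U] ln[OF e h]]] U])
        (rule u[OF e, symmetric])
    then show "\<exists>T. open T \<and> x \<in> T \<and> T \<subseteq> UNIV \<and> C2_fun T u" using U p(1) by blast
  qed
  note C2 = this
  have eq: "chern_form F h' (V, z) (z x) = chern_form F h (V, z) (z x) + - (1 / (4 * pi)) * laplacian_form u (V, z) (z x)"
    if c: "(V, z) \<in> charts" and x: "x \<in> V" for V x and z :: "'a \<Rightarrow> complex"
  proof -
    obtain U e where xU: "x \<in> U" and e: "frame (rk F) F U e" using p by blast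
    note C = chart_facts[OF c]
    define W where "W = z ` (U \<inter> V)"
    have W: "open W" unfolding W_def by (rule C(9)) (use C(1) frameD(1)[OF e] in auto)
    have zx: "z x \<in> W" using x xU by (auto simp: W_def)
    have C2h: "C2_on W (\<lambda>q. ln (h U e (inv_into V z q)))" "C2_on W (\<lambda>q. ln (h' U e (inv_into V z q)))"
      using C2_funD'[OF ln[OF e h] c] C2_funD'[OF ln[OF e h'] c] by (simp_all add: W_def)
    have C2m: "C2_on W (\<lambda>q. (-1) * ln (h U e (inv_into V z q)))"
      by (rule C2_on_mult[OF W C2_on_const[OF W] C2h(1)])
    have "laplacian_form u (V, z) (z x) =
        laplacian (\<lambda>q. ln (h' U e (inv_into V z q)) + (-1) * ln (h U e (inv_into V z q))) (z x)"
      unfolding laplacian_form_def fst_conv snd_conv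
    proof (rule laplacian_cong[OF C2_on_add[OF W C2h(2) C2m] W zx, symmetric])
      fix q assume "q \<in> W"
      then have "inv_into V z q \<in> U" using C(4) by (auto simp: W_def)
      then show "ln (h' U e (inv_into V z q)) + - 1 * ln (h U e (inv_into V z q)) = u (inv_into V z q)"
        using u[OF e] by metis
    qed
    also have "\<dots> = laplacian (\<lambda>q. ln (h' U e (inv_into V z q))) (z x) - laplacian (\<lambda>q. ln (h U e (inv_into V z q))) (z x)"
      unfolding laplacian_add[OF W zx C2h(2) C2m] laplacian_cmult[OF W zx C2h(1)] by simp
    finally have l: "laplacian_form u (V, z) (z x) =
      laplacian (\<lambda>q. ln (h' U e (inv_into V z q))) (z x) - laplacian (\<lambda>q. ln (h U e (inv_into V z q))) (z x)" .
    show ?thesis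
      unfolding chern_form_eq[OF mF h e c xU x] chern_form_eq[OF mF h' e c xU x] l
      by (simp add: diff_divide_distrib)
  qed
  note t = two_form_chern_form[OF F h] and t' = two_form_chern_form[OF F h'] and tu = two_form_laplacian[OF C2]
  note tm = surface_integral_cmult(2)[OF tu, of "- (1 / (4 * pi))"]
  have "surface_integral (chern_form F h') =
      surface_integral (\<lambda>c p. chern_form F h c p + - (1 / (4 * pi)) * laplacian_form u c p)"
    by (rule surface_integral_cong[OF eq t' surface_integral_add(2)[OF t tm]])
  also have "\<dots> = surface_integral (chern_form F h)"
    unfolding surface_integral_add(1)[OF t tm] surface_integral_cmult(1)[OF tu] surface_integral_laplacian[OF C2] by simp
  finally show ?thesis .
qed

lemma degree_eq:
  fixes F :: "'a::compact_riemann_surface sheaf"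
  assumes F: "vector_bundle F" and h: "det_metric F h"
  shows "degree F = surface_integral (chern_form F h)"
  unfolding degree_def by (rule the_equality) (use h degree_unique[OF F h] in blast)+

theorem degree_ker_im:
  fixes F G :: "'a::compact_riemann_surface sheaf"
  assumes F: "vector_bundle F" and G: "vector_bundle G" and \<phi>: "sheaf_hom F G \<phi>"
  shows "degree F = degree (ker_sheaf F \<phi>) + degree (im_sheaf F G \<phi>)"
proof -
  note mF = vector_bundleD(1)[OF F] and mG = vector_bundleD(1)[OF G]
  define N I where "N = ker_sheaf F \<phi>" and "I = im_sheaf F G \<phi>"
  note KI = ker_im_vector_bundle[OF F G \<phi>, folded N_def I_def]
  note mN = vector_bundleD(1)[OF KI(1)] and mI = vector_bundleD(1)[OF KI(2)]
  define r c where "r = rk F" and "c = rk I"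
  have rc: "rk N = r - c" "c \<le> r" using KI(3) by (auto simp: r_def c_def)
  obtain hN where hN: "det_metric N hN" using det_metric_exists[OF KI(1)] by blast
  obtain hI where hI: "det_metric I hI" using det_metric_exists[OF KI(2)] by blast
  define S where "S = adapted_frame F \<phi> r c"
  have fr: "frame r F U e" and frN: "frame (rk N) N U (\<lambda>i. e (c + i))" and frI: "frame (rk I) I U (\<lambda>j. \<phi> U (e j))"
    if "S U e" for U e
    using adapted_frameD(1)[OF that[unfolded S_def]] ker_frame[OF mF \<phi> that[unfolded S_def], folded N_def rc(1)]
      im_frame[OF mF mG \<phi> that[unfolded S_def], folded I_def] by (simp_all only: c_def)
  \<comment> \<open>The determinant of the source is the product of the determinants of kernel and
    image. On adapted frames the lengths can simply be multiplied.\<close>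
  define \<kappa> where "\<kappa> = (\<lambda>U e x. hN U (\<lambda>i. e (c + i)) x * hI U (\<lambda>j. \<phi> U (e j)) x)"
  have "\<exists>U e. S U e \<and> x \<in> U" for x
    using KI(5)[of x] unfolding S_def r_def c_def by blast
  then obtain hF where hF: "det_metric F hF" "\<And>U e x. S U e \<Longrightarrow> x \<in> U \<Longrightarrow> hF U e x = \<kappa> U e x"
  proof (rule det_metric_extend[OF F, where S = S and \<kappa> = \<kappa>, rotated])
    fix U e assume S: "S U e"
    show "\<kappa> U e x > 0" if "x \<in> U" for x
      using det_metricD(1)[OF mN hN frN[OF S] that] det_metricD(1)[OF mI hI frI[OF S] that] by (simp add: \<kappa>_def)
    show "C2_fun U (\<kappa> U e)" unfolding \<kappa>_def
      by (rule C2_fun_mult[OF frameD(1)[OF fr[OF S]] det_metricD(2)[OF mN hN frN[OF S]] det_metricD(2)[OF mI hI frI[OF S]]])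
    fix U' e' x assume S': "S U' e'" and x: "x \<in> U" "x \<in> U'"
    note e = fr[OF S] and e' = fr[OF S']
    define W where "W = U \<inter> U'"
    have W: "open W" "W \<subseteq> U" "W \<subseteq> U'" "x \<in> W" using frameD(1)[OF e] frameD(1)[OF e'] x by (auto simp: W_def)
    obtain A where A: "transition W r r e e' A" using transition_frames[OF mF e e' W(1-3)] by blast
    note aS = S[unfolded S_def] and aS' = S'[unfolded S_def]
    have im: "\<phi> U' (e' j) y k = (\<Sum>i<c. A i j y * \<phi> U (e i) y k)" if j: "j < r" and y: "y \<in> W" for j y k
    proof -
      have eF: "e' j \<in> F U'" using frameD(2)[OF e' j] .
      have "\<phi> W (restr W (e' j)) y k = (\<Sum>i<c. A i j y * \<phi> U (e i) y k)"
        by (rule adapted_frame_image[OF mF \<phi> aS W(1,2) module_sheafD(5)[OF mF frameD(1)[OF e'] W(1,3) eF] _ _ y])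
          (use transitionD[OF A j] in \<open>auto simp: restr_apply\<close>)
      then show ?thesis
        using sheaf_homD(4)[OF \<phi> frameD(1)[OF e'] eF W(1,3)] y by (simp add: restr_apply)
    qed
    \<comment> \<open>The last sections of \<open>e'\<close> lie in the kernel, so they have no
      components along the first \<open>c\<close> sections of \<open>e\<close>. This is the zero
      block that makes the determinant multiplicative.\<close>
    have z: "A i j y = 0" if j: "c \<le> j" "j < r" and i: "i < c" and y: "y \<in> W" for i j y
    proof (rule adapted_frame_indep[OF aS W(1,2), where f = "\<lambda>i. A i j"])
      show "(\<Sum>i<c. A i j y * \<phi> U (e i) y k) = 0" if "y \<in> W" for y k
        using im[OF j(2) that, of k] adapted_frameD(3)[OF aS' j] by (simp only: zero_fun_apply)
      show "holo_fun W (A i j)" if "i < c" for i using transitionD(1)[OF A j(2)] that rc(2) by simp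
    qed (use i y in auto)
    have tI: "transition W (rk I) (rk I) (\<lambda>j. \<phi> U (e j)) (\<lambda>j. \<phi> U' (e' j)) A"
      by (rule transitionI) (use im transitionD(1)[OF A] rc(2) in \<open>auto simp: c_def[symmetric]\<close>)
    have tN: "transition W (rk N) (rk N) (\<lambda>i. e (c + i)) (\<lambda>i. e' (c + i)) (\<lambda>i j. A (c + i) (c + j))"
      unfolding rc(1)
    proof (rule transitionI)
      show "e' (c + j) y k = (\<Sum>i<r - c. A (c + i) (c + j) y * e (c + i) y k)" if j: "j < r - c" and y: "y \<in> W" for j y k
      proof -
        have j': "c + j < r" using j by simp
        show ?thesis
          unfolding transitionD(2)[OF A j' y] sum_split_at[OF rc(2), of "\<lambda>i. A i (c + j) y * e i y k"]
          using z[OF le_add1 j' _ y] by simp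
      qed
    qed (use transitionD(1)[OF A] in auto)
    have det: "det_at r A x = det_at (rk I) A x * det_at (rk N) (\<lambda>i j. A (c + i) (c + j)) x"
      unfolding rc(1) c_def[symmetric] by (rule det_at_block[OF rc(2)]) (use z W(4) in auto)
    show "\<kappa> U' e' x = transition_norm (rk F) U e U' e' x * \<kappa> U e x"
      unfolding \<kappa>_def r_def[symmetric] transition_norm_eq[OF mF e e' W A] det
        det_metricD(3)[OF mN hN frN[OF S] frN[OF S'] x] det_metricD(3)[OF mI hI frI[OF S] frI[OF S'] x]
        transition_norm_eq[OF mN frN[OF S] frN[OF S'] W tN] transition_norm_eq[OF mI frI[OF S] frI[OF S'] W tI]
      by (simp add: norm_mult power_mult_distrib)
  qed (use fr in \<open>auto simp: r_def\<close>)
  have eq: "chern_form F hF (V, z) (z x) = chern_form N hN (V, z) (z x) + chern_form I hI (V, z) (z x)"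
    if ch: "(V, z) \<in> charts" and x: "x \<in> V" for V x and z :: "'a \<Rightarrow> complex"
  proof -
    obtain U e where S: "S U e" and xU: "x \<in> U" using KI(5)[of x] unfolding S_def r_def c_def by blast
    note C = chart_facts[OF ch] and U = frameD(1)[OF fr[OF S]]
    define W where "W = z ` (U \<inter> V)"
    have W: "open W" unfolding W_def by (rule C(9)) (use C(1) U in auto)
    have zx: "z x \<in> W" using x xU by (auto simp: W_def)
    have inv: "inv_into V z q \<in> U" if "q \<in> W" for q using that C(4) by (auto simp: W_def)
    have C2N: "C2_on W (\<lambda>q. ln (hN U (\<lambda>i. e (c + i)) (inv_into V z q)))"
      using C2_funD'[OF C2_fun_ln[OF U det_metricD(2)[OF mN hN frN[OF S]] det_metricD(1)[OF mN hN frN[OF S]]] ch]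
      by (simp add: W_def)
    have C2I: "C2_on W (\<lambda>q. ln (hI U (\<lambda>j. \<phi> U (e j)) (inv_into V z q)))"
      using C2_funD'[OF C2_fun_ln[OF U det_metricD(2)[OF mI hI frI[OF S]] det_metricD(1)[OF mI hI frI[OF S]]] ch]
      by (simp add: W_def)
    have "laplacian (\<lambda>q. ln (hF U e (inv_into V z q))) (z x) =
      laplacian (\<lambda>q. ln (hN U (\<lambda>i. e (c + i)) (inv_into V z q)) + ln (hI U (\<lambda>j. \<phi> U (e j)) (inv_into V z q))) (z x)"
    proof (rule laplacian_cong[OF C2_on_add[OF W C2N C2I] W zx, symmetric])
      fix q assume "q \<in> W"
      note i = inv[OF this]
      show "ln (hN U (\<lambda>i. e (c + i)) (inv_into V z q)) + ln (hI U (\<lambda>j. \<phi> U (e j)) (inv_into V z q)) =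
          ln (hF U e (inv_into V z q))"
        unfolding hF(2)[OF S i] \<kappa>_def
        using det_metricD(1)[OF mN hN frN[OF S] i] det_metricD(1)[OF mI hI frI[OF S] i] by (simp add: ln_mult)
    qed
    then show ?thesis
      unfolding chern_form_eq[OF mF hF(1) fr[OF S, unfolded r_def] ch xU x] chern_form_eq[OF mN hN frN[OF S] ch xU x]
        chern_form_eq[OF mI hI frI[OF S] ch xU x] laplacian_add[OF W zx C2N C2I] by (simp add: add_divide_distrib)
  qed
  note tF = two_form_chern_form[OF F hF(1)] and tN = two_form_chern_form[OF KI(1) hN] and tI = two_form_chern_form[OF KI(2) hI]
  have "surface_integral (chern_form F hF) = surface_integral (\<lambda>c p. chern_form N hN c p + chern_form I hI c p)"
    by (rule surface_integral_cong[OF eq tF surface_integral_add(2)[OF tN tI]])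
  then show ?thesis
    unfolding degree_eq[OF F hF(1)] N_def[symmetric] I_def[symmetric] degree_eq[OF KI(1) hN] degree_eq[OF KI(2) hI]
      surface_integral_add(1)[OF tN tI] .
qed

section \<open>Inequalities for semistable chains\<close>

lemma frame_agree:
  assumes "\<And>U. open U \<Longrightarrow> F U = E U"
  shows "frame r F = frame r E"
  by (intro ext) (auto simp: frame_def assms)

text \<open>Rank and degree are read off frames, and frames only look at open sets; values of a
  sheaf at other sets are arbitrary.\<close>

lemma agree_rk_degree:
  fixes F E :: "'a::compact_riemann_surface sheaf"
  assumes F: "vector_bundle F" and E: "vector_bundle E" and eq: "\<And>U. open U \<Longrightarrow> F U = E U"
  shows "rk F = rk E" "degree F = degree E"
proof -
  have fr: "frame r F = frame r E" for r using frame_agree eq by blast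
  obtain U e where e: "(undefined::'a) \<in> U" "frame (rk F) F U e" using vector_bundleD(3)[OF F] by blast
  show r: "rk F = rk E" using rk_eq_frame[OF E e(2)[unfolded fr] e(1)] by simp
  show "degree F = degree E"
    unfolding degree_def det_metric_def chern_form_def fr r ..
qed

lemma sheaf_hom_id: "sheaf_hom E E (\<lambda>U s. s)"
  by (simp add: sheaf_hom_def)

text \<open>This is the zero sheaf used in subchains. Additivity gives rank and degree 0 without a
  separate computation, because the image of the identity agrees with \<open>E\<close> on open
  sets.\<close>

lemma ker_id_bundle:
  fixes E :: "'a::compact_riemann_surface sheaf"
  assumes E: "vector_bundle E"
  defines "Z \<equiv> ker_sheaf E (\<lambda>U s. s)"
  shows "vector_bundle Z" "rk Z = 0" "degree Z = 0" "open U \<Longrightarrow> Z U = {0}"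
proof -
  note KI = ker_im_vector_bundle[OF E E sheaf_hom_id]
  note mE = vector_bundleD(1)[OF E]
  show Z: "vector_bundle Z" unfolding Z_def by (rule KI(1))
  have "im_sheaf E E (\<lambda>U s. s) U = E U" if U: "open U" for U
  proof
    show "im_sheaf E E (\<lambda>U s. s) U \<subseteq> E U" by (rule im_sheaf_subset)
    show "E U \<subseteq> im_sheaf E E (\<lambda>U s. s) U" using im_sheaf_image[OF mE sheaf_hom_id U] by blast
  qed
  note agree = agree_rk_degree[OF KI(2) E this]
  show "rk Z = 0" using KI(3) agree(1) by (simp add: Z_def)
  show "degree Z = 0" using degree_ker_im[OF E E sheaf_hom_id] agree(2) by (simp add: Z_def)
  show "Z U = {0}" if U: "open U"
  proof
    show "Z U \<subseteq> {0}" unfolding Z_def ker_sheaf_def by blast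
    show "{0} \<subseteq> Z U" using module_sheafD(1)[OF mE U] unfolding Z_def ker_sheaf_def by blast
  qed
qed

lemma sections_eq_0_if_rk_0:
  assumes E: "vector_bundle E" and r: "rk E = 0" and U: "open U"
  shows "E U = {0}"
proof -
  note mE = vector_bundleD(1)[OF E]
  have "s = 0" if s: "s \<in> E U" for s
  proof (rule sect_eq_0I[OF mE U s])
    fix x assume x: "x \<in> U"
    obtain V e where V: "x \<in> V" "frame 0 E V e" using vector_bundleD(3)[OF E] r by metis
    have W: "open (U \<inter> V)" "U \<inter> V \<subseteq> V" "U \<inter> V \<subseteq> U" using U frameD(1)[OF V(2)] by auto
    obtain f where "\<And>y k. y \<in> U \<inter> V \<Longrightarrow> restr (U \<inter> V) s y k = (\<Sum>i<0. f i y * e i y k)"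
      using frame_coeffs[OF V(2) W(1,2) module_sheafD(5)[OF mE U W(1,3) s]] by metis
    then have "restr (U \<inter> V) s = 0" by (auto simp: restr_def fun_eq_iff)
    then show "\<exists>V. x \<in> V \<and> restr V s = 0" using x V(1) by blast
  qed
  then show ?thesis using module_sheafD(1)[OF mE U] by blast
qed

lemma sum_3: "(\<Sum>j<3. h j) = h 0 + h 1 + h 2" for h :: "nat \<Rightarrow> 'b::comm_monoid_add"
  by (simp add: numeral_3_eq_3 numeral_2_eq_2 add.assoc)

lemma all_less_3: "(\<forall>j<3. P j) \<longleftrightarrow> P 0 \<and> P 1 \<and> P (2::nat)"
  by (auto simp: numeral_3_eq_3 numeral_2_eq_2 less_Suc_eq)

text \<open>Clearing denominators also covers the excluded subchains \<open>0\<close> and \<open>E\<close>.\<close>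

lemma semistable_chainD:
  fixes E F :: "nat \<Rightarrow> 'a::compact_riemann_surface sheaf"
  assumes E: "holomorphic_chain E \<phi>" and ss: "semistable_chain \<alpha> E \<phi>" and F: "subchain F E \<phi>"
    and r: "(\<Sum>j<3. rk (E j)) > 0"
  shows "(\<Sum>j<3. degree (F j) + (\<alpha> j - slope \<alpha> E) * real (rk (F j))) \<le> 0"
proof -
  have vE: "vector_bundle (E j)" if "j < 3" for j using E that by (simp add: holomorphic_chain_def)
  have vF: "vector_bundle (F j)" if "j < 3" for j using F that by (simp add: subchain_def)
  have eq: "(\<Sum>j<3. degree (F j) + (\<alpha> j - slope \<alpha> E) * real (rk (F j))) =
      (\<Sum>j<3. degree (F j) + \<alpha> j * real (rk (F j))) - slope \<alpha> E * real (\<Sum>j<3. rk (F j))" for F :: "nat \<Rightarrow> 'a sheaf"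
    by (simp add: sum_3 algebra_simps)
  have sl: "slope \<alpha> F * real (\<Sum>j<3. rk (F j)) = (\<Sum>j<3. degree (F j) + \<alpha> j * real (rk (F j)))"
    if "(\<Sum>j<3. rk (F j)) > 0" for F :: "nat \<Rightarrow> 'a sheaf"
  proof -
    have "real (\<Sum>j<3. rk (F j)) \<noteq> 0" using that by linarith
    then show ?thesis unfolding slope_def by (rule nonzero_eq_divide_eq[THEN iffD1, OF _ refl])
  qed
  consider "\<forall>j<3. \<forall>U. open U \<longrightarrow> F j U = {0}" | "\<forall>j<3. \<forall>U. open U \<longrightarrow> F j U = E j U"
    | "\<exists>j<3. \<exists>U. open U \<and> F j U \<noteq> {0}" "\<exists>j<3. \<exists>U. open U \<and> F j U \<noteq> E j U" by blast
  then show ?thesis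
  proof cases
    case 1
    have "rk (F j) = 0 \<and> degree (F j) = 0" if j: "j < 3" for j
    proof -
      note Z = ker_id_bundle[OF vF[OF j]]
      have "F j U = ker_sheaf (F j) (\<lambda>U s. s) U" if "open U" for U
        using 1 j that Z(4)[OF that] by simp
      from agree_rk_degree[OF vF[OF j] Z(1) this] show ?thesis using Z(2,3) by simp
    qed
    then show ?thesis by (simp add: sum_3)
  next
    case 2
    have "rk (F j) = rk (E j) \<and> degree (F j) = degree (E j)" if j: "j < 3" for j
      using agree_rk_degree[OF vF[OF j] vE[OF j]] 2 j by blast
    then have "(\<Sum>j<3. degree (F j) + (\<alpha> j - slope \<alpha> E) * real (rk (F j))) =
        (\<Sum>j<3. degree (E j) + (\<alpha> j - slope \<alpha> E) * real (rk (E j)))" by simp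
    then show ?thesis unfolding eq sl[OF r, symmetric] by simp
  next
    case 3
    have le: "slope \<alpha> F \<le> slope \<alpha> E" using ss F 3 unfolding semistable_chain_def by blast
    obtain j U where j: "j < 3" "open U" "F j U \<noteq> {0}" using 3(1) by blast
    then have "rk (F j) > 0" using sections_eq_0_if_rk_0[OF vF[OF j(1)] _ j(2)] by blast
    then have pos: "(\<Sum>j<3. rk (F j)) > 0" using j(1) by (meson finite_lessThan lessThan_iff sum_pos2 zero_le)
    show ?thesis unfolding eq sl[OF pos, symmetric]
      using mult_right_mono[OF le of_nat_0_le_iff, of "\<Sum>j<3. rk (F j)"] by linarith
  qed
qed

lemma semistable_chain_inequality:
  fixes E :: "nat \<Rightarrow> 'a::compact_riemann_surface sheaf"
  assumes E: "holomorphic_chain E \<phi>" and ss: "semistable_chain \<alpha> E \<phi>" and r: "(\<Sum>j<3. rk (E j)) > 0"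
    and F: "vector_bundle F0" "vector_bundle F1" "vector_bundle F2"
    and sub: "\<And>U. open U \<Longrightarrow> F0 U \<subseteq> E 0 U" "\<And>U. open U \<Longrightarrow> F1 U \<subseteq> E 1 U" "\<And>U. open U \<Longrightarrow> F2 U \<subseteq> E 2 U"
    and map: "\<And>U s. open U \<Longrightarrow> s \<in> F1 U \<Longrightarrow> \<phi> 1 U s \<in> F0 U" "\<And>U s. open U \<Longrightarrow> s \<in> F2 U \<Longrightarrow> \<phi> 2 U s \<in> F1 U"
  shows "degree F0 + (\<alpha> 0 - slope \<alpha> E) * real (rk F0) + (degree F1 + (\<alpha> 1 - slope \<alpha> E) * real (rk F1)) +
    (degree F2 + (\<alpha> 2 - slope \<alpha> E) * real (rk F2)) \<le> 0"
proof -
  define F where "F = (\<lambda>j::nat. if j = 0 then F0 else if j = 1 then F1 else F2 :: 'a sheaf)"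
  have "subchain F E \<phi>"
    unfolding subchain_def all_less_3 using F sub map by (auto simp: F_def)
  from semistable_chainD[OF E ss this r] show ?thesis by (simp add: sum_3 F_def)
qed

text \<open>Here \<open>b\<^sub>j = \<alpha>\<^sub>j - \<mu>\<close>, while \<open>a1, a2, a\<close> are the ranks and \<open>x, y, z\<close> the degrees of the images of
  \<open>\<phi>\<^sub>1, \<phi>\<^sub>2, \<phi>\<^sub>1\<phi>\<^sub>2\<close>. The inequalities \<open>S1, \<dots>, S8\<close> come from the subchains \<open>(E\<^sub>0,0,0)\<close>, \<open>(E\<^sub>0,E\<^sub>1,0)\<close>,
  \<open>(0,0,ker \<phi>\<^sub>2)\<close>, \<open>(0,ker \<phi>\<^sub>1,0)\<close>, \<open>(im \<phi>\<^sub>1,E\<^sub>1,E\<^sub>2)\<close>, \<open>(E\<^sub>0,im \<phi>\<^sub>2,E\<^sub>2)\<close>, \<open>(0,ker \<phi>\<^sub>1,ker \<phi>\<^sub>1\<phi>\<^sub>2)\<close>,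
  \<open>(im \<phi>\<^sub>1\<phi>\<^sub>2,im \<phi>\<^sub>2,E\<^sub>2)\<close>, in this order.\<close>

lemma parameter_bound:
  fixes r0 r1 r2 a1 a2 a :: nat and d0 d1 d2 b0 b1 b2 x y z M K L C Q :: real
  assumes pos: "r0 > 0" "r1 > 0" "r2 > 0" and ne: "r0 \<noteq> r1" "r1 \<noteq> r2" "\<not> (r0 = r2 \<and> r0 \<le> r1)"
    and a: "a1 \<le> r0" "a1 \<le> r1" "a2 \<le> r1" "a2 \<le> r2" "a \<le> r0" "a \<le> r2"
    and M: "M = \<bar>d0\<bar> + \<bar>d1\<bar> + \<bar>d2\<bar>"
    and tot: "d0 + d1 + d2 + b0 * r0 + b1 * r1 + b2 * r2 = 0"
    and S1: "d0 + b0 * r0 \<le> 0"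
    and S2: "d0 + b0 * r0 + (d1 + b1 * r1) \<le> 0"
    and S3: "(d2 - y) + b2 * (real r2 - real a2) \<le> 0"
    and S4: "(d1 - x) + b1 * (real r1 - real a1) \<le> 0"
    and S5: "x + b0 * a1 + (d1 + b1 * r1) + (d2 + b2 * r2) \<le> 0"
    and S6: "d0 + b0 * r0 + (y + b1 * a2) + (d2 + b2 * r2) \<le> 0"
    and S7: "(d1 - x) + b1 * (real r1 - real a1) + ((d2 - z) + b2 * (real r2 - real a)) \<le> 0"
    and S8: "z + b0 * a + (y + b1 * a2) + (d2 + b2 * r2) \<le> 0"
  defines "K \<equiv> M * (1 + real r0 + real r2)"
  defines "L \<equiv> M + real r1 * K"
  defines "C \<equiv> 10 * L"
  defines "Q \<equiv> L + r0 * C + r2 * (r0 * M + C) + r0 * M + C + M"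
  shows "\<bar>b1\<bar> \<le> K" "\<bar>b0\<bar> \<le> Q" "\<bar>b2\<bar> \<le> Q"
proof -
  have M0: "M \<ge> 0" "\<bar>d0\<bar> \<le> M" "\<bar>d1\<bar> \<le> M" "\<bar>d2\<bar> \<le> M" "\<bar>d0\<bar> + \<bar>d1\<bar> + \<bar>d2\<bar> \<le> M" using M by auto
  \<comment> \<open>For a factor \<open>t\<close> that is bounded above only and may be very
    negative.\<close>
  have ml: "u * t \<le> R * T" if "0 \<le> u" "u \<le> R" "t \<le> T" "0 \<le> T" for u t R T :: real
    using mult_left_mono[OF that(3,1)] mult_right_mono[OF that(2,4)] by linarith
  have ge1: "t \<le> T" if "1 \<le> u" "u * t \<le> T" "0 \<le> T" for u t T :: real
  proof (cases "t \<le> 0")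
    case False
    then have "t \<le> u * t" using that(1) by simp
    then show ?thesis using that(2) by linarith
  qed (use that in linarith)
  have r1': "real r0 \<ge> 1" "real r1 \<ge> 1" "real r2 \<ge> 1" using pos by auto
  \<comment> \<open>\<open>p\<close>, \<open>u\<close>, \<open>s\<close> are the ranks of the
    kernels of \<phi>1, \<phi>2, \<phi>1 \<phi>2, and \<open>q\<close>, \<open>v\<close>,
    \<open>w\<close> are the coranks of their images.\<close>
  define p where "p = real r1 - real a1"
  define q where "q = real r0 - real a1"
  define u where "u = real r2 - real a2"
  define v where "v = real r1 - real a2"
  define s where "s = real r2 - real a"
  define w where "w = real r0 - real a"
  have rng: "0 \<le> p" "p \<le> r1" "0 \<le> q" "q \<le> r0" "0 \<le> u" "u \<le> r2" "0 \<le> v" "v \<le> r1" "0 \<le> s" "s \<le> r2" "0 \<le> w" "w \<le> r0"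
    using a by (auto simp: p_def q_def u_def v_def s_def w_def)
  have int: "p = 0 \<or> 1 \<le> p" "q = 0 \<or> 1 \<le> q" "u = 0 \<or> 1 \<le> u" "v = 0 \<or> 1 \<le> v" "s = 0 \<or> 1 \<le> s" "w = 0 \<or> 1 \<le> w"
    using a by (auto simp: p_def q_def u_def v_def s_def w_def)
  \<comment> \<open>Each unknown degree is caught between a bound from a kernel and, with
    \<open>tot\<close>, a bound from an image. In the bounds for \<open>z\<close> the degrees
    \<open>x\<close> and \<open>y\<close> occur with signs that let \<open>x2\<close> and
    \<open>y1\<close> remove them.\<close>
  have x1: "d1 + p * b1 \<le> x" using S4 by (simp add: p_def algebra_simps)
  have x2: "x \<le> d0 + q * b0" using S5 tot by (simp add: q_def algebra_simps)
  have y1: "d2 + u * b2 \<le> y" using S3 by (simp add: u_def algebra_simps)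
  have y2: "y \<le> d1 + v * b1" using S6 tot by (simp add: v_def algebra_simps)
  have z1: "d1 - x + p * b1 + d2 + s * b2 \<le> z" using S7 by (simp add: p_def s_def algebra_simps)
  have z2: "z \<le> d0 + d1 - y + w * b0 + v * b1" using S8 tot by (simp add: w_def v_def algebra_simps)
  have T: "d0 + d1 + d2 + r0 * b0 + r1 * b1 + r2 * b2 = 0" "d0 + r0 * b0 \<le> 0" "d0 + r0 * b0 + (d1 + r1 * b1) \<le> 0"
    using tot S1 S2 by (simp_all only: mult.commute)
  have t: "r0 * b0 + r1 * b1 + r2 * b2 \<le> M" "- M \<le> r0 * b0 + r1 * b1 + r2 * b2"
    using T(1) M0(5) by linarith+
  have "r0 * b0 \<le> M" using T(2) M0 by linarith
  then have b0: "b0 \<le> M" using ge1[OF r1'(1)] M0(1) by blast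
  have "r2 * (- b2) \<le> M" using T M0 by (simp only: mult_minus_right; linarith)
  then have b2: "- b2 \<le> M" using ge1[OF r1'(3)] M0(1) by blast
  have KM: "K = M + r0 * M + r2 * M" "M \<le> K" "0 \<le> K" using M0(1) by (auto simp: K_def algebra_simps)
  \<comment> \<open>Compare \<open>x1\<close> with \<open>x2\<close>. If \<open>p = 0\<close>, then
    \<open>q\<close> cannot vanish, as the ranks \<open>r0\<close> and \<open>r1\<close> differ; so
    \<open>b0\<close> is bounded below and the total bounds \<open>b1\<close>. Otherwise
    \<open>b1\<close> is bounded directly.\<close>
  have "b1 \<le> K"
  proof (cases "p = 0")
    case True
    then have "q \<noteq> 0" using ne(1) by (auto simp: p_def q_def)
    then have q1: "1 \<le> q" using int by blast
    have "q * (- b0) \<le> M" using x1 x2 True M0 by (simp add: algebra_simps; linarith)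
    then have "- b0 \<le> M" using ge1[OF q1] M0(1) by blast
    then have "r0 * (- b0) \<le> r0 * M" "r2 * (- b2) \<le> r2 * M"
      using b2 by (simp_all only: mult_left_mono of_nat_0_le_iff)
    then have "r1 * b1 \<le> K" using t KM(1) by (simp only: mult_minus_right; linarith)
    then show ?thesis using ge1[OF r1'(2)] KM by blast
  next
    case False
    then have p1: "1 \<le> p" using int by blast
    have "q * b0 \<le> r0 * M" by (rule ml) (use rng b0 M0 in auto)
    then have "p * b1 \<le> M + r0 * M" using x1 x2 M0(5) by linarith
    also have "\<dots> \<le> K" using KM(1) M0(1) by simp
    finally show ?thesis using ge1[OF p1] KM by blast
  qed
  \<comment> \<open>The mirror image, comparing \<open>y1\<close> with \<open>y2\<close>: \<phi>2
    takes the place of \<phi>1, and \<open>b2\<close> that of \<open>b0\<close>.\<close>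
  moreover have "- b1 \<le> K"
  proof (cases "v = 0")
    case True
    then have "u \<noteq> 0" using ne(2) by (auto simp: u_def v_def)
    then have u1: "1 \<le> u" using int by blast
    have "u * b2 \<le> M" using y1 y2 True M0 by (simp; linarith)
    then have "b2 \<le> M" using ge1[OF u1] M0(1) by blast
    then have "r0 * b0 \<le> r0 * M" "r2 * b2 \<le> r2 * M"
      using b0 by (simp_all only: mult_left_mono of_nat_0_le_iff)
    then have "r1 * (- b1) \<le> K" using t KM(1) by (simp only: mult_minus_right; linarith)
    then show ?thesis using ge1[OF r1'(2)] KM by blast
  next
    case False
    then have v1: "1 \<le> v" using int by blast
    have "u * (- b2) \<le> r2 * M" by (rule ml) (use rng b2 M0 in auto)
    then have "v * (- b1) \<le> M + r2 * M" using y1 y2 M0(5) by (simp add: algebra_simps; linarith)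
    also have "\<dots> \<le> K" using KM(1) M0(1) by simp
    finally show ?thesis using ge1[OF v1] KM by blast
  qed
  ultimately show b1: "\<bar>b1\<bar> \<le> K" by linarith
  \<comment> \<open>\<open>L\<close> covers the degrees together with one product of
    \<open>b1\<close> by a coefficient of size at most \<open>r1\<close>.\<close>
  have L: "0 \<le> L" "M \<le> L" "K \<le> L" "L = M + r1 * K"
    using KM M0(1) r1'(2) mult_right_mono[OF r1'(2) KM(3)] by (auto simp: L_def)
  have C: "L \<le> C" "0 \<le> C" using L(1) unfolding C_def by linarith+
  have bnd: "\<bar>p * b1\<bar> \<le> r1 * K" "\<bar>v * b1\<bar> \<le> r1 * K" "\<bar>r1 * b1\<bar> \<le> r1 * K"
    using rng b1 by (auto simp: abs_mult intro!: mult_mono)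
  have t': "r0 * b0 + r2 * b2 \<le> L" "- L \<le> r0 * b0 + r2 * b2" using t bnd(3) L by linarith+
  have rM: "0 \<le> r0 * M" using M0(1) by simp
  \<comment> \<open>\<open>b0\<close> is bounded above, \<open>b2\<close> below, and
    \<open>r0 * b0 + r2 * b2\<close> on both sides, so a single further bound, on either parameter,
    bounds both.\<close>
  have key: "- b0 \<le> C \<or> b2 \<le> r0 * M + C"
  proof (cases "q = 0 \<and> u = 0")
    case False
    then consider "1 \<le> q" | "1 \<le> u" using int by blast
    then show ?thesis
    proof cases
      case 1
      have "q * (- b0) \<le> L" using x1 x2 bnd(1) L M0 by (simp add: algebra_simps; linarith)
      then have "- b0 \<le> L" using ge1[OF 1] L(1) by blast
      then show ?thesis using C(1) by linarith
    next
      case 2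
      have "u * b2 \<le> L" using y1 y2 bnd(2) L M0 by linarith
      then have "b2 \<le> L" using ge1[OF 2] L by blast
      then show ?thesis using C(1) rM by linarith
    qed
  next
    case True
    \<comment> \<open>With \<open>q = 0\<close> and \<open>u = 0\<close> the bounds
      \<open>x2\<close> and \<open>y1\<close> are free of \<open>b0\<close> and \<open>b2\<close>,
      so comparing \<open>z1\<close> with \<open>z2\<close> relates these two alone. The error is at
      most \<open>2 * L\<close>; the factor 10 in \<open>C\<close> is generous.\<close>
    have main: "s * b2 \<le> w * b0 + C"
      using z1 z2 x1 x2 y1 y2 bnd True L M0 unfolding C_def by (simp; linarith)
    consider "1 \<le> s" | "s = 0" "1 \<le> w" | "s = 0" "w = 0" using int by blast
    then show ?thesis
    proof cases
      case 1
      have "w * b0 \<le> r0 * M" by (rule ml) (use rng b0 M0 in auto)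
      then have "s * b2 \<le> r0 * M + C" using main by linarith
      then have "b2 \<le> r0 * M + C" using ge1[OF 1 _ add_nonneg_nonneg[OF rM C(2)]] by blast
      then show ?thesis ..
    next
      case 2
      have "w * (- b0) \<le> C" using main 2 by simp
      then show ?thesis using ge1[OF 2(2)] C by blast
    next
      case 3
      \<comment> \<open>Here \<phi>1 \<phi>2 is generically an isomorphism, and
        \<open>r0 = a1\<close> with \<open>a1 \<le> r1\<close> gives the third excluded rank
        pattern.\<close>
      then have "r0 = r2" "r0 = a1" using True by (auto simp: s_def w_def q_def)
      then show ?thesis using ne(3) a by auto
    qed
  qed
  have nn: "0 \<le> r0 * C" "0 \<le> r0 * M" "0 \<le> r2 * (r0 * M + C)" using C M0(1) by auto
  have "- b0 \<le> Q \<and> b2 \<le> Q"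
    using key
  proof
    assume b: "- b0 \<le> C"
    have "r0 * (- b0) \<le> r0 * C" by (rule mult_left_mono[OF b]) simp
    then have "r2 * b2 \<le> L + r0 * C" using t'(1) by (simp only: mult_minus_right; linarith)
    then have "b2 \<le> L + r0 * C" using ge1[OF r1'(3) _ add_nonneg_nonneg[OF L(1) nn(1)]] by blast
    then show ?thesis using b nn L C M0(1) unfolding Q_def by linarith
  next
    assume b: "b2 \<le> r0 * M + C"
    have "r2 * b2 \<le> r2 * (r0 * M + C)" by (rule mult_left_mono[OF b]) simp
    then have "r0 * (- b0) \<le> L + r2 * (r0 * M + C)" using t'(2) by (simp only: mult_minus_right; linarith)
    then have "- b0 \<le> L + r2 * (r0 * M + C)" using ge1[OF r1'(1) _ add_nonneg_nonneg[OF L(1) nn(3)]] by blast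
    then show ?thesis using b nn L C M0(1) unfolding Q_def by linarith
  qed
  moreover have "M \<le> Q" using nn L C M0(1) unfolding Q_def by linarith
  ultimately show "\<bar>b0\<bar> \<le> Q" "\<bar>b2\<bar> \<le> Q" using b0 b2 by linarith+
qed

section \<open>Linear chains\<close>

definition std_space :: "nat \<Rightarrow> (nat \<Rightarrow> 'k::field) set" where
  "std_space r = {v. \<forall>i\<ge>r. v i = 0}"

text \<open>Between standard spaces this one formula gives inclusions, coordinate projections and,
  for \<open>m = 0\<close>, the zero map.\<close>

definition truncate :: "nat \<Rightarrow> (nat \<Rightarrow> 'k::field) \<Rightarrow> nat \<Rightarrow> 'k" where
  "truncate m v = (\<lambda>i. if i < m then v i else 0)"

definition unit_seq :: "nat \<Rightarrow> nat \<Rightarrow> 'k::field" where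
  "unit_seq i = (\<lambda>j. if j = i then 1 else 0)"

lemma sum_fun_at: "(\<Sum>i\<in>I. f i) x = (\<Sum>i\<in>I. f i x)" for f :: "'i \<Rightarrow> 'a \<Rightarrow> 'k::field"
  by (induction I rule: infinite_finite_induct) auto

lemma subspace_std_space: "fspace.subspace (std_space r)"
  by (rule fspace.subspaceI) (auto simp: std_space_def fscale_def)

lemma std_space_span: "(std_space r :: (nat \<Rightarrow> 'k::field) set) = fspace.span (unit_seq ` {..<r})"
proof
  show "fspace.span (unit_seq ` {..<r}) \<subseteq> (std_space r :: (nat \<Rightarrow> 'k) set)"
    by (rule fspace.span_minimal[OF _ subspace_std_space]) (auto simp: std_space_def unit_seq_def)
  show "std_space r \<subseteq> (fspace.span (unit_seq ` {..<r}) :: (nat \<Rightarrow> 'k) set)"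
  proof
    fix v :: "nat \<Rightarrow> 'k" assume v: "v \<in> std_space r"
    have "v = (\<Sum>i<r. fscale (v i) (unit_seq i))"
    proof
      fix x
      have "(\<Sum>i<r. fscale (v i) (unit_seq i)) x = (\<Sum>i<r. if i = x then v i else 0)"
        unfolding sum_fun_at by (rule sum.cong) (auto simp: fscale_def unit_seq_def)
      also have "\<dots> = v x" using v by (auto simp: std_space_def)
      finally show "v x = (\<Sum>i<r. fscale (v i) (unit_seq i)) x" by simp
    qed
    moreover have "(\<Sum>i<r. fscale (v i) (unit_seq i)) \<in> fspace.span (unit_seq ` {..<r})"
      by (intro fspace.span_sum fspace.span_scale fspace.span_base) auto
    ultimately show "v \<in> fspace.span (unit_seq ` {..<r})" by simp
  qed
qed

lemma dim_std_space: "fspace.dim (std_space r :: (nat \<Rightarrow> 'k::field) set) = r"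
proof -
  have inj: "inj_on (unit_seq :: nat \<Rightarrow> nat \<Rightarrow> 'k) {..<r}"
    by (rule inj_onI) (metis unit_seq_def zero_neq_one)
  have "fspace.independent (unit_seq ` {..<r} :: (nat \<Rightarrow> 'k) set)"
  proof (rule fspace.independent_if_scalars_zero)
    fix f :: "(nat \<Rightarrow> 'k) \<Rightarrow> 'k" and x :: "nat \<Rightarrow> 'k"
    assume s: "(\<Sum>x\<in>unit_seq ` {..<r}. fscale (f x) x) = 0" and x: "x \<in> unit_seq ` {..<r}"
    obtain i where i: "i < r" "x = unit_seq i" using x by auto
    have "(\<Sum>j<r. fscale (f (unit_seq j)) (unit_seq j)) = 0"
      using s by (simp add: sum.reindex[OF inj])
    then have "(\<Sum>j<r. fscale (f (unit_seq j)) (unit_seq j)) i = 0" by simp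
    then have "(\<Sum>j<r. if j = i then f (unit_seq j) else 0) = 0"
      unfolding sum_fun_at by (simp add: fscale_def unit_seq_def if_distrib cong: if_cong)
    then show "f x = 0" using i by simp
  qed simp
  then have "fspace.dim (std_space r :: (nat \<Rightarrow> 'k) set) = card (unit_seq ` {..<r} :: (nat \<Rightarrow> 'k) set)"
    unfolding std_space_span by (simp add: fspace.dim_span fspace.dim_eq_card_independent)
  then show ?thesis by (simp add: card_image[OF inj])
qed

text \<open>Dimension is monotone only among finite-dimensional spaces, and the space of all
  sequences is not one; the standard space provides the finite bound.\<close>

lemma dim_le_in_std_space:
  assumes "W \<subseteq> W'" "W' \<subseteq> (std_space r :: (nat \<Rightarrow> 'k::field) set)"
  shows "fspace.dim W \<le> fspace.dim W'"
proof -
  obtain B where B: "B \<subseteq> W'" "fspace.independent B" "W' \<subseteq> fspace.span B" "card B = fspace.dim W'"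
    using fspace.basis_exists by blast
  have "finite B"
    using fspace.independent_span_bound[of "unit_seq ` {..<r}" B] B assms(2) std_space_span[of r] by blast
  then have "fspace.dim W \<le> card B"
    using fspace.dim_le_card[of W B] assms(1) B(3) by blast
  then show ?thesis using B(4) by simp
qed

lemma linear_chain_std:
  assumes "m 1 \<le> r0" "m 2 \<le> r1"
  shows "linear_chain (\<lambda>j. std_space ([r0, r1, r2] ! j)) (\<lambda>i. truncate (m i))"
  unfolding linear_chain_def
proof (intro conjI allI impI ballI)
  show "\<exists>B. finite B \<and> std_space ([r0, r1, r2] ! j) = fspace.span B" for j
    using std_space_span by blast
  show "truncate (m i) ` std_space ([r0, r1, r2] ! i) \<subseteq> std_space ([r0, r1, r2] ! (i - 1))"
    if "i \<in> {1, 2}" for i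
    using that assms by (auto simp: std_space_def truncate_def)
qed (auto simp: truncate_def fscale_def fun_eq_iff)

lemma linear_chain_type_std:
  "linear_chain_type (\<lambda>j. std_space ([r0, r1, r2] ! j) :: (nat \<Rightarrow> 'k::field) set) = (r0, r1, r2)"
  by (simp add: linear_chain_type_def dim_std_space)

text \<open>The zero subchain has slope 0 / 0 = 0, and the chains below have slope 0 or 1, so the
  inequality can be asked of every subchain.\<close>

lemma semistable_linear_chainI:
  fixes r0 r1 r2 :: nat
  defines "V \<equiv> \<lambda>j. std_space ([r0, r1, r2] ! j) :: (nat \<Rightarrow> 'k::field) set"
  assumes "\<And>W. linear_subchain W V f \<Longrightarrow> linear_slope \<alpha> W \<le> linear_slope \<alpha> V"
  shows "semistable_linear_chain \<alpha> V f"
  using assms(2) by (auto simp: semistable_linear_chain_def)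

lemma linear_slope_eq:
  "linear_slope ((!) [0, \<alpha>1, \<alpha>2]) W = (\<alpha>1 * fspace.dim (W 1) + \<alpha>2 * fspace.dim (W 2)) /
    (real (fspace.dim (W 0)) + real (fspace.dim (W 1)) + real (fspace.dim (W 2)))"
  by (simp add: linear_slope_def sum_3)

lemma truncate_id: "v \<in> std_space r \<Longrightarrow> r \<le> m \<Longrightarrow> truncate m v = v"
  by (auto simp: std_space_def truncate_def fun_eq_iff)

lemma exists_semistable_linear_chain:
  fixes r0 r1 r2 :: nat
  assumes pos: "r0 > 0" "r1 > 0" "r2 > 0" and r: "r0 = r1 \<or> r1 = r2 \<or> (r0 = r2 \<and> r0 \<le> r1)"
  shows "\<exists>\<alpha>1 \<alpha>2. (\<alpha>1, \<alpha>2) \<noteq> (0, 0) \<and> (\<exists>(V :: nat \<Rightarrow> (nat \<Rightarrow> 'k::field) set) f.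
    linear_chain V f \<and> linear_chain_type V = (r0, r1, r2) \<and> semistable_linear_chain ((!) [0, \<alpha>1, \<alpha>2]) V f)"
proof -
  define V where "V = (\<lambda>j. std_space ([r0, r1, r2] ! j) :: (nat \<Rightarrow> 'k) set)"
  have dimV: "fspace.dim (V 0) = r0" "fspace.dim (V 1) = r1" "fspace.dim (V 2) = r2"
    by (simp_all add: V_def dim_std_space)
  have goal: ?thesis
    if "m 1 \<le> r0" "m 2 \<le> r1" "(\<alpha>1, \<alpha>2) \<noteq> (0, 0)"
      "\<And>W. linear_subchain W V (\<lambda>i. truncate (m i)) \<Longrightarrow>
        linear_slope ((!) [0, \<alpha>1, \<alpha>2]) W \<le> linear_slope ((!) [0, \<alpha>1, \<alpha>2]) V" for m :: "nat \<Rightarrow> nat" and \<alpha>1 \<alpha>2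
  proof -
    have "linear_chain V (\<lambda>i. truncate (m i))" "linear_chain_type V = (r0, r1, r2)"
      "semistable_linear_chain ((!) [0, \<alpha>1, \<alpha>2]) V (\<lambda>i. truncate (m i))"
      unfolding V_def using linear_chain_std[of m r0 r1 r2] linear_chain_type_std
        semistable_linear_chainI that[unfolded V_def] by blast+
    then show ?thesis using that(3) by blast
  qed
  have sub: "W j \<subseteq> std_space ([r0, r1, r2] ! j)" "truncate (m 1) ` W 1 \<subseteq> W 0" "truncate (m 2) ` W 2 \<subseteq> W 1"
    if "linear_subchain W V (\<lambda>i. truncate (m i))" "j < 3" for W m j
    using that by (auto simp: linear_subchain_def V_def)
  from r show ?thesis
  proof (elim disjE conjE)
    assume e: "r0 = r1"
    show ?thesis
    \<comment> \<open>The first map is the identity and the second is zero. The parameters make the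
      slope of the whole chain 1, and a subchain has slope at most 1 as soon as its dimension at 1
      does not exceed that at 0.\<close>
    proof (rule goal[of "\<lambda>i. if i = 1 then r1 else 0" 2 1])
      fix W assume W: "linear_subchain W V (\<lambda>i. truncate (if i = 1 then r1 else 0))"
      note S = sub[OF W]
      have W0: "W 0 \<subseteq> std_space r0" and W1: "W 1 \<subseteq> std_space r1" using S(1)[of 0] S(1)[of 1] by simp_all
      have "v \<in> W 0" if v: "v \<in> W 1" for v
        using S(2)[of 0] v truncate_id[of v r1 r1] W1 by force
      then have "fspace.dim (W 1) \<le> fspace.dim (W 0)" by (intro dim_le_in_std_space[OF _ W0] subsetI)
      then show "linear_slope ((!) [0, 2, 1]) W \<le> linear_slope ((!) [0, 2, 1]) V"
        unfolding linear_slope_eq dimV using e pos by (auto simp: divide_le_eq_1)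
    qed (use e in auto)
  next
    assume e: "r1 = r2"
    show ?thesis
    \<comment> \<open>Now the second map is the identity. The slope of the whole chain is 0, and the
      numerator for a subchain is its dimension at 2 minus that at 1.\<close>
    proof (rule goal[of "\<lambda>i. if i = 2 then r2 else 0" "- 1" 1])
      fix W assume W: "linear_subchain W V (\<lambda>i. truncate (if i = 2 then r2 else 0))"
      note S = sub[OF W]
      have W1: "W 1 \<subseteq> std_space r1" and W2: "W 2 \<subseteq> std_space r2" using S(1)[of 1] S(1)[of 2] by simp_all
      have "v \<in> W 1" if v: "v \<in> W 2" for v
        using S(3)[of 0] v truncate_id[of v r2 r2] W2 by force
      then have "fspace.dim (W 2) \<le> fspace.dim (W 1)" by (intro dim_le_in_std_space[OF _ W1] subsetI)
      then have "linear_slope ((!) [0, - 1, 1]) W \<le> 0"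
        unfolding linear_slope_eq by (intro divide_nonpos_nonneg) auto
      moreover have "linear_slope ((!) [0, - 1, 1]) V = 0" unfolding linear_slope_eq dimV e by simp
      ultimately show "linear_slope ((!) [0, - 1, 1]) W \<le> linear_slope ((!) [0, - 1, 1]) V" by simp
    qed (use e in auto)
  next
    assume e: "r0 = r2" "r0 \<le> r1"
    show ?thesis
    \<comment> \<open>An inclusion followed by a projection, with the identity as composite. Again
      the whole chain has slope 1; a subchain has at most that because its dimension at 2 does not
      exceed that at 0.\<close>
    proof (rule goal[of "\<lambda>i. r0" 1 2])
      fix W assume W: "linear_subchain W V (\<lambda>i. truncate r0)"
      note S = sub[OF W]
      have W0: "W 0 \<subseteq> std_space r0" and W2: "W 2 \<subseteq> std_space r0" using S(1)[of 0] S(1)[of 2] e by simp_all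
      have "v \<in> W 0" if v: "v \<in> W 2" for v
      proof -
        have t: "truncate r0 v = v" using truncate_id W2 v by blast
        then have "v \<in> W 1" using S(3)[of 0] v by force
        then show ?thesis using S(2)[of 0] t by force
      qed
      then have "fspace.dim (W 2) \<le> fspace.dim (W 0)" by (intro dim_le_in_std_space[OF _ W0] subsetI)
      then have "linear_slope ((!) [0, 1, 2]) W \<le> 1"
        unfolding linear_slope_eq by (auto simp: divide_le_eq_1)
      moreover have "linear_slope ((!) [0, 1, 2]) V = 1"
        unfolding linear_slope_eq dimV e(1) using pos by (simp add: divide_eq_1_iff)
      ultimately show "linear_slope ((!) [0, 1, 2]) W \<le> linear_slope ((!) [0, 1, 2]) V" by simp
    qed (use e in auto)
  qed
qed

section \<open>Bounded parameters\<close>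

lemma sheaf_hom_comp:
  assumes "sheaf_hom F G \<phi>" "sheaf_hom G H \<psi>"
  shows "sheaf_hom F H (\<lambda>U s. \<psi> U (\<phi> U s))"
  unfolding sheaf_hom_def
proof (intro allI impI conjI ballI; (elim conjE)?)
  fix U :: "'a set" assume U: "open U"
  note P = sheaf_homD[OF assms(1) U] and Q = sheaf_homD[OF assms(2) U]
  show "\<psi> U (\<phi> U s) \<in> H U" if "s \<in> F U" for s using Q(1)[OF P(1)[OF that]] .
  show "\<psi> U (\<phi> U (s + t)) = \<psi> U (\<phi> U s) + \<psi> U (\<phi> U t)" if "s \<in> F U" "t \<in> F U" for s t
    unfolding P(2)[OF that] Q(2)[OF P(1)[OF that(1)] P(1)[OF that(2)]] ..
  show "\<psi> U (\<phi> U (fmult U f s)) = fmult U f (\<psi> U (\<phi> U s))" if "s \<in> F U" "holo_fun U f" for f s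
    unfolding P(3)[OF that] Q(3)[OF P(1)[OF that(1)] that(2)] ..
  show "\<psi> V (\<phi> V (restr V s)) = restr V (\<psi> U (\<phi> U s))" if "s \<in> F U" "open V" "V \<subseteq> U" for V s
    unfolding P(4)[OF that] Q(4)[OF P(1)[OF that(1)] that(2,3)] ..
qed

lemma semistable_chain_bound:
  fixes r0 r1 r2 :: nat and d0 d1 d2 :: real
  assumes pos: "r0 > 0" "r1 > 0" "r2 > 0" and ne: "r0 \<noteq> r1" "r1 \<noteq> r2" "\<not> (r0 = r2 \<and> r0 \<le> r1)"
  obtains B where "\<And>E \<phi> \<alpha>1 \<alpha>2. holomorphic_chain E \<phi> \<Longrightarrow>
      chain_type (E :: nat \<Rightarrow> 'a::compact_riemann_surface sheaf) = (r0, r1, r2, d0, d1, d2) \<Longrightarrow>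
      semistable_chain ((!) [0, \<alpha>1, \<alpha>2]) E \<phi> \<Longrightarrow> \<bar>\<alpha>1\<bar> \<le> B \<and> \<bar>\<alpha>2\<bar> \<le> B"
proof -
  define M where "M = \<bar>d0\<bar> + \<bar>d1\<bar> + \<bar>d2\<bar>"
  define K where "K = M * (1 + real r0 + real r2)"
  define L where "L = M + real r1 * K"
  define C where "C = 10 * L"
  define Q where "Q = L + r0 * C + r2 * (r0 * M + C) + r0 * M + C + M"
  \<comment> \<open>The parameters are the differences \<open>b1 - b0\<close> and
    \<open>b2 - b0\<close>, bounded by \<open>K + Q\<close> and \<open>Q + Q\<close>; one constant
    covers both.\<close>
  have "\<bar>\<alpha>1\<bar> \<le> K + Q + Q \<and> \<bar>\<alpha>2\<bar> \<le> K + Q + Q"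
    if E: "holomorphic_chain E \<phi>" and ty: "chain_type E = (r0, r1, r2, d0, d1, d2)"
      and ss: "semistable_chain ((!) [0, \<alpha>1, \<alpha>2]) E \<phi>" for E :: "nat \<Rightarrow> 'a sheaf" and \<phi> \<alpha>1 \<alpha>2
  proof -
    have v: "vector_bundle (E 0)" "vector_bundle (E 1)" "vector_bundle (E 2)"
      and h: "sheaf_hom (E 1) (E 0) (\<phi> 1)" "sheaf_hom (E 2) (E 1) (\<phi> 2)"
      using E by (auto simp: holomorphic_chain_def)
    note m = vector_bundleD(1)[OF v(1)] vector_bundleD(1)[OF v(2)] vector_bundleD(1)[OF v(3)]
    have rk: "rk (E 0) = r0" "rk (E 1) = r1" "rk (E 2) = r2"
      and dg: "degree (E 0) = d0" "degree (E 1) = d1" "degree (E 2) = d2"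
      using ty by (auto simp: chain_type_def)
    have h21: "sheaf_hom (E 2) (E 0) (\<lambda>U s. \<phi> 1 U (\<phi> 2 U s))" by (rule sheaf_hom_comp[OF h(2,1)])
    define N1 I1 where "N1 = ker_sheaf (E 1) (\<phi> 1)" and "I1 = im_sheaf (E 1) (E 0) (\<phi> 1)"
    define N2 I2 where "N2 = ker_sheaf (E 2) (\<phi> 2)" and "I2 = im_sheaf (E 2) (E 1) (\<phi> 2)"
    define N I where "N = ker_sheaf (E 2) (\<lambda>U s. \<phi> 1 U (\<phi> 2 U s))"
      and "I = im_sheaf (E 2) (E 0) (\<lambda>U s. \<phi> 1 U (\<phi> 2 U s))"
    note k1 = ker_im_vector_bundle[OF v(2,1) h(1), folded N1_def I1_def] degree_ker_im[OF v(2,1) h(1), folded N1_def I1_def]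
    note k2 = ker_im_vector_bundle[OF v(3,2) h(2), folded N2_def I2_def] degree_ker_im[OF v(3,2) h(2), folded N2_def I2_def]
    note k = ker_im_vector_bundle[OF v(3,1) h21, folded N_def I_def] degree_ker_im[OF v(3,1) h21, folded N_def I_def]
    \<comment> \<open>One zero sheaf fills the empty places of all eight subchains. Its only section
      is 0, so it lies in each \<open>E j\<close>.\<close>
    define Z0 where "Z0 = ker_sheaf (E 0) (\<lambda>U s. s)"
    note z = ker_id_bundle[OF v(1), folded Z0_def]
    have zsub: "Z0 U \<subseteq> E j U" if "open U" "j < 3" for U j
    proof -
      have "vector_bundle (E j)" using E that(2) by (simp add: holomorphic_chain_def)
      then show ?thesis using z(4)[OF that(1)] module_sheafD(1)[OF vector_bundleD(1) that(1)] by simp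
    qed
    have z1: "\<phi> 1 U s \<in> F U" if "open U" "s \<in> Z0 U" "vector_bundle F" for U s F
      using that z(4)[OF that(1)] sheaf_hom_zero[OF h(1) that(1) m(2)] module_sheafD(1)[OF vector_bundleD(1)[OF that(3)] that(1)]
      by (metis singletonD)
    have z2: "\<phi> 2 U s \<in> F U" if "open U" "s \<in> Z0 U" "vector_bundle F" for U s F
      using that z(4)[OF that(1)] sheaf_hom_zero[OF h(2) that(1) m(3)] module_sheafD(1)[OF vector_bundleD(1)[OF that(3)] that(1)]
      by (metis singletonD)
    have n1: "N1 U \<subseteq> E 1 U" "\<And>s. s \<in> N1 U \<Longrightarrow> \<phi> 1 U s = 0" for U unfolding N1_def ker_sheaf_def by blast+
    have n2: "N2 U \<subseteq> E 2 U" "\<And>s. s \<in> N2 U \<Longrightarrow> \<phi> 2 U s = 0" for U unfolding N2_def ker_sheaf_def by blast+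
    have n: "N U \<subseteq> E 2 U" for U unfolding N_def ker_sheaf_def by blast
    have i: "I1 U \<subseteq> E 0 U" "I2 U \<subseteq> E 1 U" "I U \<subseteq> E 0 U" for U
      unfolding I1_def I2_def I_def by (rule im_sheaf_subset)+
    have e1: "\<phi> 1 U s \<in> E 0 U" "\<phi> 1 U s \<in> I1 U" if "open U" "s \<in> E 1 U" for U s
      using sheaf_homD(1)[OF h(1) that] im_sheaf_image[OF m(1) h(1) that] by (auto simp: I1_def)
    have e2: "\<phi> 2 U s \<in> E 1 U" "\<phi> 2 U s \<in> I2 U" if "open U" "s \<in> E 2 U" for U s
      using sheaf_homD(1)[OF h(2) that] im_sheaf_image[OF m(2) h(2) that] by (auto simp: I2_def)
    have z0: "0 \<in> Z0 U" if "open U" for U using z(4)[OF that] by simp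
    \<comment> \<open>The kernels of \<phi>1 and of \<phi>1 \<phi>2 form a subchain.\<close>
    have n12: "\<phi> 2 U s \<in> N1 U" if "open U" "s \<in> N U" for U s
      using that e2(1)[OF that(1)] n unfolding N_def N1_def ker_sheaf_def by blast
    \<comment> \<open>A section of im \<phi>2 lifts locally along \<phi>2, so its image under
      \<phi>1 lifts locally along the composite; hence the images form a subchain together with the
      whole of \<open>E 2\<close>.\<close>
    have i12: "\<phi> 1 U t \<in> I U" if U: "open U" and t: "t \<in> I2 U" for U t
      unfolding I_def
    proof (rule im_sheafI)
      have tE: "t \<in> E 1 U" using t i(2) by blast
      then show "\<phi> 1 U t \<in> E 0 U" using e1(1)[OF U] by blast
      fix x assume "x \<in> U"
      then obtain V s where V: "open V" "x \<in> V" "V \<subseteq> U" "s \<in> E 2 V" "\<phi> 2 V s = restr V t"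
        using im_sheafE[OF t[unfolded I2_def]] by metis
      have "\<phi> 1 V (\<phi> 2 V s) = restr V (\<phi> 1 U t)"
        unfolding V(5) by (rule sheaf_homD(4)[OF h(1) U tE V(1,3)])
      then show "\<exists>V s. open V \<and> x \<in> V \<and> V \<subseteq> U \<and> s \<in> E 2 V \<and> \<phi> 1 V (\<phi> 2 V s) = restr V (\<phi> 1 U t)"
        using V by blast
    qed
    define \<mu> where "\<mu> = slope ((!) [0, \<alpha>1, \<alpha>2]) E"
    have rpos: "(\<Sum>j<3. rk (E j)) > 0" using pos by (simp add: sum_3 rk)
    note ineq = semistable_chain_inequality[OF E ss rpos, folded \<mu>_def]
    define b0 b1 b2 where "b0 = - \<mu>" and "b1 = \<alpha>1 - \<mu>" and "b2 = \<alpha>2 - \<mu>"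
    have al: "[0, \<alpha>1, \<alpha>2] ! 0 - \<mu> = b0" "[0, \<alpha>1, \<alpha>2] ! 1 - \<mu> = b1" "[0, \<alpha>1, \<alpha>2] ! 2 - \<mu> = b2"
      by (simp_all add: b0_def b1_def b2_def)
    note ineq = ineq[unfolded al]
    note zs = z(2,3)
    have d: "degree N1 = d1 - degree I1" "degree N2 = d2 - degree I2" "degree N = d2 - degree I"
      using k1(6) k2(6) k(6) dg by auto
    have rr: "real (rk N1) = real r1 - real (rk I1)" "real (rk N2) = real r2 - real (rk I2)"
      "real (rk N) = real r2 - real (rk I)"
      using k1(3) k2(3) k(3) rk by auto
    have "\<mu> = (d0 + (d1 + \<alpha>1 * r1) + (d2 + \<alpha>2 * r2)) / real (r0 + r1 + r2)"
      unfolding \<mu>_def slope_def sum_3 rk dg by simp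
    moreover have "real (r0 + r1 + r2) \<noteq> 0" using pos by linarith
    ultimately have "\<mu> * real (r0 + r1 + r2) = d0 + (d1 + \<alpha>1 * r1) + (d2 + \<alpha>2 * r2)" by (metis nonzero_eq_divide_eq)
    then have tot: "d0 + d1 + d2 + b0 * r0 + b1 * r1 + b2 * r2 = 0"
      by (simp add: b0_def b1_def b2_def algebra_simps)
    have zsub': "Z0 U \<subseteq> E 0 U" "Z0 U \<subseteq> E 1 U" "Z0 U \<subseteq> E 2 U" if "open U" for U
      using zsub[OF that] by simp_all
    \<comment> \<open>The disjunctions list the targets that occur in the eight subchains, so that
      the simplifier can settle the side conditions by itself.\<close>
    have z1': "\<phi> 1 U s \<in> F U" if "open U" "s \<in> Z0 U" "F = E 0 \<or> F = Z0" for U s F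
      using z1[OF that(1,2)] v z(1) that(3) by blast
    have z2': "\<phi> 2 U s \<in> F U" if "open U" "s \<in> Z0 U" "F = E 1 \<or> F = Z0 \<or> F = N1" for U s F
      using z2[OF that(1,2)] v z(1) k1(1) that(3) by blast
    have n1': "\<phi> 1 U s \<in> Z0 U" if "open U" "s \<in> N1 U" for U s
      unfolding n1(2)[OF that(2)] by (rule z0[OF that(1)])
    have n2': "\<phi> 2 U s \<in> Z0 U" if "open U" "s \<in> N2 U" for U s
      unfolding n2(2)[OF that(2)] by (rule z0[OF that(1)])
    note sub = zsub' z1' z2' n1(1) n1' n2(1) n2' n i e1 e2 n12 i12
    note eval = dg rk zs d rr
    have S1: "d0 + b0 * r0 \<le> 0"
      using ineq[OF v(1) z(1) z(1)] by (simp add: sub eval del: One_nat_def)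
    have S2: "d0 + b0 * r0 + (d1 + b1 * r1) \<le> 0"
      using ineq[OF v(1) v(2) z(1)] by (simp add: sub eval del: One_nat_def)
    have S3: "(d2 - degree I2) + b2 * (real r2 - real (rk I2)) \<le> 0"
      using ineq[OF z(1) z(1) k2(1)] by (simp add: sub eval del: One_nat_def)
    have S4: "(d1 - degree I1) + b1 * (real r1 - real (rk I1)) \<le> 0"
      using ineq[OF z(1) k1(1) z(1)] by (simp add: sub eval del: One_nat_def)
    have S5: "degree I1 + b0 * rk I1 + (d1 + b1 * r1) + (d2 + b2 * r2) \<le> 0"
      using ineq[OF k1(2) v(2) v(3)] by (simp add: sub eval del: One_nat_def)
    \<comment> \<open>That \<phi>1 maps im \<phi>2 into \<open>E 0\<close> follows from the
      inclusion of im \<phi>2 in \<open>E 1\<close>, which is supplied as an extra rule.\<close>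
    have S6: "d0 + b0 * r0 + (degree I2 + b1 * rk I2) + (d2 + b2 * r2) \<le> 0"
      using ineq[OF v(1) k2(2) v(3)] by (simp add: sub e1(1)[OF _ subsetD[OF i(2)]] eval del: One_nat_def)
    have S7: "(d1 - degree I1) + b1 * (real r1 - real (rk I1)) + ((d2 - degree I) + b2 * (real r2 - real (rk I))) \<le> 0"
      using ineq[OF z(1) k1(1) k(1)] by (simp add: sub eval del: One_nat_def)
    have S8: "degree I + b0 * rk I + (degree I2 + b1 * rk I2) + (d2 + b2 * r2) \<le> 0"
      using ineq[OF k(2) k2(2) v(3)] by (simp add: sub eval del: One_nat_def)
    have a: "rk I1 \<le> r0" "rk I1 \<le> r1" "rk I2 \<le> r1" "rk I2 \<le> r2" "rk I \<le> r0" "rk I \<le> r2"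
      using k1(3,4) k2(3,4) k(3,4) rk by auto
    note pb = parameter_bound[OF pos ne a M_def tot S1 S2 S3 S4 S5 S6 S7 S8]
    have "\<bar>b1\<bar> \<le> K" "\<bar>b0\<bar> \<le> Q" "\<bar>b2\<bar> \<le> Q"
      using pb unfolding Q_def C_def L_def K_def by blast+
    moreover have "0 \<le> K" "0 \<le> Q" using calculation by linarith+
    moreover have "\<alpha>1 = b1 - b0" "\<alpha>2 = b2 - b0" by (simp_all add: b0_def b1_def b2_def)
    ultimately show ?thesis by linarith
  qed
  then show ?thesis using that by blast
qed

theorem theorem5p5:
  fixes r0 r1 r2 :: nat
  assumes "genus TYPE('a::compact_riemann_surface) \<ge> 2"
    and "r0 > 0" "r1 > 0" "r2 > 0"
    and "\<forall>\<alpha>1 \<alpha>2 :: real.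
      (\<exists>(V :: nat \<Rightarrow> (nat \<Rightarrow> 'a mero) set) f.
         linear_chain V f \<and> linear_chain_type V = (r0, r1, r2) \<and>
         semistable_linear_chain ((!) [0, \<alpha>1, \<alpha>2]) V f)
      \<longleftrightarrow> (\<alpha>1, \<alpha>2) = (0, 0)"
  shows "\<forall>d0 d1 d2 :: int. \<exists>R :: (real \<times> real) set. bounded R \<and>
    (\<forall>\<alpha>1 \<alpha>2 :: real.
      (\<exists>(E :: nat \<Rightarrow> 'a sheaf) \<phi>.
         holomorphic_chain E \<phi> \<and>
         chain_type E = (r0, r1, r2, of_int d0, of_int d1, of_int d2) \<and>
         semistable_chain ((!) [0, \<alpha>1, \<alpha>2]) E \<phi>)
      \<longrightarrow> (\<alpha>1, \<alpha>2) \<in> R)"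
proof (intro allI)
  fix d0 d1 d2 :: int
  have "\<not> (r0 = r1 \<or> r1 = r2 \<or> (r0 = r2 \<and> r0 \<le> r1))"
    using exists_semistable_linear_chain[OF assms(2-4), where 'k = "'a mero"] assms(5) by blast
  then have ne: "r0 \<noteq> r1" "r1 \<noteq> r2" "\<not> (r0 = r2 \<and> r0 \<le> r1)" by auto
  obtain B where B: "\<And>E \<phi> \<alpha>1 \<alpha>2. holomorphic_chain E \<phi> \<Longrightarrow>
      chain_type (E :: nat \<Rightarrow> 'a sheaf) = (r0, r1, r2, of_int d0, of_int d1, of_int d2) \<Longrightarrow>
      semistable_chain ((!) [0, \<alpha>1, \<alpha>2]) E \<phi> \<Longrightarrow> \<bar>\<alpha>1\<bar> \<le> B \<and> \<bar>\<alpha>2\<bar> \<le> B"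
    using semistable_chain_bound[OF assms(2-4) ne] by metis
  show "\<exists>R :: (real \<times> real) set. bounded R \<and>
    (\<forall>\<alpha>1 \<alpha>2 :: real.
      (\<exists>(E :: nat \<Rightarrow> 'a sheaf) \<phi>.
         holomorphic_chain E \<phi> \<and>
         chain_type E = (r0, r1, r2, of_int d0, of_int d1, of_int d2) \<and>
         semistable_chain ((!) [0, \<alpha>1, \<alpha>2]) E \<phi>)
      \<longrightarrow> (\<alpha>1, \<alpha>2) \<in> R)"
  proof (intro exI[of _ "{- B..B} \<times> {- B..B}"] conjI allI impI)
    show "bounded ({- B..B} \<times> {- B..B})" by (intro bounded_Times bounded_closed_interval)
    fix \<alpha>1 \<alpha>2 :: real
    assume "\<exists>(E :: nat \<Rightarrow> 'a sheaf) \<phi>. holomorphic_chain E \<phi> \<and>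
         chain_type E = (r0, r1, r2, of_int d0, of_int d1, of_int d2) \<and>
         semistable_chain ((!) [0, \<alpha>1, \<alpha>2]) E \<phi>"
    then have "\<bar>\<alpha>1\<bar> \<le> B \<and> \<bar>\<alpha>2\<bar> \<le> B" using B by blast
    then show "(\<alpha>1, \<alpha>2) \<in> {- B..B} \<times> {- B..B}" by auto
  qed
qed

end
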